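(* For the algebra $\mathcal{A}=S^{-1}A$ the following statements are equivalent: 1. $\mathcal{A}$ is a regular algebra. 2. $\mathfrak{D}(\mathcal{A})$ is a simple algebra. 3. $\mathcal{A}$ is a simple $\mathfrak{D}(\mathcal{A})$-module.
   Context: $K$ is a field of characteristic zero, $P_n=K[x_1,\ldots,x_n]$, $I=\sum_{i=1}^m P_nf_i$ is a prime but not maximal ideal of $P_n$ with generators $f_1,\ldots,f_m$, and $A=P_n/I$, a domain with field of fractions $Q$. $S$ is a multiplicatively closed subset of $A$ (with $0\notin S$) and $\mathcal{A}=S^{-1}A\subseteq Q$. $\overline{J}=\left(\overline{\partial f_i/\partial x_j}\right)\in M_{m,n}(A)$ is the Jacobi matrix (entries reduced modulo $I$) and $r$ is its rank over $Q$. For tuples $\mathbf{i}=(i_1,\ldots,i_r)$ of indices in $\{1,\ldots,m\}$ and $\mathbf{j}=(j_1,\ldots,j_r)$ of indices in $\{1,\ldots,n\}$, $\Delta(\mathbf{i};j_1,\ldots,j_r)=\det(\overline{J}_{i_\nu,j_\mu})_{\nu,\mu=1,\ldots,r}$. A strictly increasing $\mathbf{i}$ (resp. $\mathbf{j}$) is non-singular if $\Delta(\mathbf{i},\mathbf{j}')\ne0$ for some $\mathbf{j}'$ (resp. $\Delta(\mathbf{i}',\mathbf{j})\neq0$ for some $\mathbf{i}'$); $\mathbf{I}_r$ (resp. $\mathbf{J}_r$) is the set of non-singular strictly increasing $r$-tuples $\mathbf{i}$ (resp. $\mathbf{j}$). $\mathbf{J}_{r+1}$ is the set of strictly increasing $(r+1)$-tuples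 of indices in $\{1,\ldots,n\}$ such that deleting some element leaves an element of $\mathbf{J}_r$. For $\mathbf{i}\in\mathbf{I}_r$, $\mathbf{j}=(j_1,\ldots,j_{r+1})\in\mathbf{J}_{r+1}$, $\partial_{\mathbf{i},\mathbf{j}}=\sum_{k=1}^{r+1}(-1)^{r+1+k}\Delta(\mathbf{i};j_1,\ldots,\widehat{j_k},\ldots,j_{r+1})\,\partial/\partial x_{j_k}$ (hat means omitted), i.e. the well-defined $K$-derivation of $A$ sending $x_{j_k}$ to $(-1)^{r+1+k}\Delta(\mathbf{i};j_1,\ldots,\widehat{j_k},\ldots,j_{r+1})$ and $x_l$ to $0$ for $l\notin\{j_1,\ldots,j_{r+1}\}$, extended uniquely to $\mathcal{A}$. The module of natural derivations of $\mathcal{A}$ is $\mathrm{der}_K(\mathcal{A})=\sum_{\mathbf{i}\in\mathbf{I}_r,\mathbf{j}\in\mathbf{J}_{r+1}}\mathcal{A}\,\partial_{\mathbf{i},\mathbf{j}}\subseteq\mathrm{Der}_K(\mathcal{A})$, and the algebra of natural differential operators $\mathfrak{D}(\mathcal{A})$ is the subalgebra of $\mathrm{End}_K(\mathcal{A})$ (equivalently, of the ring of differential operators $\mathcal{D}(\mathcal{A})$) generated by $\mathcal{A}$ and $\mathrm{der}_K(\mathcal{A})$. Modules are left modules. *)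

theory Defs
  imports
    "HOL-Library.Poly_Mapping"
    "HOL-Library.FuncSet"
    "HOL-Library.Extended_Nat"
    "HOL-Algebra.QuotRing"
    "HOL-Algebra.Ring_Divisibility"
    "HOL-Algebra.Generated_Rings"
    "Jordan_Normal_Form.Determinant"
    "Jordan_Normal_Form.DL_Rank"
begin

text \<open>Tuples of indices are lists, and all indices run from 0: the variables are
  \<open>x\<^sub>0, \<dots>, x\<^sub>n\<^sub>-\<^sub>1\<close> and the generators \<open>f\<^sub>0, \<dots>, f\<^sub>m\<^sub>-\<^sub>1\<close>.\<close>

definition subring_of :: "'a::ring_1 set \<Rightarrow> 'a ring" where
  "subring_of X = \<lparr>carrier = X, monoid.mult = (*), one = 1, ring.zero = 0, add = (+)\<rparr>"


section \<open>Polynomial rings\<close>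

type_synonym 'k mpoly = "(nat \<Rightarrow>\<^sub>0 nat) \<Rightarrow>\<^sub>0 'k"

definition poly_ring :: "nat \<Rightarrow> ('k::field mpoly) ring" where
  "poly_ring n = subring_of {p. \<forall>t\<in>Poly_Mapping.keys p. Poly_Mapping.keys t \<subseteq> {..<n}}"

definition Const :: "'k::field \<Rightarrow> 'k mpoly" where
  "Const c = Poly_Mapping.single 0 c"

definition Var :: "nat \<Rightarrow> 'k::field mpoly" where
  "Var j = Poly_Mapping.single (Poly_Mapping.single j 1) 1"

text \<open>Monomials without \<open>x\<^sub>j\<close> contribute 0 because of the factor \<open>lookup t j\<close>.\<close>

definition pdiff :: "nat \<Rightarrow> 'k::field mpoly \<Rightarrow> 'k mpoly" where
  "pdiff j p = (\<Sum>t\<in>Poly_Mapping.keys p.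
     Poly_Mapping.single (t - Poly_Mapping.single j 1) (of_nat (Poly_Mapping.lookup t j) * Poly_Mapping.lookup p t))"


section \<open>Fractions\<close>

text \<open>The type \<open>'q\<close> together with the embedding \<open>\<iota>\<close> is a field of fractions of the domain \<open>A\<close>.\<close>

definition fraction_field :: "('a, 'b) ring_scheme \<Rightarrow> ('a \<Rightarrow> 'q::field) \<Rightarrow> bool" where
  "fraction_field A \<iota> \<longleftrightarrow>
     \<iota> \<in> Ring.ring_hom A (subring_of UNIV) \<and> inj_on \<iota> (carrier A) \<and>
     (\<forall>q. \<exists>a\<in>carrier A. \<exists>b\<in>carrier A. \<iota> b \<noteq> 0 \<and> q = \<iota> a / \<iota> b)"

definition fractions :: "'q::field set \<Rightarrow> 'q set \<Rightarrow> 'q set" where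
  "fractions R S = {a / s | a s. a \<in> R \<and> s \<in> S}"


section \<open>Regular rings\<close>

definition prime_chain :: "('a, 'b) ring_scheme \<Rightarrow> nat \<Rightarrow> (nat \<Rightarrow> 'a set) \<Rightarrow> bool" where
  "prime_chain R l \<pp> \<longleftrightarrow> (\<forall>i\<le>l. primeideal (\<pp> i) R) \<and> (\<forall>i<l. \<pp> i \<subset> \<pp> (Suc i))"

definition krull_dim :: "('a, 'b) ring_scheme \<Rightarrow> enat" where
  "krull_dim R = Sup {enat l | l. \<exists>\<pp>. prime_chain R l \<pp>}"

definition regular_local_ring :: "('a, 'b) ring_scheme \<Rightarrow> bool" where
  "regular_local_ring R \<longleftrightarrow>
     cring R \<and> noetherian_ring R \<and>
     (\<exists>\<mm>. maximalideal \<mm> R \<and> (\<forall>\<mm>'. maximalideal \<mm>' R \<longrightarrow> \<mm>' = \<mm>) \<and>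
       (\<exists>d g. krull_dim R = enat d \<and> g ` {..<d} \<subseteq> carrier R \<and> \<mm> = genideal R (g ` {..<d})))"

text \<open>For a subring \<open>R\<close> of a field. The localization of \<open>R\<close> at a prime ideal \<open>\<pp>\<close>
  is formed inside the field.\<close>

definition regular :: "'q::field set \<Rightarrow> bool" where
  "regular R \<longleftrightarrow>
     noetherian_ring (subring_of R) \<and>
     (\<forall>\<pp>. primeideal \<pp> (subring_of R) \<longrightarrow> regular_local_ring (subring_of (fractions R (R - \<pp>))))"


section \<open>Simple rings and simple left modules\<close>

definition simple_ring :: "('a, 'b) ring_scheme \<Rightarrow> bool" where
  "simple_ring R \<longleftrightarrow>
     ring R \<and> carrier R \<noteq> {\<zero>\<^bsub>R\<^esub>} \<and> (\<forall>J. ideal J R \<longrightarrow> J = {\<zero>\<^bsub>R\<^esub>} \<or> J = carrier R)"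

text \<open>The library locale \<open>module\<close> requires a commutative ring of scalars.\<close>

definition left_module :: "('a, 'c) ring_scheme \<Rightarrow> ('a, 'b, 'd) module_scheme \<Rightarrow> bool" where
  "left_module R M \<longleftrightarrow>
     ring R \<and> abelian_group M \<and>
     (\<forall>a\<in>carrier R. \<forall>x\<in>carrier M. a \<odot>\<^bsub>M\<^esub> x \<in> carrier M) \<and>
     (\<forall>a\<in>carrier R. \<forall>b\<in>carrier R. \<forall>x\<in>carrier M.
        (a \<oplus>\<^bsub>R\<^esub> b) \<odot>\<^bsub>M\<^esub> x = a \<odot>\<^bsub>M\<^esub> x \<oplus>\<^bsub>M\<^esub> b \<odot>\<^bsub>M\<^esub> x) \<and>
     (\<forall>a\<in>carrier R. \<forall>x\<in>carrier M. \<forall>y\<in>carrier M.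
        a \<odot>\<^bsub>M\<^esub> (x \<oplus>\<^bsub>M\<^esub> y) = a \<odot>\<^bsub>M\<^esub> x \<oplus>\<^bsub>M\<^esub> a \<odot>\<^bsub>M\<^esub> y) \<and>
     (\<forall>a\<in>carrier R. \<forall>b\<in>carrier R. \<forall>x\<in>carrier M.
        (a \<otimes>\<^bsub>R\<^esub> b) \<odot>\<^bsub>M\<^esub> x = a \<odot>\<^bsub>M\<^esub> (b \<odot>\<^bsub>M\<^esub> x)) \<and>
     (\<forall>x\<in>carrier M. \<one>\<^bsub>R\<^esub> \<odot>\<^bsub>M\<^esub> x = x)"

definition simple_left_module :: "('a, 'c) ring_scheme \<Rightarrow> ('a, 'b, 'd) module_scheme \<Rightarrow> bool" where
  "simple_left_module R M \<longleftrightarrow>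
     left_module R M \<and> carrier M \<noteq> {\<zero>\<^bsub>M\<^esub>} \<and>
     (\<forall>N. Module.submodule N R M \<longrightarrow> N = {\<zero>\<^bsub>M\<^esub>} \<or> N = carrier M)"


section \<open>Endomorphisms and derivations\<close>

text \<open>The \<open>K\<close>-algebra structure of the subring \<open>R\<close> is given by \<open>\<kappa> : K \<rightarrow> R\<close>.
  Endomorphisms of \<open>R\<close> are extensional functions, so that they are determined by their values on \<open>R\<close>.\<close>

definition End_ring :: "('k \<Rightarrow> 'q::field) \<Rightarrow> 'q set \<Rightarrow> ('q \<Rightarrow> 'q) ring" where
  "End_ring \<kappa> R =
     \<lparr>carrier = {D \<in> R \<rightarrow>\<^sub>E R. (\<forall>x\<in>R. \<forall>y\<in>R. D (x + y) = D x + D y) \<and>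
                            (\<forall>c. \<forall>x\<in>R. D (\<kappa> c * x) = \<kappa> c * D x)},
      monoid.mult = (\<lambda>D E. compose R D E), one = (\<lambda>x\<in>R. x),
      ring.zero = (\<lambda>x\<in>R. 0), add = (\<lambda>D E. \<lambda>x\<in>R. D x + E x)\<rparr>"

definition Der :: "('k \<Rightarrow> 'q::field) \<Rightarrow> 'q set \<Rightarrow> ('q \<Rightarrow> 'q) set" where
  "Der \<kappa> R = {D \<in> carrier (End_ring \<kappa> R). \<forall>x\<in>R. \<forall>y\<in>R. D (x * y) = D x * y + x * D y}"


section \<open>Minors of the Jacobi matrix\<close>

definition index_tuples :: "nat \<Rightarrow> nat \<Rightarrow> nat list set" where
  "index_tuples k N = {v. length v = k \<and> set v \<subseteq> {..<N}}"

definition increasing_tuples :: "nat \<Rightarrow> nat \<Rightarrow> nat list set" where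
  "increasing_tuples k N = {v \<in> index_tuples k N. sorted_wrt (<) v}"

definition delete_nth :: "nat \<Rightarrow> 'a list \<Rightarrow> 'a list" where
  "delete_nth k v = take k v @ drop (Suc k) v"

definition minor :: "'q::field mat \<Rightarrow> nat list \<Rightarrow> nat list \<Rightarrow> 'q" where
  "minor J iv jv = det (mat (length iv) (length jv) (\<lambda>(\<nu>, \<mu>). J $$ (iv ! \<nu>, jv ! \<mu>)))"

definition mat_rank :: "'q::field mat \<Rightarrow> nat" where
  "mat_rank J = vec_space.rank (dim_row J) J"

definition nonsing_rows :: "'q::field mat \<Rightarrow> nat list set" where
  "nonsing_rows J = (let r = mat_rank J in
     {iv \<in> increasing_tuples r (dim_row J). \<exists>jv\<in>index_tuples r (dim_col J). minor J iv jv \<noteq> 0})"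

definition nonsing_cols :: "'q::field mat \<Rightarrow> nat list set" where
  "nonsing_cols J = (let r = mat_rank J in
     {jv \<in> increasing_tuples r (dim_col J). \<exists>iv\<in>index_tuples r (dim_row J). minor J iv jv \<noteq> 0})"

text \<open>The set \<open>\<^bold>J\<^sub>r\<^sub>+\<^sub>1\<close>.\<close>

definition nonsing_cols_Suc :: "'q::field mat \<Rightarrow> nat list set" where
  "nonsing_cols_Suc J = (let r = mat_rank J in
     {jv \<in> increasing_tuples (Suc r) (dim_col J). \<exists>k\<le>r. delete_nth k jv \<in> nonsing_cols J})"


section \<open>Natural derivations and natural differential operators\<close>

text \<open>Here \<open>bar\<close> is the reduction map from polynomials to \<open>A \<subseteq> Q\<close>, and \<open>J\<close> the Jacobi matrix.
  Counting positions \<open>k\<close> in \<open>jv\<close> from 0 turns the sign \<open>(-1)\<^sup>r\<^sup>+\<^sup>1\<^sup>+\<^sup>k\<close> into \<open>(-1)\<^sup>r\<^sup>+\<^sup>k\<close>.\<close>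

definition nat_derivation ::
  "nat \<Rightarrow> ('k::field mpoly \<Rightarrow> 'q::field) \<Rightarrow> 'q mat \<Rightarrow> 'q set \<Rightarrow> nat list \<Rightarrow> nat list \<Rightarrow> 'q \<Rightarrow> 'q" where
  "nat_derivation n bar J R iv jv = (let r = mat_rank J in
     THE D. D \<in> Der (\<lambda>c. bar (Const c)) R \<and>
       (\<forall>k\<le>r. D (bar (Var (jv ! k))) = (-1) ^ (r + k) * minor J iv (delete_nth k jv)) \<and>
       (\<forall>l<n. l \<notin> set jv \<longrightarrow> D (bar (Var l)) = 0))"

definition nat_der ::
  "nat \<Rightarrow> ('k::field mpoly \<Rightarrow> 'q::field) \<Rightarrow> 'q mat \<Rightarrow> 'q set \<Rightarrow> ('q \<Rightarrow> 'q) set" where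
  "nat_der n bar J R =
     {\<lambda>x\<in>R. \<Sum>iv\<in>nonsing_rows J. \<Sum>jv\<in>nonsing_cols_Suc J. a iv jv * nat_derivation n bar J R iv jv x
      | a. \<forall>iv\<in>nonsing_rows J. \<forall>jv\<in>nonsing_cols_Suc J. a iv jv \<in> R}"

text \<open>The generated subring is the generated subalgebra, since \<open>K\<close> acts through multiplications
  by elements of \<open>R\<close>.\<close>

definition nat_diff_ops ::
  "nat \<Rightarrow> ('k::field mpoly \<Rightarrow> 'q::field) \<Rightarrow> 'q mat \<Rightarrow> 'q set \<Rightarrow> ('q \<Rightarrow> 'q) ring" where
  "nat_diff_ops n bar J R = (let E = End_ring (\<lambda>c. bar (Const c)) R in
     E\<lparr>carrier := generate_ring E ({\<lambda>x\<in>R. a * x | a. a \<in> R} \<union> nat_der n bar J R)\<rparr>)"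

definition evaluation_module :: "'q::field set \<Rightarrow> ('q \<Rightarrow> 'q, 'q) module" where
  "evaluation_module R =
     \<lparr>carrier = R, monoid.mult = (*), one = 1, ring.zero = 0, add = (+), smult = (\<lambda>D x. D x)\<rparr>"


section \<open>The setting\<close>

text \<open>\<open>A = P\<^sub>n / I\<close> has field of fractions \<open>'q\<close> via \<open>\<iota>\<close>.\<close>

definition reduction ::
  "nat \<Rightarrow> 'k::field mpoly set \<Rightarrow> ('k mpoly set \<Rightarrow> 'q::field) \<Rightarrow> 'k mpoly \<Rightarrow> 'q" where
  "reduction n I \<iota> p = \<iota> (I +>\<^bsub>poly_ring n\<^esub> p)"

definition jacobi_matrix ::
  "nat \<Rightarrow> nat \<Rightarrow> (nat \<Rightarrow> 'k::field mpoly) \<Rightarrow> ('k mpoly \<Rightarrow> 'q::field) \<Rightarrow> 'q mat" where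
  "jacobi_matrix m n f bar = mat m n (\<lambda>(i, j). bar (pdiff j (f i)))"

end

theory Submission imports Defs begin

text \<open>
  Write \<open>B\<close> for the polynomial ring and, for a prime \<open>N\<close> of \<open>B\<close>, let \<open>grad_rank N\<close> be the rank modulo \<open>N\<close> of
  the gradients of its elements. It is the height of \<open>N\<close>, but all that is needed is that it increases
  strictly along chains of primes, and that locally \<open>N\<close> is generated by that many elements with
  independent gradients; both follow by adding one variable at a time and dividing with
  remainder. Hence the localization of \<open>A\<close> at a prime with contraction \<open>N \<supseteq> I\<close> has dimension at most
  \<open>grad_rank N - grad_rank I\<close>, and comparing this with the number of generators of its maximal ideal
  gives: it is regular iff \<open>r\<close> rows of the Jacobi matrix are independent modulo \<open>N\<close>, that is, iff some
  minor of order \<open>r\<close> is not in the prime. The chain of primes that bounds the dimension from below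
  consists of the largest ideals inside the maximal ideal that are stable under the derivations
  killing the first few generators; in characteristic zero such ideals are prime.

  A prime containing all minors of order \<open>r\<close> contains the images of all natural derivations, so it is
  a submodule. Conversely, if every prime avoids some minor, then the natural derivations preserving a
  stable prime with contraction \<open>N\<close> force \<open>grad_rank N \<le> r = grad_rank I\<close>, so \<open>N = I\<close>. The equivalence of
  simplicity of the ring and of the module is formal: commutators with multiplications
  lower the order of a differential operator.
\<close>

section \<open>Subrings, ideals and primes as sets\<close>

text \<open>Regularity asks for the exact Krull dimension of each local ring. The usual tools for
  it, namely the height theorem, the dimension formula and transcendence degrees, are replaced by
  linear algebra. Statements over a residue field are phrased inside a domain \<open>R\<close>
  modulo a prime \<open>N\<close>, with multipliers outside \<open>N\<close> in place of
  denominators; the same lemmas then serve polynomial rings, localizations and the field itself with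
  the prime {0}. Characteristic zero enters in two ways. A polynomial of least degree for an
  algebraic variable has a derivative outside the prime, which makes the gradients of the local
  generators independent. And positive integers are invertible, which makes the radical of a stable
  ideal stable; the resulting primes serve both the lower bound of the dimension and the passage
  from a stable ideal to a stable prime. Nakayama's lemma appears only as the removal of a redundant
  element from a smallest generating set.\<close>

locale subring_set =
  fixes R :: "'a::comm_ring_1 set"
  assumes zero_mem [simp, intro]: "0 \<in> R"
    and one_mem [simp, intro]: "1 \<in> R"
    and add_mem [simp, intro]: "x \<in> R \<Longrightarrow> y \<in> R \<Longrightarrow> x + y \<in> R"
    and mult_mem [simp, intro]: "x \<in> R \<Longrightarrow> y \<in> R \<Longrightarrow> x * y \<in> R"
    and uminus_mem [simp, intro]: "x \<in> R \<Longrightarrow> - x \<in> R"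
begin

lemma diff_mem [simp, intro]: "x \<in> R \<Longrightarrow> y \<in> R \<Longrightarrow> x - y \<in> R"
  using add_mem[of x "- y"] by simp

lemma sum_mem [intro]: "(\<And>i. i \<in> X \<Longrightarrow> g i \<in> R) \<Longrightarrow> sum g X \<in> R"
  by (induction X rule: infinite_finite_induct) auto

lemma prod_mem [intro]: "(\<And>i. i \<in> X \<Longrightarrow> g i \<in> R) \<Longrightarrow> prod g X \<in> R"
  by (induction X rule: infinite_finite_induct) auto

lemma power_mem [simp, intro]: "x \<in> R \<Longrightarrow> x ^ k \<in> R"
  by (induction k) auto

lemma of_nat_mem [simp, intro]: "of_nat k \<in> R"
  by (induction k) auto

lemma cring_subring_of: "cring (subring_of R)"
proof (rule cringI)
  show "abelian_group (subring_of R)"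
  proof (rule abelian_groupI)
    show "\<exists>y\<in>carrier (subring_of R). y \<oplus>\<^bsub>subring_of R\<^esub> x = \<zero>\<^bsub>subring_of R\<^esub>"
      if "x \<in> carrier (subring_of R)" for x
      using that by (intro bexI[of _ "- x"]) (auto simp: subring_of_def)
  qed (auto simp: subring_of_def algebra_simps)
  show "Group.comm_monoid (subring_of R)"
    by (rule comm_monoidI) (auto simp: subring_of_def algebra_simps)
qed (auto simp: subring_of_def algebra_simps)

end

lemma subring_set_UNIV: "subring_set UNIV"
  by unfold_locales auto

lemma subring_of_simps [simp]:
  "carrier (subring_of R) = R" "\<zero>\<^bsub>subring_of R\<^esub> = 0" "\<one>\<^bsub>subring_of R\<^esub> = 1"
  "x \<oplus>\<^bsub>subring_of R\<^esub> y = x + y" "x \<otimes>\<^bsub>subring_of R\<^esub> y = x * y"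
  by (simp_all add: subring_of_def)

lemma (in subring_set) a_inv_subring_of: "x \<in> R \<Longrightarrow> \<ominus>\<^bsub>subring_of R\<^esub> x = - x"
proof -
  interpret cring "subring_of R" by (rule cring_subring_of)
  show "x \<in> R \<Longrightarrow> \<ominus>\<^bsub>subring_of R\<^esub> x = - x"
    using sum_zero_eq_neg[of "- x" x] by simp
qed

locale ideal_set = subring_set R for R :: "'a::comm_ring_1 set" +
  fixes N :: "'a set"
  assumes subset: "N \<subseteq> R"
    and zero_in [simp, intro]: "0 \<in> N"
    and add_in [simp, intro]: "x \<in> N \<Longrightarrow> y \<in> N \<Longrightarrow> x + y \<in> N"
    and mult_in_right [simp, intro]: "x \<in> R \<Longrightarrow> y \<in> N \<Longrightarrow> x * y \<in> N"
begin

lemma in_ring: "x \<in> N \<Longrightarrow> x \<in> R"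
  using subset by auto

lemma mult_in_left [simp, intro]: "x \<in> N \<Longrightarrow> y \<in> R \<Longrightarrow> x * y \<in> N"
  using mult_in_right[of y x] by (simp add: mult.commute)

lemma uminus_in [simp, intro]: "x \<in> N \<Longrightarrow> - x \<in> N"
  using mult_in_right[of "-1" x] by simp

lemma diff_in [simp, intro]: "x \<in> N \<Longrightarrow> y \<in> N \<Longrightarrow> x - y \<in> N"
  using add_in[of x "- y"] by simp

lemma sum_in [intro]: "(\<And>i. i \<in> X \<Longrightarrow> g i \<in> N) \<Longrightarrow> sum g X \<in> N"
  by (induction X rule: infinite_finite_induct) auto

lemma diff_in_imp: "x - y \<in> N \<Longrightarrow> y \<in> N \<Longrightarrow> x \<in> N"
  using add_in[of "x - y" y] by simp

lemma ideal_subring_of: "ideal N (subring_of R)"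
proof (rule idealI)
  interpret cring "subring_of R" by (rule cring_subring_of)
  show "ring (subring_of R)" by unfold_locales
  show "subgroup N (add_monoid (subring_of R))"
  proof (rule group.subgroupI)
    show "Group.group (add_monoid (subring_of R))" by (rule add.group_axioms)
    fix a assume "a \<in> N"
    then have "inv\<^bsub>add_monoid (subring_of R)\<^esub> a = - a"
      using a_inv_subring_of[of a] in_ring by (simp add: a_inv_def)
    then show "inv\<^bsub>add_monoid (subring_of R)\<^esub> a \<in> N" using \<open>a \<in> N\<close> by simp
  qed (use subset in auto)
qed auto

end

lemma (in subring_set) ideal_subring_of_iff: "ideal N (subring_of R) \<longleftrightarrow> ideal_set R N"
proof
  assume "ideal N (subring_of R)"
  then interpret ideal N "subring_of R" .
  have A: "additive_subgroup N (subring_of R)" by unfold_locales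
  show "ideal_set R N"
    using additive_subgroup.zero_closed[OF A] I_l_closed additive_subgroup.a_closed[OF A] a_subset
    by unfold_locales auto
next
  assume "ideal_set R N"
  then interpret ideal_set R N .
  show "ideal N (subring_of R)" by (rule ideal_subring_of)
qed

locale prime_set = ideal_set +
  assumes one_notin [simp]: "1 \<notin> N"
    and prime_in: "x \<in> R \<Longrightarrow> y \<in> R \<Longrightarrow> x * y \<in> N \<Longrightarrow> x \<in> N \<or> y \<in> N"
begin

lemma mult_notin: "x \<in> R \<Longrightarrow> y \<in> R \<Longrightarrow> x \<notin> N \<Longrightarrow> y \<notin> N \<Longrightarrow> x * y \<notin> N"
  using prime_in by blast

lemma power_notin: "x \<in> R \<Longrightarrow> x \<notin> N \<Longrightarrow> x ^ k \<notin> N"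
  by (induction k) (auto dest: prime_in)

lemma prod_notin: "(\<And>i. i \<in> X \<Longrightarrow> g i \<in> R \<and> g i \<notin> N) \<Longrightarrow> prod g X \<notin> N"
proof (induction X rule: infinite_finite_induct)
  case (insert x X)
  then show ?case using mult_notin[of "g x" "prod g X"] prod_mem[of X g] by auto
qed auto

end

lemma (in subring_set) primeideal_subring_of_iff:
  "primeideal N (subring_of R) \<longleftrightarrow> prime_set R N"
proof
  assume "primeideal N (subring_of R)"
  then interpret primeideal N "subring_of R" .
  interpret I: ideal_set R N using ideal_subring_of_iff is_ideal by simp
  show "prime_set R N"
  proof
    show "1 \<notin> N"
    proof
      assume "1 \<in> N"
      then have "R \<subseteq> N" using I.mult_in_right[of _ 1] by auto
      then show False using I_notcarr I.subset by auto
    qed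
  qed (use I_prime in auto)
next
  assume "prime_set R N"
  then interpret P: prime_set R N .
  show "primeideal N (subring_of R)"
  proof (rule primeidealI)
    show "carrier (subring_of R) \<noteq> N" using P.one_notin one_mem by (metis subring_of_simps(1))
  qed (use P.ideal_subring_of cring_subring_of P.prime_in in auto)
qed

lemma (in subring_set) genideal_eq:
  assumes "finite X" "g ` X \<subseteq> R"
  shows "genideal (subring_of R) (g ` X) = {\<Sum>i\<in>X. a i * g i | a. \<forall>i\<in>X. a i \<in> R}" (is "_ = ?G")
proof
  interpret G: ideal_set R ?G
  proof
    show "?G \<subseteq> R" using assms by (auto intro!: sum_mem)
    show "0 \<in> ?G" by (intro CollectI exI[of _ "\<lambda>_. 0"]) auto
    fix x y assume "x \<in> ?G" "y \<in> ?G"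
    then obtain a b where "x = (\<Sum>i\<in>X. a i * g i)" "y = (\<Sum>i\<in>X. b i * g i)"
      "\<forall>i\<in>X. a i \<in> R" "\<forall>i\<in>X. b i \<in> R" by auto
    then show "x + y \<in> ?G"
      by (intro CollectI exI[of _ "\<lambda>i. a i + b i"]) (auto simp: sum.distrib algebra_simps)
  next
    fix x y assume "x \<in> R" "y \<in> ?G"
    then obtain b where "y = (\<Sum>i\<in>X. b i * g i)" "\<forall>i\<in>X. b i \<in> R" by auto
    then show "x * y \<in> ?G" using \<open>x \<in> R\<close>
      by (intro CollectI exI[of _ "\<lambda>i. x * b i"]) (auto simp: sum_distrib_left algebra_simps)
  qed
  have "g ` X \<subseteq> ?G"
  proof
    fix y assume "y \<in> g ` X"
    then obtain i where i: "i \<in> X" "y = g i" by auto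
    show "y \<in> ?G"
      by (intro CollectI exI[of _ "\<lambda>j. if j = i then 1 else 0"])
        (use i assms in \<open>auto simp: if_distrib[of "\<lambda>x. x * _"] sum.delta cong: if_cong\<close>)
  qed
  then show "genideal (subring_of R) (g ` X) \<subseteq> ?G"
    unfolding genideal_def using G.ideal_subring_of by blast
  show "?G \<subseteq> genideal (subring_of R) (g ` X)"
  proof
    fix x assume "x \<in> ?G"
    then obtain a where a: "x = (\<Sum>i\<in>X. a i * g i)" "\<forall>i\<in>X. a i \<in> R" by auto
    show "x \<in> genideal (subring_of R) (g ` X)"
      unfolding genideal_def
    proof (clarify)
      fix L assume L: "ideal L (subring_of R)" "g ` X \<subseteq> L"
      interpret L: ideal_set R L using L(1) ideal_subring_of_iff by simp
      show "x \<in> L" using a L(2) by (auto intro!: L.sum_in)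
    qed
  qed
qed

section \<open>Noetherian rings and maximal ideals\<close>

lemma (in subring_set) noetherian_subring_ofI:
  assumes "\<And>N. ideal_set R N \<Longrightarrow> \<exists>F. finite F \<and> F \<subseteq> N \<and> (\<forall>x\<in>N. \<exists>a. (\<forall>y\<in>F. a y \<in> R) \<and> x = (\<Sum>y\<in>F. a y * y))"
  shows "noetherian_ring (subring_of R)"
proof -
  interpret cring "subring_of R" by (rule cring_subring_of)
  show ?thesis
  proof (rule noetherian_ringI)
    fix N assume "ideal N (subring_of R)"
    then interpret N: ideal_set R N using ideal_subring_of_iff by simp
    obtain F where F: "finite F" "F \<subseteq> N" "\<And>x. x \<in> N \<Longrightarrow> \<exists>a. (\<forall>y\<in>F. a y \<in> R) \<and> x = (\<Sum>y\<in>F. a y * y)"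
      using assms[OF N.ideal_set_axioms] by blast
    have "N = genideal (subring_of R) ((\<lambda>x. x) ` F)"
    proof (subst genideal_eq)
      show "(\<lambda>x. x) ` F \<subseteq> R" using F(2) N.subset by auto
      have "(\<Sum>y\<in>F. a y * y) \<in> N" if "\<forall>y\<in>F. a y \<in> R" for a
        using that F(2) by (auto intro!: N.sum_in)
      then show "N = {\<Sum>i\<in>F. a i * i |a. \<forall>i\<in>F. a i \<in> R}" using F(3) by blast
    qed (use F in auto)
    then show "\<exists>F\<subseteq>carrier (subring_of R). finite F \<and> N = genideal (subring_of R) F"
      using F(1,2) N.subset by (intro exI[of _ F]) auto
  qed
qed

text \<open>Zorn's lemma applied to the proper ideals above \<open>N\<close>: in a Noetherian ring
  the union of a nonempty chain of ideals is a member of the chain, hence still proper. The maximal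
  element is a maximal ideal and therefore prime.\<close>

lemma (in subring_set) noetherian_maximal_ideal:
  assumes "noetherian_ring (subring_of R)" "ideal_set R N" "1 \<notin> N"
  obtains M where "prime_set R M" "N \<subseteq> M"
proof -
  interpret cring "subring_of R" by (rule cring_subring_of)
  let ?C = "{M. ideal_set R M \<and> N \<subseteq> M \<and> 1 \<notin> M}"
  have "\<exists>U\<in>?C. \<forall>X\<in>c. X \<subseteq> U" if c: "subset.chain ?C c" for c
  proof (cases "c = {}")
    case True
    then show ?thesis using assms by blast
  next
    case False
    have sub: "c \<subseteq> ?C" using c by (simp add: subset_chain_def)
    have "subset.chain {I. ideal I (subring_of R)} c"
      unfolding subset_chain_def
    proof (intro conjI subsetI CollectI)
      fix M assume "M \<in> c"
      then have "ideal_set R M" using sub by auto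
      then show "ideal M (subring_of R)" by (simp add: ideal_subring_of_iff)
    qed (use c in \<open>simp add: subset_chain_def\<close>)
    then have "\<Union> c \<in> c"
      using noetherian_ring.ideal_chain_is_trivial[OF assms(1) False] by blast
    then show ?thesis using sub by (intro bexI[of _ "\<Union> c"]) blast+
  qed
  then obtain M where M: "M \<in> ?C" and max: "\<And>X. X \<in> ?C \<Longrightarrow> M \<subseteq> X \<Longrightarrow> X = M"
    using subset_Zorn[of ?C] by auto
  interpret M: ideal_set R M using M by simp
  have "maximalideal M (subring_of R)"
  proof (rule maximalidealI)
    fix X assume X: "ideal X (subring_of R)" "M \<subseteq> X" "X \<subseteq> carrier (subring_of R)"
    then interpret X: ideal_set R X using ideal_subring_of_iff by simp
    show "X = M \<or> X = carrier (subring_of R)"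
    proof (cases "1 \<in> X")
      case True
      then have "R \<subseteq> X" using X.mult_in_right[of _ 1] by auto
      then show ?thesis using X by auto
    next
      case False
      then show ?thesis using max[of X] M X X.ideal_set_axioms by auto
    qed
  qed (use M M.ideal_subring_of in auto)
  then have "prime_set R M"
    using maximalideal_prime primeideal_subring_of_iff by blast
  then show ?thesis using that M by auto
qed

section \<open>Linear algebra modulo a prime\<close>

text \<open>For a prime \<open>N\<close> this is linear independence, over the fraction field of
  \<open>R\<close>/\<open>N\<close>, of the vectors with entries \<open>u i j\<close>,
  \<open>j\<close> in \<open>C\<close>. Clearing denominators allows coefficients from
  \<open>R\<close>.\<close>

definition indep_mod :: "'a::comm_ring_1 set \<Rightarrow> 'a set \<Rightarrow> 'i set \<Rightarrow> ('i \<Rightarrow> 'c \<Rightarrow> 'a) \<Rightarrow> 'c set \<Rightarrow> bool" where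
  "indep_mod R N X u C \<longleftrightarrow>
     (\<forall>c. (\<forall>i\<in>X. c i \<in> R) \<and> (\<forall>j\<in>C. (\<Sum>i\<in>X. c i * u i j) \<in> N) \<longrightarrow> (\<forall>i\<in>X. c i \<in> N))"

text \<open>The multiplier \<open>s\<close> is the common denominator of a linear combination over
  the fraction field of \<open>R\<close>/\<open>N\<close>.\<close>

definition in_span_mod ::
  "'a::comm_ring_1 set \<Rightarrow> 'a set \<Rightarrow> 'i set \<Rightarrow> ('i \<Rightarrow> 'c \<Rightarrow> 'a) \<Rightarrow> 'c set \<Rightarrow> ('c \<Rightarrow> 'a) \<Rightarrow> bool" where
  "in_span_mod R N Y w C x \<longleftrightarrow>
     (\<exists>s\<in>R - N. \<exists>a. (\<forall>y\<in>Y. a y \<in> R) \<and> (\<forall>j\<in>C. s * x j - (\<Sum>y\<in>Y. a y * w y j) \<in> N))"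

lemma indep_modD:
  "indep_mod R N X u C \<Longrightarrow> (\<And>i. i \<in> X \<Longrightarrow> c i \<in> R) \<Longrightarrow> (\<And>j. j \<in> C \<Longrightarrow> (\<Sum>i\<in>X. c i * u i j) \<in> N)
    \<Longrightarrow> i \<in> X \<Longrightarrow> c i \<in> N"
  unfolding indep_mod_def by blast

lemma (in ideal_set) indep_mod_subset:
  assumes "indep_mod R N X u C" "Y \<subseteq> X" "finite X"
  shows "indep_mod R N Y u C"
  unfolding indep_mod_def
proof (intro allI impI ballI)
  fix c i assume c: "(\<forall>i\<in>Y. c i \<in> R) \<and> (\<forall>j\<in>C. (\<Sum>i\<in>Y. c i * u i j) \<in> N)" and i: "i \<in> Y"
  define c' where "c' i = (if i \<in> Y then c i else 0)" for i
  have "(\<Sum>i\<in>X. c' i * u i j) = (\<Sum>i\<in>Y. c i * u i j)" for j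
    by (rule sum.mono_neutral_cong_right) (use assms in \<open>auto simp: c'_def\<close>)
  then have "c' i \<in> N" using indep_modD[OF assms(1), of c' i] c i assms(2) by (auto simp: c'_def)
  then show "c i \<in> N" using i by (simp add: c'_def)
qed

context prime_set begin

text \<open>Gaussian elimination without division, by induction on the equations. A row that
  vanishes modulo \<open>N\<close> is dropped; otherwise an entry outside \<open>N\<close> is the
  pivot, and \<open>M'\<close> is the system with its column cleared.\<close>

lemma underdetermined_system:
  assumes "finite X" "finite Y" "card X < card Y" "\<And>x y. x \<in> X \<Longrightarrow> y \<in> Y \<Longrightarrow> M x y \<in> R"
  shows "\<exists>c. (\<forall>y\<in>Y. c y \<in> R) \<and> (\<exists>y\<in>Y. c y \<notin> N) \<and> (\<forall>x\<in>X. (\<Sum>y\<in>Y. M x y * c y) \<in> N)"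
  using assms
proof (induction X arbitrary: Y M rule: finite_induct)
  case empty
  then have "Y \<noteq> {}" by auto
  then show ?case by (intro exI[of _ "\<lambda>_. 1"]) auto
next
  case (insert x0 X)
  show ?case
  proof (cases "\<forall>y\<in>Y. M x0 y \<in> N")
    case True
    obtain c where c: "\<forall>y\<in>Y. c y \<in> R" "\<exists>y\<in>Y. c y \<notin> N" "\<forall>x\<in>X. (\<Sum>y\<in>Y. M x y * c y) \<in> N"
      using insert.IH[of Y M] insert.prems insert.hyps by auto
    have "(\<Sum>y\<in>Y. M x0 y * c y) \<in> N" using True c(1) by (auto intro!: sum_in)
    then show ?thesis using c by (intro exI[of _ c]) auto
  next
    case False
    then obtain y0 where y0: "y0 \<in> Y" "M x0 y0 \<notin> N" by auto
    define Y' where "Y' = Y - {y0}"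
    define M' where "M' x y = M x0 y0 * M x y - M x y0 * M x0 y" for x y
    have "card X < card Y'" "finite Y'"
      using insert.prems insert.hyps y0 by (auto simp: Y'_def)
    then obtain c where c: "\<forall>y\<in>Y'. c y \<in> R" "\<exists>y\<in>Y'. c y \<notin> N" "\<forall>x\<in>X. (\<Sum>y\<in>Y'. M' x y * c y) \<in> N"
      using insert.IH[of Y' M'] insert.prems y0 by (auto simp: M'_def Y'_def)
    \<comment> \<open>Back substitution multiplied through by the pivot: the value at
      \<open>y0\<close> makes equation \<open>x0\<close> hold exactly, and every other equation
      becomes its row of \<open>M'\<close>.\<close>
    define d where "d y = (if y = y0 then - (\<Sum>y\<in>Y'. M x0 y * c y) else M x0 y0 * c y)" for y
    have M0: "M x0 y0 \<in> R" using insert.prems y0 by auto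
    have dR: "\<forall>y\<in>Y. d y \<in> R"
      using c(1) insert.prems M0 by (auto simp: d_def Y'_def intro!: uminus_mem sum_mem mult_mem)
    have sum: "(\<Sum>y\<in>Y. M x y * d y) = (\<Sum>y\<in>Y'. M' x y * c y)" for x
    proof -
      have "(\<Sum>y\<in>Y. M x y * d y) = M x y0 * d y0 + (\<Sum>y\<in>Y'. M x y * d y)"
        using y0 insert.prems(1) by (simp add: Y'_def sum.remove)
      also have "(\<Sum>y\<in>Y'. M x y * d y) = (\<Sum>y\<in>Y'. M x y * (M x0 y0 * c y))"
        by (rule sum.cong) (auto simp: d_def Y'_def)
      also have "M x y0 * d y0 = - (\<Sum>y\<in>Y'. M x y0 * (M x0 y * c y))"
        by (simp add: d_def sum_distrib_left)
      finally show ?thesis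
        by (simp add: M'_def algebra_simps sum_subtractf)
    qed
    have "(\<Sum>y\<in>Y. M x0 y * d y) = 0" unfolding sum by (simp add: M'_def algebra_simps)
    moreover have "\<exists>y\<in>Y. d y \<notin> N"
    proof -
      obtain y where y: "y \<in> Y'" "c y \<notin> N" using c by auto
      then have "d y \<notin> N" using mult_notin[OF M0 _ y0(2) y(2)] c(1) by (auto simp: d_def Y'_def)
      then show ?thesis using y by (auto simp: Y'_def)
    qed
    ultimately show ?thesis using dR c(3) sum by (intro exI[of _ d]) auto
  qed
qed

text \<open>If \<open>X\<close> were larger than \<open>Y\<close>, the coefficient system would have
  a solution \<open>c\<close> that is nonzero modulo \<open>N\<close>; multiplied by the
  denominators \<open>s x\<close> it is a relation among the \<open>u x\<close>, against
  independence.\<close>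

lemma indep_mod_card_le:
  assumes fin: "finite X" "finite Y" and ind: "indep_mod R N X u C"
    and u: "\<And>x j. x \<in> X \<Longrightarrow> j \<in> C \<Longrightarrow> u x j \<in> R" and w: "\<And>y j. y \<in> Y \<Longrightarrow> j \<in> C \<Longrightarrow> w y j \<in> R"
    and span: "\<And>x. x \<in> X \<Longrightarrow> in_span_mod R N Y w C (u x)"
  shows "card X \<le> card Y"
proof (rule ccontr)
  assume "\<not> card X \<le> card Y"
  let ?P = "\<lambda>x s a. s \<in> R - N \<and> (\<forall>y\<in>Y. a y \<in> R) \<and> (\<forall>j\<in>C. s * u x j - (\<Sum>y\<in>Y. a y * w y j) \<in> N)"
  have "\<forall>x\<in>X. \<exists>s a. ?P x s a"
    using span unfolding in_span_mod_def by blast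
  from bchoice[OF this] obtain s where "\<forall>x\<in>X. \<exists>a. ?P x (s x) a" by blast
  from bchoice[OF this] obtain a where a: "\<forall>x\<in>X. ?P x (s x) (a x)" by blast
  have sa: "\<And>x. x \<in> X \<Longrightarrow> s x \<in> R - N" "\<And>x y. x \<in> X \<Longrightarrow> y \<in> Y \<Longrightarrow> a x y \<in> R"
    "\<And>x j. x \<in> X \<Longrightarrow> j \<in> C \<Longrightarrow> s x * u x j - (\<Sum>y\<in>Y. a x y * w y j) \<in> N"
    using a by blast+
  obtain c where c: "\<forall>x\<in>X. c x \<in> R" "\<exists>x\<in>X. c x \<notin> N" "\<forall>y\<in>Y. (\<Sum>x\<in>X. a x y * c x) \<in> N"
    using underdetermined_system[of Y X "\<lambda>y x. a x y"] fin sa \<open>\<not> card X \<le> card Y\<close> by auto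
  have "(\<Sum>x\<in>X. (c x * s x) * u x j) \<in> N" if j: "j \<in> C" for j
  proof -
    have "(\<Sum>x\<in>X. (c x * s x) * u x j) =
        (\<Sum>x\<in>X. c x * (s x * u x j - (\<Sum>y\<in>Y. a x y * w y j))) + (\<Sum>x\<in>X. \<Sum>y\<in>Y. c x * (a x y * w y j))"
      by (simp add: algebra_simps sum_subtractf sum_distrib_left)
    also have "(\<Sum>x\<in>X. \<Sum>y\<in>Y. c x * (a x y * w y j)) = (\<Sum>y\<in>Y. (\<Sum>x\<in>X. a x y * c x) * w y j)"
      by (subst sum.swap) (simp add: sum_distrib_left mult_ac)
    finally show ?thesis
      using sa(3)[OF _ j] c(1,3) w[OF _ j] by (simp add: add_in sum_in mult_in_right mult_in_left)
  qed
  moreover have "c x * s x \<in> R" if "x \<in> X" for x using c(1) sa(1)[OF that] that by auto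
  ultimately have "c x * s x \<in> N" if "x \<in> X" for x
    using indep_modD[OF ind, of "\<lambda>x. c x * s x"] that by blast
  moreover obtain x where "x \<in> X" "c x \<notin> N" using c(2) by auto
  ultimately show False using c(1) sa(1)[of x] prime_in[of "c x" "s x"] by auto
qed

text \<open>\<open>X\<close> has greatest cardinality among the independent sets between
  \<open>X0\<close> and \<open>Y\<close>. Adding a further \<open>y\<close> yields a relation whose
  coefficient at \<open>y\<close> is outside \<open>N\<close>, and this coefficient is the
  multiplier that puts \<open>u y\<close> in the span.\<close>

lemma exists_maximal_indep:
  assumes "finite Y" "X0 \<subseteq> Y" "indep_mod R N X0 u C"
    and u: "\<And>y j. y \<in> Y \<Longrightarrow> j \<in> C \<Longrightarrow> u y j \<in> R"
  obtains X where "X0 \<subseteq> X" "X \<subseteq> Y" "indep_mod R N X u C" "\<And>y. y \<in> Y \<Longrightarrow> in_span_mod R N X u C (u y)"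
proof -
  let ?P = "\<lambda>X. X0 \<subseteq> X \<and> X \<subseteq> Y \<and> indep_mod R N X u C"
  have bnd: "\<forall>X. ?P X \<longrightarrow> card X < Suc (card Y)"
    using assms(1) by (auto simp: less_Suc_eq_le intro: card_mono)
  have "?P X0" using assms by simp
  from ex_has_greatest_nat[of ?P X0 card, OF this bnd]
  obtain X where X: "?P X" and max: "\<And>Z. ?P Z \<Longrightarrow> card Z \<le> card X" by auto
  have finX: "finite X" using X assms(1) finite_subset by blast
  have "in_span_mod R N X u C (u y)" if y: "y \<in> Y" for y
  proof (cases "y \<in> X")
    case True
    have "(\<Sum>x\<in>X. (if x = y then 1 else 0) * u x j) = u y j" for j
      using True finX by (simp add: if_distrib[of "\<lambda>x. x * _"] sum.delta cong: if_cong)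
    then show ?thesis unfolding in_span_mod_def
      by (intro bexI[of _ 1] exI[of _ "\<lambda>x. if x = y then 1 else 0"]) auto
  next
    case False
    have "\<not> indep_mod R N (insert y X) u C"
      using max[of "insert y X"] X y False finX by auto
    then obtain c where c: "\<forall>i\<in>insert y X. c i \<in> R" "\<forall>j\<in>C. (\<Sum>i\<in>insert y X. c i * u i j) \<in> N"
      "\<exists>i\<in>insert y X. c i \<notin> N" unfolding indep_mod_def by blast
    have cs: "c y * u y j + (\<Sum>i\<in>X. c i * u i j) \<in> N" if "j \<in> C" for j
      using c(2) that False finX by (simp add: sum.insert)
    show ?thesis
    proof (cases "c y \<in> N")
      case False
      have "c y * u y j - (\<Sum>x\<in>X. - c x * u x j) \<in> N" if "j \<in> C" for j
        using cs[OF that] by (simp add: sum_negf)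
      then show ?thesis unfolding in_span_mod_def using False c(1)
        by (intro bexI[of _ "c y"] exI[of _ "\<lambda>x. - c x"]) auto
    next
      case True
      have "(\<Sum>i\<in>X. c i * u i j) \<in> N" if "j \<in> C" for j
        using diff_in[OF cs[OF that], of "c y * u y j"] True u[OF y] that by auto
      then have "\<forall>i\<in>X. c i \<in> N" using X c(1) unfolding indep_mod_def by auto
      then show ?thesis using c(3) True by auto
    qed
  qed
  then show ?thesis using that X by blast
qed

text \<open>Gaussian elimination without division: clearing the pivot column from the other rows keeps
  them independent, and a vector orthogonal to the reduced rows lifts.\<close>

lemma indep_mod_orthogonal:
  assumes "finite X" "finite C"
    and "\<And>x j. x \<in> X \<Longrightarrow> j \<in> C \<Longrightarrow> u x j \<in> R" "\<And>j. j \<in> C \<Longrightarrow> t j \<in> R"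
    and "\<And>c e. (\<And>i. i \<in> X \<Longrightarrow> c i \<in> R) \<Longrightarrow> e \<in> R \<Longrightarrow> (\<And>j. j \<in> C \<Longrightarrow> (\<Sum>i\<in>X. c i * u i j) + e * t j \<in> N)
           \<Longrightarrow> e \<in> N \<and> (\<forall>i\<in>X. c i \<in> N)"
  shows "\<exists>v. (\<forall>j\<in>C. v j \<in> R) \<and> (\<forall>x\<in>X. (\<Sum>j\<in>C. u x j * v j) = 0) \<and> (\<Sum>j\<in>C. t j * v j) \<notin> N"
  using assms
proof (induction X arbitrary: C u t rule: finite_induct)
  case empty
  have "\<exists>j\<in>C. t j \<notin> N"
    using empty.prems(4)[of "\<lambda>_. 0" 1] by auto
  then obtain j0 where j0: "j0 \<in> C" "t j0 \<notin> N" by auto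
  have "(\<Sum>j\<in>C. t j * (if j = j0 then 1 else 0)) = t j0"
    using j0 empty.prems(1) by (simp add: if_distrib[of "\<lambda>x. _ * x"] sum.delta cong: if_cong)
  then show ?case using j0 by (intro exI[of _ "\<lambda>j. if j = j0 then 1 else 0"]) auto
next
  case (insert x0 X)
  have "\<exists>j\<in>C. u x0 j \<notin> N"
  proof (rule ccontr)
    assume none: "\<not> (\<exists>j\<in>C. u x0 j \<notin> N)"
    define c where "c i = (if i = x0 then 1 else 0 :: 'a)" for i
    have "(\<Sum>i\<in>insert x0 X. c i * u i j) = u x0 j" for j
    proof -
      have "(\<Sum>i\<in>X. c i * u i j) = 0"
        by (rule sum.neutral) (use insert.hyps in \<open>auto simp: c_def\<close>)
      then show ?thesis using insert.hyps by (simp add: c_def)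
    qed
    moreover have "c i \<in> R" for i by (simp add: c_def)
    ultimately have "c x0 \<in> N" using insert.prems(4)[of c 0] none by auto
    then show False by (simp add: c_def)
  qed
  then obtain j0 where j0: "j0 \<in> C" "u x0 j0 \<notin> N" by auto
  define p where "p = u x0 j0"
  define C' where "C' = C - {j0}"
  define u' where "u' i j = p * u i j - u i j0 * u x0 j" for i j
  define t' where "t' j = p * t j - t j0 * u x0 j" for j
  have pR: "p \<in> R" and pN: "p \<notin> N" using insert.prems(2) j0 by (auto simp: p_def)
  have "\<exists>v. (\<forall>j\<in>C'. v j \<in> R) \<and> (\<forall>x\<in>X. (\<Sum>j\<in>C'. u' x j * v j) = 0) \<and> (\<Sum>j\<in>C'. t' j * v j) \<notin> N"
  proof (rule insert.IH)
    show "finite C'" using insert.prems by (simp add: C'_def)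
    show "u' x j \<in> R" if "x \<in> X" "j \<in> C'" for x j
      using that insert.prems(2) j0 pR by (auto simp: u'_def C'_def)
    show "t' j \<in> R" if "j \<in> C'" for j
      using that insert.prems(2,3) j0 pR by (auto simp: t'_def C'_def)
    fix c e assume c: "\<And>i. i \<in> X \<Longrightarrow> c i \<in> R" and e: "e \<in> R"
      and s: "\<And>j. j \<in> C' \<Longrightarrow> (\<Sum>i\<in>X. c i * u' i j) + e * t' j \<in> N"
    define q where "q = (\<Sum>i\<in>X. c i * u i j0) + e * t j0"
    define d where "d i = (if i = x0 then - q else p * c i)" for i
    have qR: "q \<in> R" using c e insert.prems(2,3) j0 by (auto simp: q_def intro!: add_mem sum_mem)
    have eq: "(\<Sum>i\<in>insert x0 X. d i * u i j) + (p * e) * t j = (\<Sum>i\<in>X. c i * u' i j) + e * t' j" for j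
    proof -
      have "(\<Sum>i\<in>X. d i * u i j) = (\<Sum>i\<in>X. p * c i * u i j)"
        by (rule sum.cong) (use insert.hyps in \<open>auto simp: d_def\<close>)
      then have "(\<Sum>i\<in>insert x0 X. d i * u i j) = - q * u x0 j + (\<Sum>i\<in>X. p * c i * u i j)"
        using insert.hyps by (simp add: d_def)
      then show ?thesis
        by (simp add: q_def u'_def t'_def algebra_simps sum_subtractf sum_distrib_left)
    qed
    have "(\<Sum>i\<in>insert x0 X. d i * u i j) + (p * e) * t j \<in> N" if "j \<in> C" for j
    proof (cases "j = j0")
      case True
      have "(\<Sum>i\<in>X. c i * u' i j0) + e * t' j0 = 0"
        by (simp add: u'_def t'_def p_def)
      then show ?thesis unfolding eq True by simp
    next
      case False
      then show ?thesis unfolding eq using s that by (simp add: C'_def)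
    qed
    moreover have "d i \<in> R" if "i \<in> insert x0 X" for i using that c qR pR by (auto simp: d_def)
    ultimately have "p * e \<in> N \<and> (\<forall>i\<in>insert x0 X. d i \<in> N)"
      using insert.prems(4)[of d "p * e"] pR e by blast
    then show "e \<in> N \<and> (\<forall>i\<in>X. c i \<in> N)"
      using prime_in[OF pR] pN e c insert.hyps unfolding d_def by (metis insertI2)
  qed
  then obtain v where v: "\<forall>j\<in>C'. v j \<in> R" "\<forall>x\<in>X. (\<Sum>j\<in>C'. u' x j * v j) = 0" "(\<Sum>j\<in>C'. t' j * v j) \<notin> N"
    by blast
  \<comment> \<open>As in back substitution, the entry at the pivot column is the one that makes
    \<open>w\<close> orthogonal to row \<open>x0\<close>; the remaining products become those of the
    reduced rows with \<open>v\<close>.\<close>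
  define w where "w j = (if j = j0 then - (\<Sum>k\<in>C'. u x0 k * v k) else p * v j)" for j
  have wR: "\<forall>j\<in>C. w j \<in> R"
    using v(1) pR insert.prems(2) by (auto simp: w_def C'_def intro!: uminus_mem sum_mem mult_mem)
  have sum: "(\<Sum>j\<in>C. z j * w j) = (\<Sum>j\<in>C'. (p * z j - z j0 * u x0 j) * v j)" for z
  proof -
    have "(\<Sum>j\<in>C. z j * w j) = z j0 * w j0 + (\<Sum>j\<in>C'. z j * w j)"
      using j0 insert.prems(1) by (simp add: C'_def sum.remove)
    also have "(\<Sum>j\<in>C'. z j * w j) = (\<Sum>j\<in>C'. z j * (p * v j))"
      by (rule sum.cong) (auto simp: w_def C'_def)
    finally show ?thesis
      by (simp add: w_def algebra_simps sum_subtractf sum_distrib_left)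
  qed
  show ?case
  proof (intro exI[of _ w] conjI wR ballI)
    fix x assume "x \<in> insert x0 X"
    then show "(\<Sum>j\<in>C. u x j * w j) = 0"
      unfolding sum using v(2) by (auto simp: u'_def p_def)
  next
    show "(\<Sum>j\<in>C. t j * w j) \<notin> N"
      unfolding sum using v(3) by (simp add: t'_def)
  qed
qed

end

section \<open>Adjoining an element, and Hilbert's basis theorem\<close>

definition coeffs_in :: "'a::comm_ring_1 set \<Rightarrow> 'a poly set" where
  "coeffs_in C = {p. \<forall>i. coeff p i \<in> C}"

text \<open>Representations as a value at \<open>z\<close> need not be unique, since
  \<open>z\<close> may satisfy relations over \<open>C\<close>. Arguments by degree therefore choose
  a representing polynomial of least degree.\<close>

definition adjoin :: "'a::comm_ring_1 set \<Rightarrow> 'a \<Rightarrow> 'a set" where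
  "adjoin C z = {poly p z | p. p \<in> coeffs_in C}"

definition span_of :: "'a::comm_ring_1 set \<Rightarrow> 'a set \<Rightarrow> 'a set" where
  "span_of R F = {\<Sum>y\<in>F. a y * y | a. \<forall>y\<in>F. a y \<in> R}"

definition all_ideals_fg :: "'a::comm_ring_1 set \<Rightarrow> bool" where
  "all_ideals_fg R \<longleftrightarrow> (\<forall>N. ideal_set R N \<longrightarrow> (\<exists>F. finite F \<and> F \<subseteq> N \<and> N \<subseteq> span_of R F))"

lemma degree_minus_lead:
  fixes p :: "'a::comm_ring_1 poly"
  assumes "h = p - monom (lead_coeff p) (degree p)"
  shows "h = 0 \<or> degree h < degree p"
proof (rule ccontr)
  assume *: "\<not> (h = 0 \<or> degree h < degree p)"
  then have "coeff h (degree h) = 0"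
    by (cases "degree h = degree p") (auto simp: assms coeff_eq_0)
  then show False using * by simp
qed

context subring_set begin

lemma coeffs_in_closed [simp, intro]:
  "0 \<in> coeffs_in R" "1 \<in> coeffs_in R"
  "p \<in> coeffs_in R \<Longrightarrow> q \<in> coeffs_in R \<Longrightarrow> p + q \<in> coeffs_in R"
  "p \<in> coeffs_in R \<Longrightarrow> q \<in> coeffs_in R \<Longrightarrow> p - q \<in> coeffs_in R"
  "p \<in> coeffs_in R \<Longrightarrow> - p \<in> coeffs_in R"
  "p \<in> coeffs_in R \<Longrightarrow> q \<in> coeffs_in R \<Longrightarrow> p * q \<in> coeffs_in R"
  "c \<in> R \<Longrightarrow> p \<in> coeffs_in R \<Longrightarrow> Polynomial.smult c p \<in> coeffs_in R"
  "c \<in> R \<Longrightarrow> monom c k \<in> coeffs_in R"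
  "c \<in> R \<Longrightarrow> [:c:] \<in> coeffs_in R"
  by (auto simp: coeffs_in_def coeff_mult coeff_pCons one_pCons intro!: sum_mem split: nat.split)

lemma lead_coeff_mem [intro]: "p \<in> coeffs_in R \<Longrightarrow> coeff p i \<in> R"
  by (auto simp: coeffs_in_def)

lemma subring_set_adjoin: "subring_set (adjoin R z)"
proof
  show "0 \<in> adjoin R z" unfolding adjoin_def by (force intro: exI[of _ 0])
  show "1 \<in> adjoin R z" unfolding adjoin_def by (force intro: exI[of _ 1])
next
  fix x y assume "x \<in> adjoin R z" "y \<in> adjoin R z"
  then obtain p q where pq: "x = poly p z" "y = poly q z" "p \<in> coeffs_in R" "q \<in> coeffs_in R"
    by (auto simp: adjoin_def)
  show "x + y \<in> adjoin R z" unfolding adjoin_def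
    using pq by (intro CollectI exI[of _ "p + q"]) auto
  show "x * y \<in> adjoin R z" unfolding adjoin_def
    using pq by (intro CollectI exI[of _ "p * q"]) auto
next
  fix x assume "x \<in> adjoin R z"
  then obtain p where "x = poly p z" "p \<in> coeffs_in R" by (auto simp: adjoin_def)
  then show "- x \<in> adjoin R z" unfolding adjoin_def
    by (intro CollectI exI[of _ "- p"]) auto
qed

lemma subset_adjoin: "R \<subseteq> adjoin R z"
proof
  fix x assume "x \<in> R"
  then show "x \<in> adjoin R z" unfolding adjoin_def
    by (intro CollectI exI[of _ "[:x:]"]) auto
qed

lemma adjoin_self: "z \<in> adjoin R z"
  unfolding adjoin_def by (intro CollectI exI[of _ "monom 1 1"]) (auto simp: poly_monom)

text \<open>Leading coefficients are not invertible, so each step multiplies \<open>f\<close> once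
  by that of \<open>g\<close> before cancelling the leading term. The alternative
  \<open>r = 0\<close> covers divisors of degree zero.\<close>

lemma pseudo_division:
  assumes g: "g \<in> coeffs_in R" and f: "f \<in> coeffs_in R"
  shows "\<exists>k q r. q \<in> coeffs_in R \<and> r \<in> coeffs_in R \<and> Polynomial.smult (lead_coeff g ^ k) f = q * g + r \<and>
    (r = 0 \<or> degree r < degree g)"
  using f
proof (induction "degree f" arbitrary: f rule: less_induct)
  case less
  show ?case
  proof (cases "f = 0 \<or> degree f < degree g")
    case True
    then show ?thesis using less.prems
      by (intro exI[of _ 0] exI[of _ "0 :: 'a poly"] exI[of _ f]) auto
  next
    case False
    define e where "e = degree f - degree g"
    define h where "h = Polynomial.smult (lead_coeff g) f - monom (lead_coeff f) e * g"
    have h: "h \<in> coeffs_in R" using g less.prems by (auto simp: h_def)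
    have deg: "h = 0 \<or> degree h < degree f"
    proof -
      have z: "coeff h i = 0" if "degree f \<le> i" for i
      proof (cases "i = degree f")
        case True
        then have "coeff (monom (lead_coeff f) e * g) i = lead_coeff f * lead_coeff g"
          using False by (simp add: coeff_monom_mult e_def)
        then show ?thesis using True by (simp add: h_def mult.commute[of "lead_coeff f"])
      next
        case ne: False
        then have "i > degree f" "i - e > degree g" using that False by (auto simp: e_def)
        then show ?thesis by (simp add: h_def coeff_monom_mult coeff_eq_0)
      qed
      show ?thesis
      proof (cases "h = 0")
        case False
        then have "coeff h (degree h) \<noteq> 0" by simp
        then show ?thesis using z[of "degree h"] by (metis not_le)
      qed simp
    qed
    have "\<exists>k q r. q \<in> coeffs_in R \<and> r \<in> coeffs_in R \<and> Polynomial.smult (lead_coeff g ^ k) h = q * g + r \<and>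
      (r = 0 \<or> degree r < degree g)"
    proof (cases "h = 0")
      case True
      then show ?thesis by (intro exI[of _ 0] exI[of _ "0 :: 'a poly"]) auto
    next
      case False
      then show ?thesis using less.hyps[of h] deg h by auto
    qed
    then obtain k q r where kqr: "q \<in> coeffs_in R" "r \<in> coeffs_in R"
      "Polynomial.smult (lead_coeff g ^ k) h = q * g + r" "r = 0 \<or> degree r < degree g" by blast
    have "Polynomial.smult (lead_coeff g ^ Suc k) f =
        (q + Polynomial.smult (lead_coeff g ^ k) (monom (lead_coeff f) e)) * g + r"
    proof -
      have "Polynomial.smult (lead_coeff g ^ Suc k) f = Polynomial.smult (lead_coeff g ^ k) (h + monom (lead_coeff f) e * g)"
        by (simp add: h_def mult.commute)
      also have "\<dots> = q * g + r + Polynomial.smult (lead_coeff g ^ k) (monom (lead_coeff f) e) * g"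
        by (simp add: smult_add_right kqr(3))
      finally show ?thesis by (simp add: algebra_simps)
    qed
    moreover have "q + Polynomial.smult (lead_coeff g ^ k) (monom (lead_coeff f) e) \<in> coeffs_in R"
      using kqr g less.prems by auto
    ultimately show ?thesis using kqr by blast
  qed
qed

section \<open>Finite generation of ideals\<close>

lemma span_of_ideal:
  assumes "F \<subseteq> R"
  shows "ideal_set R (span_of R F)"
proof
  show "span_of R F \<subseteq> R" using assms by (auto simp: span_of_def intro!: sum_mem)
  show "0 \<in> span_of R F" unfolding span_of_def by (intro CollectI exI[of _ "\<lambda>_. 0"]) auto
next
  fix x y assume "x \<in> span_of R F" "y \<in> span_of R F"
  then obtain a b where "x = (\<Sum>y\<in>F. a y * y)" "\<forall>y\<in>F. a y \<in> R" "y = (\<Sum>y\<in>F. b y * y)" "\<forall>y\<in>F. b y \<in> R"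
    by (auto simp: span_of_def)
  then show "x + y \<in> span_of R F" unfolding span_of_def
    by (intro CollectI exI[of _ "\<lambda>y. a y + b y"]) (auto simp: sum.distrib algebra_simps)
next
  fix x y assume "x \<in> R" "y \<in> span_of R F"
  then obtain b where "y = (\<Sum>y\<in>F. b y * y)" "\<forall>y\<in>F. b y \<in> R"
    by (auto simp: span_of_def)
  then show "x * y \<in> span_of R F" unfolding span_of_def using \<open>x \<in> R\<close>
    by (intro CollectI exI[of _ "\<lambda>y. x * b y"]) (auto simp: sum_distrib_left algebra_simps)
qed

lemma span_of_incl:
  assumes "finite F" "y \<in> F"
  shows "y \<in> span_of R F"
  unfolding span_of_def
  by (intro CollectI exI[of _ "\<lambda>x. if x = y then 1 else 0"])
    (use assms in \<open>auto simp: if_distrib[of "\<lambda>x. x * _"] sum.delta cong: if_cong\<close>)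

lemma span_of_minimal:
  assumes "ideal_set R N" "F \<subseteq> N"
  shows "span_of R F \<subseteq> N"
proof -
  interpret N: ideal_set R N by fact
  show ?thesis using assms(2) by (auto simp: span_of_def intro!: N.sum_in)
qed

lemma span_of_mono:
  assumes "F \<subseteq> G" "finite G" "G \<subseteq> R"
  shows "span_of R F \<subseteq> span_of R G"
  using span_of_minimal[OF span_of_ideal[OF assms(3)], of F] span_of_incl[OF assms(2)] assms(1) by blast

text \<open>The ideals spanned by the initial segments increase, and their union is finitely
  generated, so all generators of the union already lie in one of them.\<close>

lemma noetherian_sequence:
  fixes a :: "nat \<Rightarrow> 'a"
  assumes "all_ideals_fg R" "range a \<subseteq> R"
  shows "\<exists>k. a k \<in> span_of R (a ` {..<k})"
proof -
  define N where "N = (\<Union>k. span_of R (a ` {..<k}))"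
  have mono: "span_of R (a ` {..<k}) \<subseteq> span_of R (a ` {..<l})" if "k \<le> l" for k l
    using that assms(2) by (intro span_of_mono image_mono finite_imageI) auto
  have id: "ideal_set R (span_of R (a ` {..<k}))" for k
    using assms(2) by (intro span_of_ideal) auto
  have "ideal_set R N"
  proof
    show "N \<subseteq> R" using id unfolding N_def ideal_set_def ideal_set_axioms_def by blast
    show "0 \<in> N" using ideal_set.zero_in[OF id] by (auto simp: N_def)
  next
    fix x y assume "x \<in> N" "y \<in> N"
    then obtain k l where "x \<in> span_of R (a ` {..<k})" "y \<in> span_of R (a ` {..<l})" by (auto simp: N_def)
    then have "x \<in> span_of R (a ` {..<max k l})" "y \<in> span_of R (a ` {..<max k l})"
      using mono[of k "max k l"] mono[of l "max k l"] by auto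
    then show "x + y \<in> N" using ideal_set.add_in[OF id] by (auto simp: N_def)
  next
    fix x y assume "x \<in> R" "y \<in> N"
    then show "x * y \<in> N" using ideal_set.mult_in_right[OF id] by (auto simp: N_def)
  qed
  then obtain F where F: "finite F" "F \<subseteq> N" "N \<subseteq> span_of R F"
    using assms(1) by (auto simp: all_ideals_fg_def)
  have "\<exists>k. F \<subseteq> span_of R (a ` {..<k})"
    using F(1,2)
  proof (induction F rule: finite_induct)
    case (insert x F)
    then obtain k l where "F \<subseteq> span_of R (a ` {..<k})" "x \<in> span_of R (a ` {..<l})" by (auto simp: N_def)
    then have "insert x F \<subseteq> span_of R (a ` {..<max k l})"
      using mono[of k "max k l"] mono[of l "max k l"] by auto
    then show ?case by blast
  qed auto
  then obtain k where k: "F \<subseteq> span_of R (a ` {..<k})" by blast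
  have "a k \<in> span_of R (a ` {..<Suc k})" by (rule span_of_incl) auto
  then have "a k \<in> N" by (auto simp: N_def)
  then show ?thesis using F(3) span_of_minimal[OF id k] by blast
qed

text \<open>If an ideal is not finitely generated, choose successively elements of minimal degree outside
  the ideal generated by the previous ones; their leading coefficients contradict
  \<open>noetherian_sequence\<close>.\<close>

theorem all_ideals_fg_adjoin:
  assumes fg: "all_ideals_fg R"
  shows "all_ideals_fg (adjoin R z)"
  unfolding all_ideals_fg_def
proof (intro allI impI, rule ccontr)
  interpret A: subring_set "adjoin R z" by (rule subring_set_adjoin)
  let ?A = "adjoin R z"
  fix N assume "ideal_set ?A N" and nfg: "\<nexists>F. finite F \<and> F \<subseteq> N \<and> N \<subseteq> span_of ?A F"
  interpret N: ideal_set ?A N by fact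
  define Q where "Q F p \<longleftrightarrow> p \<in> coeffs_in R \<and> poly p z \<in> N \<and> poly p z \<notin> span_of ?A ((\<lambda>p. poly p z) ` F)" for F p
  define nxt where "nxt F = arg_min degree (Q F)" for F
  \<comment> \<open>Each choice depends on all earlier ones, hence the recursion over the set of
    polynomials chosen so far.\<close>
  define Fs where "Fs = rec_nat {} (\<lambda>_ F. insert (nxt F) F)"
  have Fs_Suc: "Fs (Suc k) = insert (nxt (Fs k)) (Fs k)" for k by (simp add: Fs_def)
  define p where "p k = nxt (Fs k)" for k
  have Fs: "Fs k = p ` {..<k}" for k
    by (induction k) (auto simp: Fs_Suc p_def lessThan_Suc, simp add: Fs_def)
  have ex: "\<exists>q. Q F q" if "finite F" "\<forall>p\<in>F. poly p z \<in> N" for F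
  proof -
    have "finite ((\<lambda>p. poly p z) ` F)" "(\<lambda>p. poly p z) ` F \<subseteq> N" using that by auto
    then have "\<not> N \<subseteq> span_of ?A ((\<lambda>p. poly p z) ` F)" using nfg by simp
    then obtain x where x: "x \<in> N" "x \<notin> span_of ?A ((\<lambda>p. poly p z) ` F)" by blast
    obtain q where "x = poly q z" "q \<in> coeffs_in R"
      using N.in_ring[OF x(1)] by (auto simp: adjoin_def)
    then show ?thesis using x by (auto simp: Q_def)
  qed
  have Qp: "Q (p ` {..<k}) (p k)" and pmin: "\<And>q. Q (p ` {..<k}) q \<Longrightarrow> degree (p k) \<le> degree q" for k
  proof (induction k rule: less_induct)
    case (less k)
    have "\<exists>q. Q (p ` {..<k}) q" using less(1) by (intro ex) (auto simp: Q_def)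
    then show "Q (p ` {..<k}) (p k)" "\<And>q. Q (p ` {..<k}) q \<Longrightarrow> degree (p k) \<le> degree q"
      using arg_min_nat_lemma[of "Q (p ` {..<k})" _ degree] Fs[of k] by (auto simp: p_def nxt_def)
  qed
  have pc: "p k \<in> coeffs_in R" for k using Qp[of k] by (simp add: Q_def)
  have dmono: "degree (p k) \<le> degree (p l)" if "k \<le> l" for k l
  proof -
    have "(\<lambda>p. poly p z) ` p ` {..<l} \<subseteq> ?A" using pc by (auto simp: adjoin_def)
    then have "span_of ?A ((\<lambda>p. poly p z) ` p ` {..<k}) \<subseteq> span_of ?A ((\<lambda>p. poly p z) ` p ` {..<l})"
      using that by (intro A.span_of_mono) auto
    then have "Q (p ` {..<k}) (p l)" using Qp[of l] by (auto simp: Q_def)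
    then show ?thesis by (rule pmin)
  qed
  obtain k where k: "lead_coeff (p k) \<in> span_of R ((\<lambda>i. lead_coeff (p i)) ` {..<k})"
    using noetherian_sequence[OF fg, of "\<lambda>i. lead_coeff (p i)"] pc by auto
  have "span_of R ((\<lambda>i. lead_coeff (p i)) ` {..<k}) \<subseteq>
      {\<Sum>i<k. b i * lead_coeff (p i) | b. \<forall>i<k. b i \<in> R}" (is "_ \<subseteq> ?S")
  proof (rule span_of_minimal)
    have "?S = genideal (subring_of R) ((\<lambda>i. lead_coeff (p i)) ` {..<k})"
      using pc by (subst genideal_eq) auto
    moreover interpret cring "subring_of R" by (rule cring_subring_of)
    have "ideal (genideal (subring_of R) ((\<lambda>i. lead_coeff (p i)) ` {..<k})) (subring_of R)"
      using pc by (intro genideal_ideal) auto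
    ultimately show "ideal_set R ?S" using ideal_subring_of_iff by simp
    show "(\<lambda>i. lead_coeff (p i)) ` {..<k} \<subseteq> ?S"
    proof
      fix y assume "y \<in> (\<lambda>i. lead_coeff (p i)) ` {..<k}"
      then obtain i where i: "i < k" "y = lead_coeff (p i)" by auto
      show "y \<in> ?S"
        by (intro CollectI exI[of _ "\<lambda>j. if j = i then 1 else 0"])
          (use i in \<open>auto simp: if_distrib[of "\<lambda>x. x * _"] sum.delta cong: if_cong\<close>)
    qed
  qed
  then obtain b where b: "lead_coeff (p k) = (\<Sum>i<k. b i * lead_coeff (p i))" "\<And>i. i < k \<Longrightarrow> b i \<in> R"
    using k by auto
  \<comment> \<open>The \<open>p i\<close> are shifted to the degree of \<open>p k\<close>, which is
    possible because degrees do not decrease along the choices. So \<open>h\<close> has the leading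
    term of \<open>p k\<close>, while its value is in the span of the earlier ones. Then
    \<open>q\<close> is still an admissible choice although its coefficients vanish from the degree
    of \<open>p k\<close> on, against minimality.\<close>
  define h where "h = (\<Sum>i<k. monom (b i) (degree (p k) - degree (p i)) * p i)"
  define q where "q = p k - h"
  have hc: "h \<in> coeffs_in R"
  proof -
    have "(\<Sum>i\<in>X. monom (b i) (degree (p k) - degree (p i)) * p i) \<in> coeffs_in R" if "X \<subseteq> {..<k}" for X
      using that b(2) pc by (induction X rule: infinite_finite_induct) auto
    then show ?thesis unfolding h_def by blast
  qed
  interpret S: ideal_set ?A "span_of ?A ((\<lambda>p. poly p z) ` p ` {..<k})"
    by (rule A.span_of_ideal) (use pc in \<open>auto simp: adjoin_def\<close>)
  have hS: "poly h z \<in> span_of ?A ((\<lambda>p. poly p z) ` p ` {..<k})"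
    unfolding h_def poly_sum poly_mult
  proof (intro S.sum_in S.mult_in_right)
    fix i assume i: "i \<in> {..<k}"
    show "poly (monom (b i) (degree (p k) - degree (p i))) z \<in> ?A"
      using b(2) i unfolding adjoin_def by blast
    show "poly (p i) z \<in> span_of ?A ((\<lambda>p. poly p z) ` p ` {..<k})"
      by (rule A.span_of_incl) (use i in auto)
  qed
  have hN: "poly h z \<in> N"
    using hS A.span_of_minimal[OF N.ideal_set_axioms, of "(\<lambda>p. poly p z) ` p ` {..<k}"] Qp by (auto simp: Q_def)
  have "Q (p ` {..<k}) q"
    using Qp[of k] hc hN S.diff_in_imp[OF _ hS, of "poly (p k) z"] pc by (auto simp: Q_def q_def)
  then have "degree (p k) \<le> degree q" by (rule pmin)
  have ch: "coeff h j = (\<Sum>i<k. b i * coeff (p i) (j - (degree (p k) - degree (p i))))"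
    if "degree (p k) \<le> j" for j
    unfolding h_def coeff_sum using that by (intro sum.cong) (auto simp: coeff_monom_mult)
  have "coeff q j = 0" if "degree (p k) \<le> j" for j
  proof (cases "j = degree (p k)")
    case True
    have "j - (degree (p k) - degree (p i)) = degree (p i)" if "i < k" for i
      using dmono[of i k] that True by auto
    then have "coeff h j = lead_coeff (p k)" unfolding ch[OF that] b(1) by (intro sum.cong) auto
    then show ?thesis using True by (simp add: q_def)
  next
    case False
    have "coeff (p i) (j - (degree (p k) - degree (p i))) = 0" if "i < k" for i
      using dmono[of i k] that False \<open>degree (p k) \<le> j\<close> by (intro coeff_eq_0) auto
    then have "coeff h j = 0" unfolding ch[OF that] by (intro sum.neutral) auto
    then show ?thesis using False that by (simp add: q_def coeff_eq_0)
  qed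
  then have "coeff q (degree q) = 0" using \<open>degree (p k) \<le> degree q\<close> by simp
  then have "q = 0" by simp
  then show False using \<open>Q (p ` {..<k}) q\<close> by (auto simp: Q_def)
qed

end

section \<open>Polynomials in a given set of variables\<close>

text \<open>An arbitrary set of variables in place of an initial segment: later arguments adjoin
  variables in a chosen order and look at the variables outside a set \<open>Z\<close>.\<close>

definition polys_in :: "nat set \<Rightarrow> 'k::field mpoly set" where
  "polys_in U = {p. \<forall>t\<in>Poly_Mapping.keys p. Poly_Mapping.keys t \<subseteq> U}"

lemma poly_ring_eq: "poly_ring n = subring_of (polys_in {..<n})"
  by (simp add: poly_ring_def polys_in_def)

lemma polys_in_mono: "U \<subseteq> V \<Longrightarrow> polys_in U \<subseteq> polys_in V"
  by (fastforce simp: polys_in_def)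

interpretation polys: subring_set "polys_in U :: 'k::field mpoly set" for U
proof
  fix x y :: "'k mpoly" assume xy: "x \<in> polys_in U" "y \<in> polys_in U"
  show "x + y \<in> polys_in U"
    using xy Poly_Mapping.keys_add[of x y] unfolding polys_in_def by blast
  show "x * y \<in> polys_in U"
    unfolding polys_in_def
  proof (intro CollectI ballI)
    fix t assume "t \<in> Poly_Mapping.keys (x * y)"
    then obtain a b where "a \<in> Poly_Mapping.keys x" "b \<in> Poly_Mapping.keys y" "t = a + b"
      using Poly_Mapping.keys_mult[of x y] by blast
    then show "Poly_Mapping.keys t \<subseteq> U"
      using xy Poly_Mapping.keys_add[of a b] unfolding polys_in_def by blast
  qed
qed (auto simp: polys_in_def)

lemma Const_simps [simp]:
  "Const 0 = 0" "Const 1 = 1" "Const (a + b) = Const a + Const b" "Const (a * b) = Const a * Const b"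
  by (simp_all add: Const_def single_add mult_single)

lemma Const_of_nat: "Const (of_nat k) = of_nat k"
  by (induction k) auto

lemma Const_in [simp, intro]: "Const c \<in> polys_in U"
  by (auto simp: Const_def polys_in_def)

lemma Var_in [simp, intro]: "j \<in> U \<Longrightarrow> Var j \<in> polys_in U"
  by (auto simp: Var_def polys_in_def)

lemma sum_single_lookup: "(\<Sum>t\<in>Poly_Mapping.keys p. Poly_Mapping.single t (Poly_Mapping.lookup p t)) = p"
  by (rule poly_mapping_eqI) (auto simp: lookup_sum lookup_single when_def in_keys_iff)

lemma polys_in_induct [consumes 1, case_names Const add mult]:
  assumes "p \<in> polys_in U" "\<And>c. P (Const c)"
    and "\<And>p q. p \<in> polys_in U \<Longrightarrow> q \<in> polys_in U \<Longrightarrow> P p \<Longrightarrow> P q \<Longrightarrow> P (p + q)"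
    and "\<And>p j. p \<in> polys_in U \<Longrightarrow> j \<in> U \<Longrightarrow> P p \<Longrightarrow> P (p * Var j)"
  shows "P p"
proof -
  have mono: "P (Poly_Mapping.single t c)" if "Poly_Mapping.keys t \<subseteq> U" for t c
    using that
  \<comment> \<open>Induction on the total degree of the monomial: one occurrence of a variable
    \<open>k\<close> is split off as a factor \<open>Var k\<close>.\<close>
  proof (induction "\<Sum>k\<in>Poly_Mapping.keys t. Poly_Mapping.lookup t k" arbitrary: t rule: less_induct)
    case less
    show ?case
    proof (cases "t = 0")
      case True
      then show ?thesis using assms(2)[of c] by (simp add: Const_def)
    next
      case False
      then obtain k where k: "k \<in> Poly_Mapping.keys t" by fastforce
      define t' where "t' = t - Poly_Mapping.single k 1"
      have lk: "Poly_Mapping.lookup t k \<noteq> 0" using k by (simp add: in_keys_iff)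
      have t: "t = t' + Poly_Mapping.single k 1"
        by (rule poly_mapping_eqI) (use lk in \<open>auto simp: t'_def lookup_add lookup_minus lookup_single when_def\<close>)
      have lt: "Poly_Mapping.lookup t' i \<le> Poly_Mapping.lookup t i" for i
        by (simp add: t'_def lookup_minus)
      have sub: "Poly_Mapping.keys t' \<subseteq> Poly_Mapping.keys t"
      proof
        fix i assume "i \<in> Poly_Mapping.keys t'"
        then show "i \<in> Poly_Mapping.keys t" using lt[of i] by (simp add: in_keys_iff)
      qed
      have "(\<Sum>k\<in>Poly_Mapping.keys t'. Poly_Mapping.lookup t' k) = (\<Sum>k\<in>Poly_Mapping.keys t. Poly_Mapping.lookup t' k)"
        by (rule sum.mono_neutral_left) (use sub in \<open>auto simp: in_keys_iff\<close>)
      also have "\<dots> < (\<Sum>k\<in>Poly_Mapping.keys t. Poly_Mapping.lookup t k)"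
        by (rule sum_strict_mono_ex1) (use k lk lt in \<open>auto simp: t'_def lookup_minus intro!: bexI[of _ k]\<close>)
      finally have "P (Poly_Mapping.single t' c)"
        by (rule less.hyps) (use sub less.prems in auto)
      moreover have "Poly_Mapping.single t' c \<in> polys_in U"
        using sub less.prems by (auto simp: polys_in_def)
      moreover have "k \<in> U" using k less.prems by blast
      ultimately have "P (Poly_Mapping.single t' c * Var k)" using assms(4) by blast
      then show ?thesis by (simp add: Var_def mult_single t)
    qed
  qed
  have "P (\<Sum>t\<in>X. Poly_Mapping.single t (Poly_Mapping.lookup p t)) \<and>
      (\<Sum>t\<in>X. Poly_Mapping.single t (Poly_Mapping.lookup p t)) \<in> polys_in U" if "X \<subseteq> Poly_Mapping.keys p" for X
  proof -
    have "finite X" using that by (rule finite_subset) simp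
    then show ?thesis using that
    proof (induction X rule: finite_induct)
      case empty
      then show ?case using assms(2)[of 0] by simp
    next
      case (insert t X)
      have "Poly_Mapping.keys t \<subseteq> U" using insert assms(1) by (auto simp: polys_in_def)
      then have "P (Poly_Mapping.single t (Poly_Mapping.lookup p t))"
        "Poly_Mapping.single t (Poly_Mapping.lookup p t) \<in> polys_in U"
        using mono by (auto simp: polys_in_def)
      then show ?case using insert assms(3) by auto
    qed
  qed
  from this[OF subset_refl] show ?thesis by (simp add: sum_single_lookup)
qed

lemma polys_in_insert: "polys_in (insert z U) = adjoin (polys_in U) (Var z)"
proof
  interpret A: subring_set "adjoin (polys_in U) (Var z)" by (rule polys.subring_set_adjoin)
  have sub: "polys_in U \<subseteq> adjoin (polys_in U) (Var z)" by (rule polys.subset_adjoin)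
  show "polys_in (insert z U) \<subseteq> adjoin (polys_in U) (Var z)"
  proof
    fix p assume "p \<in> polys_in (insert z U)"
    then show "p \<in> adjoin (polys_in U) (Var z)"
    proof (induction rule: polys_in_induct)
      case (mult p j)
      then have "Var j \<in> adjoin (polys_in U) (Var z)"
        using sub polys.adjoin_self by blast
      then show ?case using mult by auto
    qed (use sub in auto)
  qed
  show "adjoin (polys_in U) (Var z) \<subseteq> polys_in (insert z U)"
  proof -
    have "poly p (Var z) \<in> polys_in (insert z U)" if "p \<in> coeffs_in (polys_in U)" for p
      unfolding poly_altdef
      by (intro polys.sum_mem polys.mult_mem polys.power_mem Var_in)
        (use that polys_in_mono[of U "insert z U"] in \<open>auto simp: coeffs_in_def\<close>)
    then show ?thesis by (auto simp: adjoin_def)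
  qed
qed

lemma polys_in_empty: "polys_in {} = range Const"
proof
  show "polys_in {} \<subseteq> range Const"
  proof
    fix p assume "p \<in> polys_in {}"
    then show "p \<in> range Const"
    proof (induction rule: polys_in_induct)
      case (add p q)
      then obtain a b where "p = Const a" "q = Const b" by auto
      then have "p + q = Const (a + b)" by simp
      then show ?case by blast
    qed auto
  qed
qed auto

lemma Const_inverse: "c \<noteq> 0 \<Longrightarrow> Const (inverse c) * Const c = 1"
  by (simp flip: Const_simps(4))

theorem polys_in_fg:
  assumes "finite U"
  shows "all_ideals_fg (polys_in U)"
  using assms
proof (induction U rule: finite_induct)
  case empty
  show ?case
    unfolding all_ideals_fg_def
  proof (intro allI impI)
    fix N assume "ideal_set (polys_in {}) N"
    then interpret N: ideal_set "polys_in {}" N .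
    show "\<exists>F. finite F \<and> F \<subseteq> N \<and> N \<subseteq> span_of (polys_in {}) F"
    proof (cases "N = {0}")
      case True
      then show ?thesis by (intro exI[of _ "{}"]) (auto simp: span_of_def)
    next
      case False
      then obtain c where c: "Const c \<in> N" "Const c \<noteq> 0"
        using N.subset N.zero_in by (auto simp: polys_in_empty)
      have "1 \<in> N" using N.mult_in_right[of "Const (inverse c)" "Const c"] c Const_inverse[of c] Const_simps(1) by (metis Const_in)
      moreover have "N \<subseteq> span_of (polys_in {}) {1}"
        using N.subset by (auto simp: span_of_def)
      ultimately show ?thesis by (intro exI[of _ "{1}"]) auto
    qed
  qed
next
  case (insert z U)
  then show ?case using polys.all_ideals_fg_adjoin polys_in_insert by metis
qed

section \<open>Partial derivatives\<close>

lemma pdiff_superset: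
  assumes "finite T" "Poly_Mapping.keys p \<subseteq> T"
  shows "pdiff j p = (\<Sum>t\<in>T. Poly_Mapping.single (t - Poly_Mapping.single j 1)
    (of_nat (Poly_Mapping.lookup t j) * Poly_Mapping.lookup p t))"
  unfolding pdiff_def by (rule sum.mono_neutral_left) (use assms in \<open>auto simp: in_keys_iff\<close>)

lemma pdiff_add [simp]: "pdiff j (p + q) = pdiff j p + pdiff j q"
proof -
  let ?T = "Poly_Mapping.keys p \<union> Poly_Mapping.keys q"
  have "Poly_Mapping.keys (p + q) \<subseteq> ?T" by (rule Poly_Mapping.keys_add)
  then show ?thesis
    using pdiff_superset[of ?T p j] pdiff_superset[of ?T q j] pdiff_superset[of ?T "p + q" j]
    by (simp add: lookup_add distrib_left single_add sum.distrib)
qed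

lemma pdiff_single: "pdiff j (Poly_Mapping.single t a) =
  Poly_Mapping.single (t - Poly_Mapping.single j 1) (of_nat (Poly_Mapping.lookup t j) * a)"
  using pdiff_superset[of "{t}" "Poly_Mapping.single t a" j] by simp

lemma pdiff_zero [simp]: "pdiff j 0 = 0"
  by (simp add: pdiff_def)

lemma pdiff_sum: "pdiff j (sum g X) = (\<Sum>x\<in>X. pdiff j (g x))"
  by (induction X rule: infinite_finite_induct) auto

lemma pdiff_Const [simp]: "pdiff j (Const c) = 0"
  by (simp add: Const_def pdiff_single)

lemma pdiff_one [simp]: "pdiff j 1 = 0"
  using pdiff_Const[of j 1] by simp

lemma pdiff_Var: "pdiff j (Var k) = (if j = k then 1 else 0)"
  by (simp add: Var_def pdiff_single lookup_single when_def)

lemma single_minus_one: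
  "Poly_Mapping.lookup s j \<noteq> 0 \<Longrightarrow> t + s - Poly_Mapping.single j (1::nat) = t + (s - Poly_Mapping.single j 1)"
  by (rule poly_mapping_eqI) (auto simp: lookup_add lookup_minus lookup_single when_def)

lemma pdiff_mult_single:
  "pdiff j (Poly_Mapping.single t a * Poly_Mapping.single s b) =
   pdiff j (Poly_Mapping.single t a) * Poly_Mapping.single s b +
   Poly_Mapping.single t a * pdiff j (Poly_Mapping.single s b)"
proof -
  \<comment> \<open>Subtraction of exponents is truncated, so moving it past \<open>t\<close> is
    wrong when \<open>s\<close> does not contain the variable \<open>j\<close>; then the coefficient
    is zero and both sides vanish.\<close>
  have 1: "Poly_Mapping.single (t + s - Poly_Mapping.single j 1) (of_nat (Poly_Mapping.lookup s j) * c) =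
     Poly_Mapping.single (t + (s - Poly_Mapping.single j 1)) (of_nat (Poly_Mapping.lookup s j) * c)" for s t and c :: 'a
    by (cases "Poly_Mapping.lookup s j = 0") (simp_all add: single_minus_one[simplified])
  show ?thesis
    using 1[of t s "a * b"] 1[of s t "a * b"]
    by (simp add: mult_single pdiff_single lookup_add distrib_right single_add algebra_simps)
qed

lemma pdiff_mult: "pdiff j (p * q) = pdiff j p * q + p * pdiff j q"
proof -
  let ?m = "\<lambda>p t. Poly_Mapping.single t (Poly_Mapping.lookup p t)"
  have p: "p = (\<Sum>t\<in>Poly_Mapping.keys p. ?m p t)" for p :: "'a mpoly"
    by (simp add: sum_single_lookup)
  have "pdiff j (p * q) = (\<Sum>t\<in>Poly_Mapping.keys p. \<Sum>s\<in>Poly_Mapping.keys q. pdiff j (?m p t * ?m q s))"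
    by (subst p[of p], subst p[of q]) (simp add: sum_product pdiff_sum)
  also have "\<dots> = (\<Sum>t\<in>Poly_Mapping.keys p. pdiff j (?m p t)) * (\<Sum>s\<in>Poly_Mapping.keys q. ?m q s) +
      (\<Sum>t\<in>Poly_Mapping.keys p. ?m p t) * (\<Sum>s\<in>Poly_Mapping.keys q. pdiff j (?m q s))"
    by (simp add: pdiff_mult_single sum.distrib sum_product)
  also have "\<dots> = pdiff j p * q + p * pdiff j q"
    unfolding pdiff_sum[symmetric] by (simp add: sum_single_lookup)
  finally show ?thesis .
qed

lemma pdiff_in: "p \<in> polys_in U \<Longrightarrow> pdiff j p \<in> polys_in U"
proof (induction rule: polys_in_induct)
  case (mult p k)
  then show ?case by (auto simp: pdiff_mult pdiff_Var)
qed auto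

lemma pdiff_notin: "p \<in> polys_in U \<Longrightarrow> j \<notin> U \<Longrightarrow> pdiff j p = 0"
proof (induction rule: polys_in_induct)
  case (mult p k)
  then show ?case by (auto simp: pdiff_mult pdiff_Var)
qed auto

lemma pderiv_coeffs_in:
  fixes p :: "'b::idom poly"
  shows "subring_set R' \<Longrightarrow> p \<in> coeffs_in R' \<Longrightarrow> pderiv p \<in> coeffs_in R'"
proof -
  assume "subring_set R'" "p \<in> coeffs_in R'"
  then interpret subring_set R' by simp
  show ?thesis using \<open>p \<in> coeffs_in R'\<close> by (auto simp: coeffs_in_def coeff_pderiv simp del: of_nat_Suc)
qed

lemma pdiff_poly_eval:
  assumes "q \<in> coeffs_in (polys_in U)" "z \<notin> U"
  shows "pdiff z (poly q (Var z)) = poly (pderiv q) (Var z)"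
  using assms(1)
proof (induction q)
  case (pCons a q)
  have "coeff (pCons a q) 0 \<in> polys_in U" "coeff (pCons a q) (Suc i) \<in> polys_in U" for i
    using pCons.prems unfolding coeffs_in_def by blast+
  then have "a \<in> polys_in U" "q \<in> coeffs_in (polys_in U)" by (auto simp: coeffs_in_def)
  then show ?case
    using pCons.IH pdiff_notin[OF _ assms(2)]
    by (simp add: pdiff_mult pdiff_Var pderiv_pCons algebra_simps)
qed auto

section \<open>Local generators of a prime and the rank of its gradients\<close>

text \<open>The elements of \<open>R\<close> that lie in the ideal generated by the
  \<open>g z\<close> after localization at \<open>N\<close>; \<open>s\<close> is a
  denominator.\<close>

definition local_span :: "'a::comm_ring_1 set \<Rightarrow> 'a set \<Rightarrow> 'i set \<Rightarrow> ('i \<Rightarrow> 'a) \<Rightarrow> 'a set" where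
  "local_span R N Z g = {p \<in> R. \<exists>s\<in>R - N. \<exists>a. (\<forall>z\<in>Z. a z \<in> R) \<and> s * p = (\<Sum>z\<in>Z. a z * g z)}"

lemma (in ideal_set) poly_eval_in:
  assumes "\<And>i. coeff f i \<in> N" "x \<in> R"
  shows "poly f x \<in> N"
  unfolding poly_altdef using assms by (intro sum_in mult_in_left) auto

context prime_set begin

lemma local_span_ideal: "ideal_set R (local_span R N Z g)"
proof
  show "local_span R N Z g \<subseteq> R" by (auto simp: local_span_def)
  show "0 \<in> local_span R N Z g" unfolding local_span_def
    by (auto intro!: bexI[of _ 1] exI[of _ "\<lambda>_. 0"])
next
  fix x y assume "x \<in> local_span R N Z g" "y \<in> local_span R N Z g"
  then obtain s a t b where *: "x \<in> R" "y \<in> R" "s \<in> R - N" "t \<in> R - N" "\<forall>z\<in>Z. a z \<in> R" "\<forall>z\<in>Z. b z \<in> R"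
    "s * x = (\<Sum>z\<in>Z. a z * g z)" "t * y = (\<Sum>z\<in>Z. b z * g z)"
    unfolding local_span_def by auto
  have "(s * t) * (x + y) = t * (s * x) + s * (t * y)" by (simp add: algebra_simps)
  also have "\<dots> = (\<Sum>z\<in>Z. (t * a z + s * b z) * g z)"
    unfolding * by (simp add: sum_distrib_left sum.distrib algebra_simps)
  finally show "x + y \<in> local_span R N Z g" unfolding local_span_def
    using * mult_notin[of s t] by (auto intro!: bexI[of _ "s * t"] exI[of _ "\<lambda>z. t * a z + s * b z"])
next
  fix x y assume "x \<in> R" "y \<in> local_span R N Z g"
  then obtain t b where *: "y \<in> R" "t \<in> R - N" "\<forall>z\<in>Z. b z \<in> R" "t * y = (\<Sum>z\<in>Z. b z * g z)"
    unfolding local_span_def by auto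
  have "t * (x * y) = x * (t * y)" by (simp add: algebra_simps)
  also have "\<dots> = (\<Sum>z\<in>Z. (x * b z) * g z)" unfolding * by (simp add: sum_distrib_left algebra_simps)
  finally show "x * y \<in> local_span R N Z g" unfolding local_span_def
    using * \<open>x \<in> R\<close> by (auto intro!: bexI[of _ t] exI[of _ "\<lambda>z. x * b z"])
qed

lemma local_span_cancel:
  assumes "s \<in> R - N" "p \<in> R" "s * p \<in> local_span R N Z g"
  shows "p \<in> local_span R N Z g"
proof -
  obtain t a where "t \<in> R - N" "\<forall>z\<in>Z. a z \<in> R" "t * (s * p) = (\<Sum>z\<in>Z. a z * g z)"
    using assms(3) by (auto simp: local_span_def)
  then show ?thesis using assms mult_notin[of t s] unfolding local_span_def
    by (auto intro!: bexI[of _ "t * s"] exI[of _ a] simp: mult.assoc)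
qed

lemma local_span_incl:
  assumes "finite Z" "z \<in> Z" "g z \<in> R"
  shows "g z \<in> local_span R N Z g"
proof -
  have "(\<Sum>y\<in>Z. (if y = z then 1 else 0) * g y) = g z"
    using assms by (simp add: if_distrib[of "\<lambda>x. x * _"] sum.delta cong: if_cong)
  then show ?thesis using assms unfolding local_span_def
    by (auto intro!: bexI[of _ 1] exI[of _ "\<lambda>y. if y = z then 1 else 0"])
qed

lemma local_span_mono:
  assumes "\<And>z. z \<in> Z \<Longrightarrow> g z \<in> local_span R N Y h"
  shows "local_span R N Z g \<subseteq> local_span R N Y h"
proof
  fix p assume "p \<in> local_span R N Z g"
  then obtain s a where *: "p \<in> R" "s \<in> R - N" "\<forall>z\<in>Z. a z \<in> R" "s * p = (\<Sum>z\<in>Z. a z * g z)"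
    by (auto simp: local_span_def)
  interpret L: ideal_set R "local_span R N Y h" by (rule local_span_ideal)
  have "s * p \<in> local_span R N Y h" unfolding *(4) using assms *(3) by (intro L.sum_in L.mult_in_right) auto
  then show "p \<in> local_span R N Y h" using local_span_cancel[OF *(2,1)] by blast
qed

text \<open>The hypothesis on degrees forbids a leading coefficient outside \<open>N\<close>, so the
  leading term can be subtracted and the rest has smaller degree. It is applied to variables that
  satisfy no such polynomial \<open>q\<close> at all, and to degrees below that of a minimal
  one.\<close>

lemma coeffs_in_prime:
  assumes "subring_set C" "C \<subseteq> R" "x \<in> R" "f \<in> coeffs_in C" "poly f x \<in> N"
    and "\<And>q. q \<in> coeffs_in C \<Longrightarrow> poly q x \<in> N \<Longrightarrow> lead_coeff q \<notin> N \<Longrightarrow> degree f < degree q"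
  shows "coeff f i \<in> N"
  using assms(4-)
proof (induction "degree f" arbitrary: f i rule: less_induct)
  case less
  interpret C: subring_set C by fact
  have lc: "lead_coeff f \<in> N" using less.prems by blast
  define h where "h = f - monom (lead_coeff f) (degree f)"
  have hc: "coeff h j = (if j = degree f then 0 else coeff f j)" for j
    by (simp add: h_def)
  have "coeff h i \<in> N"
  proof (cases "h = 0")
    case False
    then have "degree h < degree f" using degree_minus_lead[OF h_def] by blast
    moreover have "h \<in> coeffs_in C" using less.prems(1) by (auto simp: h_def)
    moreover have "poly h x \<in> N"
      using lc less.prems(2) assms(3) by (auto simp: h_def poly_monom intro!: diff_in mult_in_left)
    ultimately show ?thesis
      using less.prems(3) by (intro less.hyps) (auto intro: less_trans)
  qed auto
  then show ?case using lc hc[of i] by (cases "i = degree f") auto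
qed

end

text \<open>In the construction below \<open>Z\<close> collects the variables that are algebraic,
  modulo \<open>N\<close>, over those adjoined before them, and \<open>g z\<close> is a relation of
  least degree for \<open>z\<close>. Only the variables in \<open>U\<close> have been treated so
  far, but multipliers come from the full ring \<open>polys_in W\<close>, so that \<open>N\<close>
  is a prime of one fixed ring throughout.\<close>

definition presents :: "nat set \<Rightarrow> 'k::field mpoly set \<Rightarrow> nat set \<Rightarrow> nat set \<Rightarrow> (nat \<Rightarrow> 'k mpoly) \<Rightarrow> bool" where
  "presents W N U Z g \<longleftrightarrow>
     Z \<subseteq> U \<and> (\<forall>z\<in>Z. g z \<in> N \<inter> polys_in U) \<and>
     N \<inter> polys_in U \<subseteq> local_span (polys_in W) N Z g \<and>
     indep_mod (polys_in W) N Z (\<lambda>z j. pdiff j (g z)) U"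

text \<open>No polynomial over \<open>U\<close> with leading coefficient outside \<open>N\<close>
  vanishes at \<open>z\<close> modulo \<open>N\<close>. Hence all coefficients of an element of
  \<open>N\<close> are in \<open>N\<close>, and no generator is added. The second claim keeps the
  variables outside \<open>Z\<close> algebraically independent modulo \<open>N\<close>.\<close>

lemma presents_step_free:
  fixes N :: "'k::field_char_0 mpoly set"
  assumes N: "prime_set (polys_in W) N" and U: "insert z U \<subseteq> W" "z \<notin> U" "finite U"
    and pr: "presents W N U Z g" and Z: "N \<inter> polys_in (U - Z) \<subseteq> {0}"
    and free: "\<And>q. q \<in> coeffs_in (polys_in U) \<Longrightarrow> poly q (Var z) \<in> N \<Longrightarrow> lead_coeff q \<in> N"
  shows "presents W N (insert z U) Z g" "N \<inter> polys_in (insert z U - Z) \<subseteq> {0}"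
proof -
  interpret N: prime_set "polys_in W" N by fact
  interpret L: ideal_set "polys_in W" "local_span (polys_in W) N Z g" by (rule N.local_span_ideal)
  have UW: "polys_in U \<subseteq> polys_in W" using U polys_in_mono[of U W] by auto
  have xW: "Var z \<in> polys_in W" using U by auto
  have coeff: "coeff f i \<in> N" if "f \<in> coeffs_in (polys_in U)" "poly f (Var z) \<in> N" for f i
    by (rule N.coeffs_in_prime[OF polys.subring_set_axioms UW xW that]) (use free in blast)
  show "presents W N (insert z U) Z g"
    unfolding presents_def
  proof (intro conjI)
    show "N \<inter> polys_in (insert z U) \<subseteq> local_span (polys_in W) N Z g"
    proof
      fix p assume p: "p \<in> N \<inter> polys_in (insert z U)"
      then obtain f where f: "p = poly f (Var z)" "f \<in> coeffs_in (polys_in U)"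
        by (auto simp: polys_in_insert adjoin_def)
      have "coeff f i \<in> local_span (polys_in W) N Z g" for i
        using coeff[of f i] f p pr unfolding presents_def coeffs_in_def by blast
      then show "p \<in> local_span (polys_in W) N Z g"
        unfolding f(1) using L.poly_eval_in xW by blast
    qed
    show "indep_mod (polys_in W) N Z (\<lambda>z j. pdiff j (g z)) (insert z U)"
      using pr unfolding presents_def indep_mod_def by blast
    show "\<forall>z'\<in>Z. g z' \<in> N \<inter> polys_in (insert z U)"
      using pr polys_in_mono[of U "insert z U"] unfolding presents_def by blast
  qed (use pr in \<open>auto simp: presents_def\<close>)
  have "z \<notin> Z" using pr U by (auto simp: presents_def)
  then have eq: "insert z U - Z = insert z (U - Z)" by auto
  show "N \<inter> polys_in (insert z U - Z) \<subseteq> {0}"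
    unfolding eq polys_in_insert
  proof
    fix p assume p: "p \<in> N \<inter> adjoin (polys_in (U - Z)) (Var z)"
    then obtain f where f: "p = poly f (Var z)" "f \<in> coeffs_in (polys_in (U - Z))"
      by (auto simp: adjoin_def)
    then have "f \<in> coeffs_in (polys_in U)"
      using polys_in_mono[of "U - Z" U] unfolding coeffs_in_def by blast
    then have "coeff f i \<in> N \<inter> polys_in (U - Z)" for i
      using coeff[of f i] f p by (auto simp: coeffs_in_def)
    then have "coeff f i = 0" for i using Z by blast
    then have "f = 0" by (simp add: poly_eq_iff)
    then show "p \<in> {0}" using f by simp
  qed
qed

text \<open>\<open>G\<close> of least degree plays the role of a minimal polynomial of
  \<open>z\<close> over the fraction field of the earlier variables modulo \<open>N\<close>. The
  second claim is incomparability in an algebraic extension: a prime above \<open>N\<close> that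
  adds nothing over \<open>U\<close> adds nothing after \<open>z\<close> is adjoined.\<close>

lemma presents_step_algebraic:
  fixes N N' :: "'k::field_char_0 mpoly set"
  assumes N: "prime_set (polys_in W) N" and N': "prime_set (polys_in W) N'" "N \<subseteq> N'"
    and U: "insert z U \<subseteq> W" "z \<notin> U" "finite U"
    and pr: "presents W N U Z g" and q: "q \<in> coeffs_in (polys_in U)" "poly q (Var z) \<in> N" "lead_coeff q \<notin> N"
  shows "\<exists>h. presents W N (insert z U) (insert z Z) (g(z := h))"
    and "N' \<inter> polys_in U \<subseteq> N \<Longrightarrow> N' \<inter> polys_in (insert z U) \<subseteq> N"
proof -
  interpret N: prime_set "polys_in W" N by fact
  interpret N': prime_set "polys_in W" N' by fact
  let ?x = "Var z"
  let ?C = "coeffs_in (polys_in U)"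
  have UW: "polys_in U \<subseteq> polys_in W" using U polys_in_mono[of U W] by auto
  have xW: "?x \<in> polys_in W" using U by auto
  have evW: "poly f ?x \<in> polys_in W" if "f \<in> ?C" for f
  proof -
    have "poly f ?x \<in> polys_in (insert z U)" using that by (auto simp: polys_in_insert adjoin_def)
    then show ?thesis using polys_in_mono[OF U(1)] by blast
  qed
  define P where "P q \<longleftrightarrow> q \<in> ?C \<and> poly q ?x \<in> N \<and> lead_coeff q \<notin> N" for q
  define G where "G = arg_min degree P"
  have "P q" using q by (simp add: P_def)
  then have PG: "P G" and Gmin: "\<And>q. P q \<Longrightarrow> degree G \<le> degree q"
    unfolding G_def by (auto intro: arg_min_nat_lemma arg_min_natI arg_min_nat_le)
  have G: "G \<in> ?C" "poly G ?x \<in> N" "lead_coeff G \<notin> N" using PG by (auto simp: P_def)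
  have lcU: "lead_coeff G \<in> polys_in U" using G(1) by auto
  have lcW: "lead_coeff G \<in> polys_in W" using lcU UW by blast
  have coeff: "coeff f i \<in> N" if "f \<in> ?C" "poly f ?x \<in> N" "f = 0 \<or> degree f < degree G" for f i
  proof (cases "f = 0")
    case False
    show ?thesis
      by (rule N.coeffs_in_prime[OF polys.subring_set_axioms UW xW that(1,2)])
        (use that(3) False Gmin in \<open>fastforce simp: P_def\<close>)
  qed simp
  have degG: "degree G > 0"
  proof (rule ccontr)
    assume "\<not> degree G > 0"
    then have "poly G ?x = lead_coeff G" by (simp add: poly_altdef)
    then show False using G by simp
  qed
  \<comment> \<open>This uses characteristic zero: the derivative has smaller degree than
    \<open>G\<close>, so membership would put its leading coefficient, a positive integer times that
    of \<open>G\<close>, into \<open>N\<close>.\<close>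
  have dG: "poly (pderiv G) ?x \<notin> N"
  proof
    assume "poly (pderiv G) ?x \<in> N"
    then have "coeff (pderiv G) (degree G - 1) \<in> N"
      using degG G(1) by (intro coeff) (auto simp: degree_pderiv intro: pderiv_coeffs_in polys.subring_set_axioms)
    then have "of_nat (degree G) * lead_coeff G \<in> N"
      using degG by (simp add: coeff_pderiv)
    then have "Const (inverse (of_nat (degree G))) * (of_nat (degree G) * lead_coeff G) \<in> N"
      by (rule N.mult_in_right[OF Const_in])
    moreover have "Const (inverse (of_nat (degree G))) * of_nat (degree G) = (1 :: 'k mpoly)"
      using Const_inverse[of "of_nat (degree G) :: 'k"] degG by (simp add: Const_of_nat)
    ultimately have "1 * lead_coeff G \<in> N" by (metis mult.assoc)
    then show False using G(3) by simp
  qed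
  define h where "h = g(z := poly G ?x)"
  have zZ: "z \<notin> Z" using pr U by (auto simp: presents_def)
  have finZ: "finite Z" using pr U(3) finite_subset by (auto simp: presents_def)
  have hZ: "h y = g y" if "y \<in> Z" for y using that zZ by (auto simp: h_def)
  have hz: "h z = poly G ?x" by (simp add: h_def)
  have gN: "g y \<in> N" "g y \<in> polys_in U" if "y \<in> Z" for y using that pr by (auto simp: presents_def)
  have hW: "h y \<in> polys_in W" if "y \<in> insert z Z" for y
    using that hZ hz gN N.subset G(2) by auto
  let ?L = "local_span (polys_in W) N (insert z Z) h"
  interpret L: ideal_set "polys_in W" ?L by (rule N.local_span_ideal)
  have inL: "h y \<in> ?L" if "y \<in> insert z Z" for y
    using finZ that hW by (intro N.local_span_incl) auto
  have old: "local_span (polys_in W) N Z g \<subseteq> ?L"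
    using inL hZ by (intro N.local_span_mono) (metis insertCI)
  have "presents W N (insert z U) (insert z Z) h"
    unfolding presents_def
  proof (intro conjI)
    show "insert z Z \<subseteq> insert z U" using pr by (auto simp: presents_def)
    have "poly G ?x \<in> polys_in (insert z U)" using G(1) by (auto simp: polys_in_insert adjoin_def)
    then show "\<forall>y\<in>insert z Z. h y \<in> N \<inter> polys_in (insert z U)"
      using hz hZ gN polys_in_mono[of U "insert z U"] G(2) by auto
    show "N \<inter> polys_in (insert z U) \<subseteq> ?L"
    proof
      fix p assume p: "p \<in> N \<inter> polys_in (insert z U)"
      then obtain f where f: "p = poly f ?x" "f \<in> ?C"
        by (auto simp: polys_in_insert adjoin_def)
      obtain k s r where *: "s \<in> ?C" "r \<in> ?C" "Polynomial.smult (lead_coeff G ^ k) f = s * G + r"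
        "r = 0 \<or> degree r < degree G"
        using polys.pseudo_division[OF G(1) f(2)] by blast
      have ev: "lead_coeff G ^ k * p = poly s ?x * poly G ?x + poly r ?x"
        using arg_cong[OF *(3), of "\<lambda>f. poly f ?x"] f(1) by simp
      have "poly r ?x = lead_coeff G ^ k * p - poly s ?x * poly G ?x" using ev by simp
      then have "poly r ?x \<in> N" using p G(2) lcW evW[OF *(1)] by auto
      \<comment> \<open>The remainder has degree below \<open>G\<close>, so its coefficients are
        elements of \<open>N\<close> over \<open>U\<close>, where the old generators
        suffice.\<close>
      then have "coeff r i \<in> N \<inter> polys_in U" for i
        using coeff[OF *(2) _ *(4)] *(2) by (auto simp: coeffs_in_def)
      then have "coeff r i \<in> ?L" for i using pr old unfolding presents_def by blast
      then have "poly r ?x \<in> ?L" using L.poly_eval_in xW by blast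
      then have "lead_coeff G ^ k * p \<in> ?L"
        unfolding ev using inL[of z] hz evW[OF *(1)] by auto
      moreover have "lead_coeff G ^ k \<in> polys_in W - N" using lcW G(3) N.power_notin by auto
      ultimately show "p \<in> ?L" using N.local_span_cancel p N.in_ring by blast
    qed
    \<comment> \<open>The matrix of gradients is block triangular: the old generators do not involve
      \<open>z\<close>, so column \<open>z\<close> alone forces \<open>c z\<close> into
      \<open>N\<close>, and the other columns are then handled by the old independence.\<close>
    show "indep_mod (polys_in W) N (insert z Z) (\<lambda>y j. pdiff j (h y)) (insert z U)"
      unfolding indep_mod_def
    proof (intro allI impI)
      fix c assume c: "(\<forall>i\<in>insert z Z. c i \<in> polys_in W) \<and>
        (\<forall>j\<in>insert z U. (\<Sum>i\<in>insert z Z. c i * pdiff j (h i)) \<in> N)"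
      have s: "(\<Sum>i\<in>insert z Z. c i * pdiff j (h i)) = c z * pdiff j (poly G ?x) + (\<Sum>i\<in>Z. c i * pdiff j (g i))" for j
        using zZ finZ hZ hz by (simp add: sum.insert)
      have "(\<Sum>i\<in>Z. c i * pdiff z (g i)) = 0"
        using pdiff_notin[OF gN(2) U(2)] by (intro sum.neutral) simp
      then have "c z * poly (pderiv G) ?x \<in> N"
        using c s[of z] pdiff_poly_eval[OF G(1) U(2)] by auto
      moreover have "poly (pderiv G) ?x \<in> polys_in W"
        using G(1) by (intro evW pderiv_coeffs_in polys.subring_set_axioms)
      ultimately have cz: "c z \<in> N" using N.prime_in[of "c z"] dG c by blast
      have pG: "pdiff j (poly G ?x) \<in> polys_in W" for j using evW[OF G(1)] pdiff_in by blast
      have "(\<Sum>i\<in>Z. c i * pdiff j (g i)) \<in> N" if "j \<in> U" for j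
      proof -
        have "(\<Sum>i\<in>insert z Z. c i * pdiff j (h i)) \<in> N" using c that by blast
        moreover have "c z * pdiff j (poly G ?x) \<in> N" using cz pG by auto
        ultimately show ?thesis unfolding s[of j] using N.diff_in_imp[of "\<Sum>i\<in>Z. c i * pdiff j (g i)"]
          N.diff_in[of "c z * pdiff j (poly G ?x) + (\<Sum>i\<in>Z. c i * pdiff j (g i))" "c z * pdiff j (poly G ?x)"]
          by (simp only: add_diff_cancel_left')
      qed
      moreover have "indep_mod (polys_in W) N Z (\<lambda>z j. pdiff j (g z)) U"
        using pr by (simp add: presents_def)
      ultimately have "\<forall>i\<in>Z. c i \<in> N" using c by (simp add: indep_mod_def)
      then show "\<forall>i\<in>insert z Z. c i \<in> N" using cz by blast
    qed
  qed
  then show "\<exists>h. presents W N (insert z U) (insert z Z) (g(z := h))" unfolding h_def by blast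

  assume eqU: "N' \<inter> polys_in U \<subseteq> N"
  show "N' \<inter> polys_in (insert z U) \<subseteq> N"
  proof (rule ccontr)
    assume nsub: "\<not> N' \<inter> polys_in (insert z U) \<subseteq> N"
    \<comment> \<open>\<open>F\<close> has least degree among the polynomials whose value separates
      \<open>N'\<close> from \<open>N\<close>. If its degree reached that of \<open>G\<close>, the
      remainder modulo \<open>G\<close> would separate them too. So \<open>G\<close> is divided by
      \<open>F\<close>: the remainder, and with it the quotient \<open>s\<close>, has its value in
      \<open>N\<close>. Then all their coefficients are in \<open>N\<close>, and so is a product of
      powers of leading coefficients outside \<open>N\<close>, a contradiction.\<close>
    define P' where "P' f \<longleftrightarrow> f \<in> ?C \<and> poly f ?x \<in> N' \<and> poly f ?x \<notin> N" for f
    obtain f where "P' f"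
      using nsub by (auto simp: polys_in_insert adjoin_def P'_def)
    define F where "F = arg_min degree P'"
    have PF: "P' F" and Fmin: "\<And>f. P' f \<Longrightarrow> degree F \<le> degree f"
      unfolding F_def using \<open>P' f\<close> by (auto intro: arg_min_nat_lemma arg_min_natI arg_min_nat_le)
    have F: "F \<in> ?C" "poly F ?x \<in> N'" "poly F ?x \<notin> N" using PF by (auto simp: P'_def)
    have small: "f = 0 \<or> degree f < degree F \<Longrightarrow> f \<in> ?C \<Longrightarrow> poly f ?x \<in> N' \<Longrightarrow> poly f ?x \<in> N" for f
      by (rule ccontr) (use Fmin[of f] in \<open>auto simp: P'_def\<close>)
    have lcFU: "lead_coeff F \<in> polys_in U" using F(1) by auto
    have lcFW: "lead_coeff F \<in> polys_in W" using lcFU UW by blast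
    have lcF: "lead_coeff F \<notin> N"
    proof
      assume lc: "lead_coeff F \<in> N"
      define H where "H = F - monom (lead_coeff F) (degree F)"
      have "H = 0 \<or> degree H < degree F" by (rule degree_minus_lead[OF H_def])
      moreover have "H \<in> ?C" using F(1) lcFU by (auto simp: H_def)
      moreover have eH: "poly H ?x = poly F ?x - lead_coeff F * ?x ^ degree F" by (simp add: H_def poly_monom)
      moreover have "poly H ?x \<in> N'" unfolding eH using F(2) lc N'(2) xW by (intro N'.diff_in N'.mult_in_left) auto
      ultimately have "poly F ?x - lead_coeff F * ?x ^ degree F \<in> N" using small[of H] by simp
      moreover have "lead_coeff F * ?x ^ degree F \<in> N" using lc xW by auto
      ultimately have "poly F ?x \<in> N" by (rule N.diff_in_imp)
      then show False using F(3) by simp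
    qed
    have degF: "degree F > 0"
    proof (rule ccontr)
      assume "\<not> degree F > 0"
      then have "poly F ?x = lead_coeff F" by (simp add: poly_altdef)
      then show False using F eqU lcFU by auto
    qed
    have less: "degree F < degree G"
    proof (rule ccontr)
      assume ge: "\<not> degree F < degree G"
      obtain k s r where *: "s \<in> ?C" "r \<in> ?C" "Polynomial.smult (lead_coeff G ^ k) F = s * G + r"
        "r = 0 \<or> degree r < degree G"
        using polys.pseudo_division[OF G(1) F(1)] by blast
      have ev: "lead_coeff G ^ k * poly F ?x = poly s ?x * poly G ?x + poly r ?x"
        using arg_cong[OF *(3), of "\<lambda>f. poly f ?x"] by simp
      then have r: "poly r ?x = lead_coeff G ^ k * poly F ?x - poly s ?x * poly G ?x" by simp
      have "poly r ?x \<in> N'" unfolding r using F(2) G(2) N'(2) lcW evW[OF *(1)] by auto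
      then have "poly r ?x \<in> N" using small[of r] *(2,4) ge by auto
      then have "lead_coeff G ^ k * poly F ?x \<in> N" unfolding ev using G(2) evW[OF *(1)] by auto
      then show False using N.prime_in[of "lead_coeff G ^ k"] F(1,3) G(3) lcW N.power_notin evW by blast
    qed
    obtain k s r where *: "s \<in> ?C" "r \<in> ?C" "Polynomial.smult (lead_coeff F ^ k) G = s * F + r"
      "r = 0 \<or> degree r < degree F"
      using polys.pseudo_division[OF F(1) G(1)] by blast
    have ev: "lead_coeff F ^ k * poly G ?x = poly s ?x * poly F ?x + poly r ?x"
      using arg_cong[OF *(3), of "\<lambda>f. poly f ?x"] by simp
    then have r: "poly r ?x = lead_coeff F ^ k * poly G ?x - poly s ?x * poly F ?x" by simp
    have "poly r ?x \<in> N'" unfolding r using F(2) G(2) N'(2) lcFW evW[OF *(1)] by auto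
    then have rN: "poly r ?x \<in> N" using small[of r] *(2,4) by auto
    have "poly s ?x * poly F ?x = lead_coeff F ^ k * poly G ?x - poly r ?x" using ev by simp
    then have "poly s ?x * poly F ?x \<in> N" using rN G(2) lcFW by auto
    then have sN: "poly s ?x \<in> N" using N.prime_in F(3) evW[OF *(1)] evW[OF F(1)] by blast
    have "s = 0 \<or> degree s < degree G"
    proof (rule ccontr)
      assume a: "\<not> (s = 0 \<or> degree s < degree G)"
      have "F \<noteq> 0" using degF by auto
      then have "degree (s * F) = degree s + degree F" using a by (intro degree_mult_eq) auto
      then have "degree (s * F) > degree G" "degree r < degree (s * F)" using a degF *(4) less by auto
      then have "degree (s * F + r) > degree G" by (simp add: degree_add_eq_left)
      then have "degree (Polynomial.smult (lead_coeff F ^ k) G) > degree G" unfolding *(3) .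
      then show False using degree_smult_le[of "lead_coeff F ^ k" G] by simp
    qed
    then have "coeff s i \<in> N" for i using coeff *(1) sN by blast
    moreover have "r = 0 \<or> degree r < degree G" using *(4) less by linarith
    then have "coeff r i \<in> N" for i using coeff[OF *(2) rN] by blast
    moreover have "coeff F i \<in> polys_in W" for i using F(1) UW by (auto simp: coeffs_in_def)
    ultimately have "coeff (s * F + r) (degree G) \<in> N"
      by (auto simp: coeff_mult intro!: N.sum_in)
    then have "lead_coeff F ^ k * lead_coeff G \<in> N" unfolding *(3)[symmetric] by simp
    then show False using N.prime_in[of "lead_coeff F ^ k" "lead_coeff G"] G(3) lcF lcW lcFW N.power_notin
      by blast
  qed
qed

text \<open>The variables of \<open>W - B\<close> are adjoined one at a time to the independent
  variables \<open>B\<close>. The second prime is carried along for the last claim: if every step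
  was algebraic, no step separates \<open>N'\<close> from \<open>N\<close>. Plain existence is the
  case \<open>N' = N\<close> with \<open>B\<close> empty.\<close>

lemma presentation_exists:
  fixes N N' :: "'k::field_char_0 mpoly set"
  assumes N: "prime_set (polys_in W) N" and N': "prime_set (polys_in W) N'" "N \<subseteq> N'"
    and W: "finite W" "B \<subseteq> W" and B: "N' \<inter> polys_in B \<subseteq> {0}"
  shows "\<exists>Z g. presents W N W Z g \<and> Z \<subseteq> W - B \<and> N \<inter> polys_in (W - Z) \<subseteq> {0} \<and> (Z = W - B \<longrightarrow> N' \<subseteq> N)"
proof -
  interpret N: prime_set "polys_in W" N by fact
  interpret N': prime_set "polys_in W" N' by fact
  have finB: "finite B" using W finite_subset by blast
  have "\<exists>Z g. presents W N (B \<union> X) Z g \<and> Z \<subseteq> X \<and> N \<inter> polys_in (B \<union> X - Z) \<subseteq> {0} \<and>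
      (Z = X \<longrightarrow> N' \<inter> polys_in (B \<union> X) \<subseteq> N)" if "finite X" "X \<subseteq> W - B" for X
    using that
  proof (induction X rule: finite_induct)
    case empty
    have "presents W N B {} undefined"
      using B N'(2) N.local_span_ideal[of "{}" undefined]
      by (auto simp: presents_def indep_mod_def dest!: ideal_set.zero_in)
    then show ?case using B N' by (intro exI[of _ "{}"] exI[of _ undefined]) auto
  next
    case (insert z X)
    then obtain Z g where IH: "presents W N (B \<union> X) Z g" "Z \<subseteq> X" "N \<inter> polys_in (B \<union> X - Z) \<subseteq> {0}"
      "Z = X \<longrightarrow> N' \<inter> polys_in (B \<union> X) \<subseteq> N" by auto
    let ?U = "B \<union> X"
    have U: "insert z ?U \<subseteq> W" "z \<notin> ?U" "finite ?U" using insert.prems insert.hyps W finB by auto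
    have eq: "B \<union> insert z X = insert z ?U" by auto
    have zZ: "z \<notin> Z" using IH(2) insert.hyps by auto
    show ?case
    proof (cases "\<exists>q. q \<in> coeffs_in (polys_in ?U) \<and> poly q (Var z) \<in> N \<and> lead_coeff q \<notin> N")
      case True
      then obtain q where q: "q \<in> coeffs_in (polys_in ?U)" "poly q (Var z) \<in> N" "lead_coeff q \<notin> N" by blast
      obtain h where h: "presents W N (insert z ?U) (insert z Z) (g(z := h))"
        using presents_step_algebraic(1)[OF N N' U IH(1) q] by blast
      moreover have "insert z ?U - insert z Z = ?U - Z" using U(2) by auto
      moreover have "insert z Z = insert z X \<Longrightarrow> N' \<inter> polys_in (insert z ?U) \<subseteq> N"
        using IH(4) zZ insert.hyps presents_step_algebraic(2)[OF N N' U IH(1) q] by (metis insert_ident)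
      ultimately show ?thesis unfolding eq using IH(2,3)
        by (intro exI[of _ "insert z Z"] exI[of _ "g(z := h)"] conjI) (simp_all only:, auto)
    next
      case False
      then have f: "\<And>q. q \<in> coeffs_in (polys_in ?U) \<Longrightarrow> poly q (Var z) \<in> N \<Longrightarrow> lead_coeff q \<in> N" by blast
      from presents_step_free[OF N U IH(1,3) f] show ?thesis unfolding eq using IH(2) zZ
        by (intro exI[of _ Z] exI[of _ g]) auto
    qed
  qed
  from this[of "W - B"] W have "\<exists>Z g. presents W N (B \<union> (W - B)) Z g \<and> Z \<subseteq> W - B \<and>
    N \<inter> polys_in (B \<union> (W - B) - Z) \<subseteq> {0} \<and> (Z = W - B \<longrightarrow> N' \<inter> polys_in (B \<union> (W - B)) \<subseteq> N)" by auto
  moreover have "B \<union> (W - B) = W" using W by auto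
  moreover have "N' \<inter> polys_in W = N'" using N'.subset by auto
  ultimately show ?thesis by auto
qed

lemma prime_Int_constants:
  assumes "prime_set (polys_in W) (N :: 'k::field mpoly set)"
  shows "N \<inter> polys_in {} \<subseteq> {0}"
proof
  interpret N: prime_set "polys_in W" N by fact
  fix p assume "p \<in> N \<inter> polys_in {}"
  then obtain c where c: "p = Const c" "Const c \<in> N" by (auto simp: polys_in_empty)
  have "c = 0"
  proof (rule ccontr)
    assume "c \<noteq> 0"
    then have "1 \<in> N" using N.mult_in_right[of "Const (inverse c)" "Const c"] c Const_inverse[of c] by auto
    then show False by simp
  qed
  then show "p \<in> {0}" using c by simp
qed

section \<open>Gradients of the elements of a prime\<close>

abbreviation grad :: "('i \<Rightarrow> 'k::field mpoly) \<Rightarrow> 'i \<Rightarrow> nat \<Rightarrow> 'k mpoly" where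
  "grad g \<equiv> \<lambda>i j. pdiff j (g i)"

text \<open>When the relation for \<open>s * p\<close> is differentiated, the terms in which
  \<open>s\<close> or some \<open>a z\<close> is differentiated keep a factor \<open>p\<close> or
  \<open>g z\<close> from \<open>N\<close>.\<close>

lemma grad_in_span_mod:
  assumes "prime_set (polys_in W) N" "s \<in> polys_in W - N" "p \<in> N"
    and "\<And>z. z \<in> Z \<Longrightarrow> a z \<in> polys_in W" "\<And>z. z \<in> Z \<Longrightarrow> g z \<in> N"
    and "s * p = (\<Sum>z\<in>Z. a z * g z)"
  shows "in_span_mod (polys_in W) N Z (grad g) W (\<lambda>j. pdiff j p)"
  unfolding in_span_mod_def
proof (intro bexI[of _ s] exI[of _ a] conjI ballI)
  interpret N: prime_set "polys_in W" N by fact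
  fix j
  have "s * pdiff j p + pdiff j s * p = (\<Sum>z\<in>Z. a z * pdiff j (g z)) + (\<Sum>z\<in>Z. pdiff j (a z) * g z)"
    using arg_cong[OF assms(6), of "pdiff j"]
    by (simp add: pdiff_mult pdiff_sum sum.distrib algebra_simps)
  then have "s * pdiff j p - (\<Sum>z\<in>Z. a z * pdiff j (g z)) = (\<Sum>z\<in>Z. pdiff j (a z) * g z) - pdiff j s * p"
    by (simp add: algebra_simps)
  moreover have "(\<Sum>z\<in>Z. pdiff j (a z) * g z) - pdiff j s * p \<in> N"
    using assms by (intro N.diff_in N.sum_in N.mult_in_right pdiff_in) auto
  ultimately show "s * pdiff j p - (\<Sum>z\<in>Z. a z * pdiff j (g z)) \<in> N" by simp
qed (use assms in auto)

lemma presents_grad_span: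
  assumes "prime_set (polys_in W) N" "presents W N W Z g" "p \<in> N"
  shows "in_span_mod (polys_in W) N Z (grad g) W (\<lambda>j. pdiff j p)"
proof -
  interpret N: prime_set "polys_in W" N by fact
  have "p \<in> local_span (polys_in W) N Z g" using assms N.subset unfolding presents_def by blast
  then obtain s a where "s \<in> polys_in W - N" "\<forall>z\<in>Z. a z \<in> polys_in W" "s * p = (\<Sum>z\<in>Z. a z * g z)"
    by (auto simp: local_span_def)
  then show ?thesis using assms unfolding presents_def
    by (intro grad_in_span_mod[of W N s p Z a g]) auto
qed

text \<open>The height of \<open>N\<close>, that is \<open>card W\<close> minus the transcendence degree of \<open>K[W]/N\<close>.\<close>

definition grad_rank :: "nat set \<Rightarrow> 'k::field mpoly set \<Rightarrow> nat" where
  "grad_rank W N = (SOME c. \<exists>Z g. presents W N W Z g \<and> c = card Z)"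

lemma grad_rankE:
  assumes "prime_set (polys_in W) (N :: 'k::field_char_0 mpoly set)" "finite W"
  obtains Z g where "presents W N W Z g" "grad_rank W N = card Z"
proof -
  obtain Z g where "presents W N W Z g"
    using presentation_exists[OF assms(1) assms(1) subset_refl assms(2) empty_subsetI prime_Int_constants[OF assms(1)]]
    by blast
  then have "\<exists>c Z g. presents W N W Z g \<and> c = card Z" by blast
  from someI_ex[OF this] show ?thesis using that unfolding grad_rank_def by blast
qed

text \<open>Together with \<open>grad_rank_le_card\<close> this shows that \<open>grad_rank\<close>
  is the dimension of the space spanned by the gradients of \<open>N\<close> modulo
  \<open>N\<close>, whichever presentation the choice in its definition picks.\<close>

lemma card_le_grad_rank:
  assumes N: "prime_set (polys_in W) (N :: 'k::field_char_0 mpoly set)" "finite W"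
    and X: "finite X" "\<And>x. x \<in> X \<Longrightarrow> h x \<in> N" "indep_mod (polys_in W) N X (grad h) W"
  shows "card X \<le> grad_rank W N"
proof -
  interpret N: prime_set "polys_in W" N by fact
  obtain Z g where Z: "presents W N W Z g" "grad_rank W N = card Z" using grad_rankE[OF N] .
  have "finite Z" using Z(1) N(2) finite_subset by (auto simp: presents_def)
  have "card X \<le> card Z"
  proof (rule N.indep_mod_card_le[OF X(1) \<open>finite Z\<close> X(3)])
    show "in_span_mod (polys_in W) N Z (grad g) W (grad h x)" if "x \<in> X" for x
      using presents_grad_span[OF N(1) Z(1) X(2)[OF that]] .
  qed (use Z(1) X(2) N.subset in \<open>auto simp: presents_def intro!: pdiff_in\<close>)
  then show ?thesis using Z by simp
qed

lemma grad_rank_le_card: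
  assumes N: "prime_set (polys_in W) (N :: 'k::field_char_0 mpoly set)" "finite W"
    and Y: "finite Y" "\<And>y j. y \<in> Y \<Longrightarrow> j \<in> W \<Longrightarrow> w y j \<in> polys_in W"
    and span: "\<And>p. p \<in> N \<Longrightarrow> in_span_mod (polys_in W) N Y w W (\<lambda>j. pdiff j p)"
  shows "grad_rank W N \<le> card Y"
proof -
  interpret N: prime_set "polys_in W" N by fact
  obtain Z g where Z: "presents W N W Z g" "grad_rank W N = card Z" using grad_rankE[OF N] .
  have "finite Z" using Z(1) N(2) finite_subset by (auto simp: presents_def)
  have "card Z \<le> card Y"
    by (rule N.indep_mod_card_le[OF \<open>finite Z\<close> Y(1), where u = "grad g" and w = w and C = W])
      (use Z(1) Y(2) N.subset span in \<open>auto simp: presents_def intro!: pdiff_in\<close>)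
  then show ?thesis using Z by simp
qed

lemma presents_card_eq:
  assumes N: "prime_set (polys_in W) (N :: 'k::field_char_0 mpoly set)" "finite W" "presents W N W Z g"
  shows "card Z = grad_rank W N"
proof (rule antisym)
  interpret N: prime_set "polys_in W" N by fact
  have "finite Z" using N(3,2) finite_subset by (auto simp: presents_def)
  then show "card Z \<le> grad_rank W N" "grad_rank W N \<le> card Z"
    using N card_le_grad_rank[OF N(1,2), of Z g] grad_rank_le_card[OF N(1,2), of Z "grad g"]
      presents_grad_span[OF N(1,3)] N.subset by (auto simp: presents_def intro!: pdiff_in)
qed

text \<open>The variables outside \<open>Z'\<close> are independent modulo \<open>N'\<close>, so a
  presentation of \<open>N\<close> can start from them, and its set \<open>Z\<close> lies in
  \<open>Z'\<close>. Equality would mean that every step was algebraic and so \<open>N'\<close> is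
  contained in \<open>N\<close>.\<close>

theorem grad_rank_strict_mono:
  assumes N: "prime_set (polys_in W) (N :: 'k::field_char_0 mpoly set)"
    and N': "prime_set (polys_in W) N'" and W: "finite W" and sub: "N \<subset> N'"
  shows "grad_rank W N < grad_rank W N'"
proof -
  obtain Z' g' where Z': "presents W N' W Z' g'" "N' \<inter> polys_in (W - Z') \<subseteq> {0}"
    using presentation_exists[OF N' N' subset_refl W empty_subsetI prime_Int_constants[OF N']] by blast
  have sub': "N \<subseteq> N'" using sub by auto
  obtain Z g where Z: "presents W N W Z g" "Z \<subseteq> W - (W - Z')" "Z = W - (W - Z') \<longrightarrow> N' \<subseteq> N"
    using presentation_exists[OF N N' sub' W _ Z'(2)] by blast
  have "Z' \<subseteq> W" using Z'(1) by (auto simp: presents_def)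
  then have "W - (W - Z') = Z'" by auto
  then have "Z \<subset> Z'" using Z sub by auto
  moreover have "finite Z'" using \<open>Z' \<subseteq> W\<close> W finite_subset by blast
  ultimately have "card Z < card Z'" by (rule psubset_card_mono[rotated])
  then show ?thesis using presents_card_eq[OF N W Z(1)] presents_card_eq[OF N' W Z'(1)] by simp
qed

section \<open>Rings of operators generated by multiplications and derivations\<close>

definition mult_op :: "'q::field set \<Rightarrow> 'q \<Rightarrow> 'q \<Rightarrow> 'q" where
  "mult_op R a = (\<lambda>x\<in>R. a * x)"

definition commutator_op :: "'q::field set \<Rightarrow> ('q \<Rightarrow> 'q) \<Rightarrow> 'q \<Rightarrow> 'q \<Rightarrow> 'q" where
  "commutator_op R D a = (\<lambda>x\<in>R. D (a * x) - a * D x)"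

text \<open>Orders of differential operators are shifted by one, so that only the zero operator has order 0.\<close>

fun has_order :: "'q::field set \<Rightarrow> nat \<Rightarrow> ('q \<Rightarrow> 'q) \<Rightarrow> bool" where
  "has_order R 0 D \<longleftrightarrow> (\<forall>x\<in>R. D x = 0)"
| "has_order R (Suc k) D \<longleftrightarrow> (\<forall>a\<in>R. has_order R k (commutator_op R D a))"

definition stable_ideal :: "'a::comm_ring_1 set \<Rightarrow> ('a \<Rightarrow> 'a) set \<Rightarrow> 'a set \<Rightarrow> bool" where
  "stable_ideal R \<Delta> N \<longleftrightarrow> ideal_set R N \<and> (\<forall>D\<in>\<Delta>. \<forall>x\<in>N. D x \<in> N)"

text \<open>Any set \<open>\<Delta>\<close> of derivations is allowed, because the comparison of the
  two notions of simplicity is formal; it is later instantiated with \<open>nat_der\<close>.\<close>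

locale operator_ring = subring_set R for R :: "'q::field set" +
  fixes \<kappa> :: "'k \<Rightarrow> 'q" and \<Delta> :: "('q \<Rightarrow> 'q) set"
  assumes \<kappa>_mem: "\<kappa> c \<in> R"
    and derivations: "\<Delta> \<subseteq> Der \<kappa> R"
begin

abbreviation "E \<equiv> End_ring \<kappa> R"

definition "gens = {\<lambda>x\<in>R. a * x | a. a \<in> R} \<union> \<Delta>"

definition "ops = E\<lparr>carrier := generate_ring E gens\<rparr>"

lemma End_simps:
  "\<one>\<^bsub>E\<^esub> = (\<lambda>x\<in>R. x)" "\<zero>\<^bsub>E\<^esub> = (\<lambda>x\<in>R. 0)"
  "D \<oplus>\<^bsub>E\<^esub> D' = (\<lambda>x\<in>R. D x + D' x)" "D \<otimes>\<^bsub>E\<^esub> D' = compose R D D'"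
  by (simp_all add: End_ring_def)

lemma EndI:
  "D \<in> R \<rightarrow>\<^sub>E R \<Longrightarrow> (\<And>x y. x \<in> R \<Longrightarrow> y \<in> R \<Longrightarrow> D (x + y) = D x + D y) \<Longrightarrow>
    (\<And>c x. x \<in> R \<Longrightarrow> D (\<kappa> c * x) = \<kappa> c * D x) \<Longrightarrow> D \<in> carrier E"
  by (simp add: End_ring_def)

lemma EndD:
  assumes "D \<in> carrier E"
  shows "D \<in> R \<rightarrow>\<^sub>E R" "x \<in> R \<Longrightarrow> D x \<in> R" "x \<in> R \<Longrightarrow> y \<in> R \<Longrightarrow> D (x + y) = D x + D y"
    "x \<in> R \<Longrightarrow> D (\<kappa> c * x) = \<kappa> c * D x"
  using assms by (auto simp: End_ring_def)

lemma End_zero: "D \<in> carrier E \<Longrightarrow> D 0 = 0"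
  using EndD(3)[of D 0 0] by (metis add_0 add_cancel_left_left zero_mem)

lemma End_uminus: "D \<in> carrier E \<Longrightarrow> x \<in> R \<Longrightarrow> D (- x) = - D x"
  using EndD(3)[of D x "- x"] End_zero[of D] by (simp add: eq_neg_iff_add_eq_0 add.commute)

lemma End_diff: "D \<in> carrier E \<Longrightarrow> x \<in> R \<Longrightarrow> y \<in> R \<Longrightarrow> D (x - y) = D x - D y"
  using EndD(3)[of D x "- y"] End_uminus[of D y] by simp

lemma End_eqI:
  assumes "D \<in> R \<rightarrow>\<^sub>E R" "D' \<in> R \<rightarrow>\<^sub>E R" "\<And>x. x \<in> R \<Longrightarrow> D x = D' x"
  shows "D = D'"
  using assms by (intro extensionalityI[of D R D']) (auto simp: PiE_iff)

lemma uminus_End: "D \<in> carrier E \<Longrightarrow> (\<lambda>x\<in>R. - D x) \<in> carrier E"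
  by (rule EndI) (auto simp: EndD \<kappa>_mem)

lemma ring_End: "ring E"
proof (rule ringI)
  show "abelian_group E"
  proof (rule abelian_groupI)
    fix D D' assume "D \<in> carrier E" "D' \<in> carrier E"
    then show "D \<oplus>\<^bsub>E\<^esub> D' \<in> carrier E"
      unfolding End_simps by (intro EndI) (use EndD \<kappa>_mem in \<open>auto simp: algebra_simps\<close>)
  next
    show "\<zero>\<^bsub>E\<^esub> \<in> carrier E" unfolding End_simps by (intro EndI) (use \<kappa>_mem in auto)
  next
    fix D assume D: "D \<in> carrier E"
    show "\<zero>\<^bsub>E\<^esub> \<oplus>\<^bsub>E\<^esub> D = D" unfolding End_simps
      by (rule End_eqI) (use EndD[OF D] in auto)
    show "\<exists>D'\<in>carrier E. D' \<oplus>\<^bsub>E\<^esub> D = \<zero>\<^bsub>E\<^esub>" unfolding End_simps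
      by (rule bexI[OF _ uminus_End[OF D]]) (auto simp: fun_eq_iff restrict_def)
  qed (auto simp: End_simps algebra_simps fun_eq_iff restrict_def)
  show "Group.monoid E"
  proof (rule monoidI)
    fix D D' assume D: "D \<in> carrier E" "D' \<in> carrier E"
    then show "D \<otimes>\<^bsub>E\<^esub> D' \<in> carrier E"
      unfolding End_simps compose_def by (intro EndI) (use EndD \<kappa>_mem in auto)
  next
    show "\<one>\<^bsub>E\<^esub> \<in> carrier E" unfolding End_simps by (intro EndI) (use \<kappa>_mem in auto)
  next
    fix D D' D'' assume "D \<in> carrier E" "D' \<in> carrier E" "D'' \<in> carrier E"
    then show "D \<otimes>\<^bsub>E\<^esub> D' \<otimes>\<^bsub>E\<^esub> D'' = D \<otimes>\<^bsub>E\<^esub> (D' \<otimes>\<^bsub>E\<^esub> D'')"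
      unfolding End_simps compose_def using EndD by (auto simp: fun_eq_iff restrict_def)
  next
    fix D assume D: "D \<in> carrier E"
    show "\<one>\<^bsub>E\<^esub> \<otimes>\<^bsub>E\<^esub> D = D" unfolding End_simps compose_def
      by (rule End_eqI) (use EndD[OF D] in auto)
    show "D \<otimes>\<^bsub>E\<^esub> \<one>\<^bsub>E\<^esub> = D" unfolding End_simps compose_def
      by (rule End_eqI) (use EndD[OF D] in auto)
  qed
next
  fix D D' D'' assume "D \<in> carrier E" "D' \<in> carrier E" "D'' \<in> carrier E"
  then show "(D \<oplus>\<^bsub>E\<^esub> D') \<otimes>\<^bsub>E\<^esub> D'' = D \<otimes>\<^bsub>E\<^esub> D'' \<oplus>\<^bsub>E\<^esub> D' \<otimes>\<^bsub>E\<^esub> D''"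
    "D'' \<otimes>\<^bsub>E\<^esub> (D \<oplus>\<^bsub>E\<^esub> D') = D'' \<otimes>\<^bsub>E\<^esub> D \<oplus>\<^bsub>E\<^esub> D'' \<otimes>\<^bsub>E\<^esub> D'"
    unfolding End_simps compose_def using EndD by (auto simp: fun_eq_iff restrict_def)
qed

sublocale End: ring E by (rule ring_End)

lemma End_a_inv: "D \<in> carrier E \<Longrightarrow> \<ominus>\<^bsub>E\<^esub> D = (\<lambda>x\<in>R. - D x)"
proof -
  assume D: "D \<in> carrier E"
  have "(\<lambda>x\<in>R. - D x) \<oplus>\<^bsub>E\<^esub> D = \<zero>\<^bsub>E\<^esub>" unfolding End_simps by (auto simp: fun_eq_iff restrict_def)
  then show ?thesis using End.minus_equality[OF _ D uminus_End[OF D]] by simp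
qed

lemma mult_op_End: "a \<in> R \<Longrightarrow> mult_op R a \<in> carrier E"
  unfolding mult_op_def by (intro EndI) (use \<kappa>_mem in \<open>auto simp: algebra_simps\<close>)

lemma gens_End: "gens \<subseteq> carrier E"
  using mult_op_End derivations by (auto simp: gens_def Der_def mult_op_def)

lemma subring_ops: "subring (carrier ops) E"
  using End.generate_ring_is_subring[OF gens_End] by (simp add: ops_def)

lemma ring_ops: "ring ops"
  using End.generate_ring_is_ring[OF gens_End] by (simp add: ops_def)

sublocale ops: ring ops by (rule ring_ops)

lemma ops_simps [simp]:
  "\<one>\<^bsub>ops\<^esub> = (\<lambda>x\<in>R. x)" "\<zero>\<^bsub>ops\<^esub> = (\<lambda>x\<in>R. 0)"
  "D \<oplus>\<^bsub>ops\<^esub> D' = (\<lambda>x\<in>R. D x + D' x)" "D \<otimes>\<^bsub>ops\<^esub> D' = compose R D D'"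
  by (simp_all add: ops_def End_simps)

lemma ops_End: "D \<in> carrier ops \<Longrightarrow> D \<in> carrier E"
  using subringE(1)[OF subring_ops] by auto

lemma mult_op_ops: "a \<in> R \<Longrightarrow> mult_op R a \<in> carrier ops"
  unfolding ops_def by (auto simp: mult_op_def gens_def intro!: generate_ring.incl)

lemma derivation_ops: "D \<in> \<Delta> \<Longrightarrow> D \<in> carrier ops"
  unfolding ops_def by (auto simp: gens_def intro!: generate_ring.incl)

lemma ops_a_inv: "D \<in> carrier ops \<Longrightarrow> \<ominus>\<^bsub>ops\<^esub> D = (\<lambda>x\<in>R. - D x)"
proof -
  assume D: "D \<in> carrier ops"
  have "(\<lambda>x\<in>R. - D x) \<in> carrier ops"
    using subringE(5)[OF subring_ops D] End_a_inv[OF ops_End[OF D]] by simp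
  moreover have "(\<lambda>x\<in>R. - D x) \<oplus>\<^bsub>ops\<^esub> D = \<zero>\<^bsub>ops\<^esub>" by (auto simp: fun_eq_iff restrict_def)
  ultimately show ?thesis using ops.minus_equality[OF _ D] by simp
qed

lemma ops_induct [consumes 1, case_names mult derivation uminus add compose]:
  assumes "D \<in> carrier ops"
    and "\<And>a. a \<in> R \<Longrightarrow> P (mult_op R a)" "\<And>D. D \<in> \<Delta> \<Longrightarrow> P D"
    and "\<And>D. D \<in> carrier ops \<Longrightarrow> P D \<Longrightarrow> P (\<lambda>x\<in>R. - D x)"
    and "\<And>D D'. D \<in> carrier ops \<Longrightarrow> D' \<in> carrier ops \<Longrightarrow> P D \<Longrightarrow> P D' \<Longrightarrow> P (\<lambda>x\<in>R. D x + D' x)"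
    and "\<And>D D'. D \<in> carrier ops \<Longrightarrow> D' \<in> carrier ops \<Longrightarrow> P D \<Longrightarrow> P D' \<Longrightarrow> P (compose R D D')"
  shows "P D"
proof -
  have "D \<in> generate_ring E gens" using assms(1) by (simp add: ops_def)
  then show ?thesis
  proof (induction rule: generate_ring.induct)
    case one
    have "\<one>\<^bsub>E\<^esub> = mult_op R 1" by (simp add: End_simps mult_op_def)
    then show ?case using assms(2) by simp
  next
    case (incl h)
    then show ?case using assms(2,3) by (auto simp: gens_def mult_op_def)
  next
    case (a_inv h)
    then have h: "h \<in> carrier ops" by (simp add: ops_def)
    then show ?case using assms(4)[OF h] a_inv by (simp only: End_a_inv[OF ops_End[OF h]])
  next
    case (eng_add h1 h2)
    then have h: "h1 \<in> carrier ops" "h2 \<in> carrier ops" by (simp_all add: ops_def)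
    show ?case using assms(5)[OF h eng_add.IH] by (simp only: End_simps)
  next
    case (eng_mult h1 h2)
    then have h: "h1 \<in> carrier ops" "h2 \<in> carrier ops" by (simp_all add: ops_def)
    show ?case using assms(6)[OF h eng_mult.IH] by (simp only: End_simps)
  qed
qed

lemma stable_ops:
  assumes "stable_ideal R \<Delta> N" "D \<in> carrier ops" "x \<in> N"
  shows "D x \<in> N"
proof -
  interpret N: ideal_set R N using assms by (simp add: stable_ideal_def)
  show ?thesis using assms(2,3)
  proof (induction arbitrary: x rule: ops_induct)
    case (derivation D)
    then show ?case using assms(1) by (auto simp: stable_ideal_def)
  next
    case (add D D')
    then show ?case using N.in_ring by auto
  qed (use N.in_ring in \<open>auto simp: mult_op_def compose_def\<close>)
qed

section \<open>The evaluation module and its submodules\<close>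

lemma left_module_evaluation: "left_module ops (evaluation_module R)"
  unfolding left_module_def
proof (intro conjI)
  show "ring ops" by (rule ring_ops)
  show "abelian_group (evaluation_module R)"
  proof (rule abelian_groupI)
    show "\<exists>y\<in>carrier (evaluation_module R). y \<oplus>\<^bsub>evaluation_module R\<^esub> x = \<zero>\<^bsub>evaluation_module R\<^esub>"
      if "x \<in> carrier (evaluation_module R)" for x
      using that by (intro bexI[of _ "- x"]) (auto simp: evaluation_module_def)
  qed (auto simp: evaluation_module_def algebra_simps)
qed (use EndD ops_End in \<open>auto simp: evaluation_module_def compose_def\<close>)

lemma evaluation_a_inv:
  "x \<in> R \<Longrightarrow> inv\<^bsub>add_monoid (evaluation_module R)\<^esub> x = - x"
proof -
  assume x: "x \<in> R"
  interpret M: abelian_group "evaluation_module R"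
    using left_module_evaluation by (simp add: left_module_def)
  have "\<ominus>\<^bsub>evaluation_module R\<^esub> x = - x"
    by (rule M.minus_equality) (use x in \<open>auto simp: evaluation_module_def\<close>)
  then show ?thesis by (simp add: a_inv_def)
qed

lemma submodule_iff: "Module.submodule N ops (evaluation_module R) \<longleftrightarrow> stable_ideal R \<Delta> N"
proof
  assume "Module.submodule N ops (evaluation_module R)"
  then interpret N: Module.submodule N ops "evaluation_module R" .
  have sm: "D x \<in> N" if "D \<in> carrier ops" "x \<in> N" for D x
    using N.smult_closed[of D x] that by (simp add: evaluation_module_def)
  have sub: "N \<subseteq> R" using N.subset by (simp add: evaluation_module_def)
  show "stable_ideal R \<Delta> N"
    unfolding stable_ideal_def
  proof (intro conjI ballI)
    show "ideal_set R N"
    proof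
      show "0 \<in> N" using N.one_closed by (simp add: evaluation_module_def)
      show "x + y \<in> N" if "x \<in> N" "y \<in> N" for x y
        using N.m_closed that by (simp add: evaluation_module_def)
      show "x * y \<in> N" if "x \<in> R" "y \<in> N" for x y
      proof -
        have "mult_op R x y \<in> N" using sm[OF mult_op_ops] that by blast
        moreover have "mult_op R x y = x * y" using that sub by (auto simp: mult_op_def)
        ultimately show ?thesis by simp
      qed
    qed (rule sub)
  qed (use sm derivation_ops in auto)
next
  assume st: "stable_ideal R \<Delta> N"
  then interpret N: ideal_set R N by (simp add: stable_ideal_def)
  show "Module.submodule N ops (evaluation_module R)"
  proof (intro Module.submodule.intro subgroup.intro Module.submodule_axioms.intro)
    fix x assume "x \<in> N"
    then show "inv\<^bsub>add_monoid (evaluation_module R)\<^esub> x \<in> N"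
      using evaluation_a_inv N.in_ring by auto
  next
    fix D x assume "D \<in> carrier ops" "x \<in> N"
    then show "D \<odot>\<^bsub>evaluation_module R\<^esub> x \<in> N" using stable_ops[OF st] by (simp add: evaluation_module_def)
  qed (use N.subset in \<open>auto simp: evaluation_module_def\<close>)
qed

lemma simple_module_iff:
  "simple_left_module ops (evaluation_module R) \<longleftrightarrow> (\<forall>N. stable_ideal R \<Delta> N \<longrightarrow> N = {0} \<or> N = R)"
proof -
  have "R \<noteq> {0}" using one_mem by (metis singletonD zero_neq_one)
  then show ?thesis
    unfolding simple_left_module_def submodule_iff using left_module_evaluation
    by (simp add: evaluation_module_def)
qed

section \<open>Orders of operators\<close>

lemma commutator_End:
  assumes "D \<in> carrier E" "a \<in> R"
  shows "commutator_op R D a \<in> carrier E"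
proof -
  have "D (a * (\<kappa> c * x)) = \<kappa> c * D (a * x)" if "x \<in> R" for c x
    using EndD(4)[OF assms(1), of "a * x" c] assms that by (simp add: mult.left_commute)
  then show ?thesis
    unfolding commutator_op_def
    by (intro EndI) (use assms EndD[OF assms(1)] \<kappa>_mem in \<open>auto simp: algebra_simps\<close>)
qed

lemma has_order_cong: "(\<And>x. x \<in> R \<Longrightarrow> D x = D' x) \<Longrightarrow> has_order R k D = has_order R k D'"
proof (induction k arbitrary: D D')
  case (Suc k)
  have "commutator_op R D a = commutator_op R D' a" if "a \<in> R" for a
    using Suc.prems that by (auto simp: commutator_op_def fun_eq_iff restrict_def)
  then show ?case by simp
qed auto

lemma has_order_zero: "(\<And>x. x \<in> R \<Longrightarrow> D x = 0) \<Longrightarrow> has_order R k D"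
proof (induction k arbitrary: D)
  case (Suc k)
  then show ?case by (auto simp: commutator_op_def intro!: Suc.IH)
qed auto

lemma has_order_Suc: "has_order R k D \<Longrightarrow> has_order R (Suc k) D"
proof (induction k arbitrary: D)
  case 0
  then show ?case by (auto simp: commutator_op_def)
qed auto

lemma has_order_mono: "has_order R k D \<Longrightarrow> k \<le> l \<Longrightarrow> has_order R l D"
proof (induction l)
  case (Suc l)
  then show ?case using has_order_Suc[of l D] by (cases "k = Suc l") auto
qed auto

lemma has_order_add:
  "has_order R k D \<Longrightarrow> has_order R k D' \<Longrightarrow> has_order R k (\<lambda>x\<in>R. D x + D' x)"
proof (induction k arbitrary: D D')
  case (Suc k)
  show ?case unfolding has_order.simps
  proof
    fix a assume a: "a \<in> R"
    have "has_order R k (\<lambda>x\<in>R. commutator_op R D a x + commutator_op R D' a x)"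
      using Suc.prems a by (intro Suc.IH) auto
    then show "has_order R k (commutator_op R (\<lambda>x\<in>R. D x + D' x) a)"
      by (rule has_order_cong[THEN iffD1, rotated]) (use a in \<open>auto simp: commutator_op_def algebra_simps\<close>)
  qed
qed auto

lemma has_order_uminus: "has_order R k D \<Longrightarrow> has_order R k (\<lambda>x\<in>R. - D x)"
proof (induction k arbitrary: D)
  case (Suc k)
  show ?case unfolding has_order.simps
  proof
    fix a assume a: "a \<in> R"
    have "has_order R k (\<lambda>x\<in>R. - commutator_op R D a x)"
      using Suc.prems a by (intro Suc.IH) auto
    then show "has_order R k (commutator_op R (\<lambda>x\<in>R. - D x) a)"
      by (rule has_order_cong[THEN iffD1, rotated]) (use a in \<open>auto simp: commutator_op_def algebra_simps\<close>)
  qed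
qed auto

text \<open>The commutator of a composition is \<open>[D D', a] = D [D', a] + [D, a] D'\<close>, and
  both summands have a smaller sum of orders. With shifted orders \<open>k + l\<close> is one above
  the sharp bound, which is enough for the existence of an order.\<close>

lemma has_order_compose:
  assumes "D \<in> carrier E" "D' \<in> carrier E" "has_order R k D" "has_order R l D'"
  shows "has_order R (k + l) (compose R D D')"
  using assms
proof (induction "k + l" arbitrary: k l D D')
  case 0
  then show ?case using EndD by (auto simp: compose_def)
next
  case (Suc m)
  show ?case
  proof (cases "k = 0 \<or> l = 0")
    case True
    then have "compose R D D' x = 0" if "x \<in> R" for x
      using Suc.prems that EndD(2)[of D' x] End_zero[of D] by (auto simp: compose_def)
    then show ?thesis by (intro has_order_zero)
  next
    case False
    then obtain k' l' where kl: "k = Suc k'" "l = Suc l'" by (meson not0_implies_Suc)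
    have "has_order R m (commutator_op R (compose R D D') a)" if a: "a \<in> R" for a
    proof -
      have "has_order R (k + l') (compose R D (commutator_op R D' a))"
        using Suc kl a by (intro Suc.hyps(1)) (auto intro: commutator_End)
      moreover have "has_order R (k' + l) (compose R (commutator_op R D a) D')"
        using Suc kl a by (intro Suc.hyps(1)) (auto intro: commutator_End)
      ultimately have "has_order R m (\<lambda>x\<in>R. compose R D (commutator_op R D' a) x + compose R (commutator_op R D a) D' x)"
        using Suc.hyps(2) kl by (intro has_order_add) auto
      then show ?thesis
      proof (rule has_order_cong[THEN iffD1, rotated])
        fix x assume x: "x \<in> R"
        show "(\<lambda>x\<in>R. compose R D (commutator_op R D' a) x + compose R (commutator_op R D a) D' x) x =
            commutator_op R (compose R D D') a x"
          using x a EndD(2)[OF Suc.prems(2)] End_diff[OF Suc.prems(1)]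
          by (auto simp: commutator_op_def compose_def)
      qed
    qed
    then show ?thesis using Suc.hyps(2)[symmetric] by simp
  qed
qed

lemma derivation_mult:
  "D \<in> \<Delta> \<Longrightarrow> x \<in> R \<Longrightarrow> y \<in> R \<Longrightarrow> D (x * y) = D x * y + x * D y"
  using derivations by (auto simp: Der_def)

lemma ops_has_order: "D \<in> carrier ops \<Longrightarrow> \<exists>k. has_order R k D"
proof (induction rule: ops_induct)
  case (mult a)
  have "has_order R 1 (mult_op R a)" by (auto simp: commutator_op_def mult_op_def)
  then show ?case by blast
next
  case (derivation D)
  then have "D x \<in> R" if "x \<in> R" for x using that ops_End[OF derivation_ops] EndD(2) by blast
  \<comment> \<open>Order one, shifted by one: the commutator with \<open>a\<close> is
    multiplication by \<open>D a\<close>.\<close>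
  then have "has_order R (Suc (Suc 0)) D"
    using derivation by (auto simp: commutator_op_def derivation_mult algebra_simps)
  then show ?case by blast
next
  case (uminus D)
  then show ?case using has_order_uminus by blast
next
  case (add D D')
  then obtain k l where "has_order R k D" "has_order R l D'" by blast
  then have "has_order R (max k l) D" "has_order R (max k l) D'" using has_order_mono by auto
  then show ?case using has_order_add by blast
next
  case (compose D D')
  then show ?case using has_order_compose ops_End by blast
qed

theorem simple_ring_iff_simple_module:
  "simple_ring ops \<longleftrightarrow> simple_left_module ops (evaluation_module R)"
proof
  assume simple: "simple_ring ops"
  show "simple_left_module ops (evaluation_module R)"
    unfolding simple_module_iff
  proof (intro allI impI)
    fix N assume st: "stable_ideal R \<Delta> N"
    then interpret N: ideal_set R N by (simp add: stable_ideal_def)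
    \<comment> \<open>The operators with image in \<open>N\<close> form a left ideal because all
      operators preserve the stable ideal \<open>N\<close>, and a right ideal because composition on
      the right only shrinks the image. This ideal contains the multiplications by elements of
      \<open>N\<close>, and it contains the identity only if \<open>N = R\<close>.\<close>
    let ?J = "{D \<in> carrier ops. \<forall>x\<in>R. D x \<in> N}"
    have "ideal ?J ops"
    proof (rule idealI[OF ring_ops])
      show "subgroup ?J (add_monoid ops)"
      proof (rule group.subgroupI)
        show "Group.group (add_monoid ops)" by (rule ops.add.group_axioms)
        show "?J \<noteq> {}" using ops.zero_closed by auto
      next
        fix D assume D: "D \<in> ?J"
        then have "inv\<^bsub>add_monoid ops\<^esub> D = (\<lambda>x\<in>R. - D x)" using ops_a_inv[of D] by (simp add: a_inv_def)
        then show "inv\<^bsub>add_monoid ops\<^esub> D \<in> ?J"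
          using D ops.a_inv_closed[of D] ops_a_inv[of D] by auto
      next
        fix D D' assume "D \<in> ?J" "D' \<in> ?J"
        then show "D \<otimes>\<^bsub>add_monoid ops\<^esub> D' \<in> ?J" using ops.a_closed[of D D'] by auto
      qed auto
    next
      fix D D' assume D: "D \<in> ?J" "D' \<in> carrier ops"
      show "D' \<otimes>\<^bsub>ops\<^esub> D \<in> ?J"
        using D ops.m_closed[of D' D] stable_ops[OF st] by (auto simp: compose_def)
      show "D \<otimes>\<^bsub>ops\<^esub> D' \<in> ?J"
        using D ops.m_closed[of D D'] EndD(2)[OF ops_End] by (auto simp: compose_def)
    qed
    then consider "?J = {\<zero>\<^bsub>ops\<^esub>}" | "?J = carrier ops" using simple by (auto simp: simple_ring_def)
    then show "N = {0} \<or> N = R"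
    proof cases
      case 1
      have "a = 0" if "a \<in> N" for a
      proof -
        have "mult_op R a \<in> ?J" using that mult_op_ops N.in_ring by (auto simp: mult_op_def)
        then have "mult_op R a = (\<lambda>x\<in>R. 0)" using 1 by auto
        then have "mult_op R a 1 = 0" by simp
        then show "a = 0" by (simp add: mult_op_def)
      qed
      then show ?thesis by auto
    next
      case 2
      then have "\<one>\<^bsub>ops\<^esub> \<in> ?J" using ops.one_closed by simp
      then have "\<forall>x\<in>R. x \<in> N" by simp
      then show ?thesis using N.subset by blast
    qed
  qed
next
  assume simple: "simple_left_module ops (evaluation_module R)"
  show "simple_ring ops"
    unfolding simple_ring_def
  proof (intro conjI allI impI)
    show "ring ops" by (rule ring_ops)
    have "\<one>\<^bsub>ops\<^esub> \<noteq> \<zero>\<^bsub>ops\<^esub>"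
    proof
      assume "\<one>\<^bsub>ops\<^esub> = \<zero>\<^bsub>ops\<^esub>"
      then have "(\<lambda>x\<in>R. x) 1 = (\<lambda>x\<in>R. 0 :: 'q) 1" by simp
      then show False by simp
    qed
    then show "carrier ops \<noteq> {\<zero>\<^bsub>ops\<^esub>}" using ops.one_closed by blast
    fix J assume "ideal J ops"
    then interpret J: ideal J ops .
    show "J = {\<zero>\<^bsub>ops\<^esub>} \<or> J = carrier ops"
    proof (rule disjCI)
      assume "J \<noteq> carrier ops"
      show "J = {\<zero>\<^bsub>ops\<^esub>}"
      proof (rule ccontr)
        assume "J \<noteq> {\<zero>\<^bsub>ops\<^esub>}"
        then obtain D0 where "D0 \<in> J" "D0 \<noteq> \<zero>\<^bsub>ops\<^esub>"
          using additive_subgroup.zero_closed[OF J.is_additive_subgroup] by blast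
        \<comment> \<open>A nonzero element of \<open>J\<close> of least order: its commutators with
          multiplications are in \<open>J\<close> and of smaller order, hence zero. So it commutes
          with all multiplications and is itself multiplication by \<open>D 1\<close>.\<close>
        define P where "P k \<longleftrightarrow> (\<exists>D\<in>J. D \<noteq> \<zero>\<^bsub>ops\<^esub> \<and> has_order R k D)" for k
        have minus_J: "D \<ominus>\<^bsub>ops\<^esub> D' \<in> J" if "D \<in> J" "D' \<in> J" for D D'
          unfolding a_minus_def
          using that additive_subgroup.a_closed[OF J.is_additive_subgroup]
            additive_subgroup.a_inv_closed[OF J.is_additive_subgroup] by blast
        have JE: "D \<in> carrier E" if "D \<in> J" for D using that J.a_subset ops_End by blast
        have Jops: "D \<in> carrier ops" if "D \<in> J" for D using that J.a_subset by blast
        obtain k0 where "has_order R k0 D0" using ops_has_order[OF Jops[OF \<open>D0 \<in> J\<close>]] by blast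
        then have "\<exists>k. P k" using \<open>D0 \<in> J\<close> \<open>D0 \<noteq> \<zero>\<^bsub>ops\<^esub>\<close> unfolding P_def by blast
        then obtain k where k: "P k" "\<And>l. l < k \<Longrightarrow> \<not> P l" by (metis exists_least_iff)
        then obtain D where D: "D \<in> J" "D \<noteq> \<zero>\<^bsub>ops\<^esub>" "has_order R k D" by (auto simp: P_def)
        have zeroI: "D' = \<zero>\<^bsub>ops\<^esub>" if "D' \<in> carrier E" "\<forall>x\<in>R. D' x = 0" for D'
          using that EndD(1)[OF that(1)] by (auto intro!: End_eqI)
        have "k \<noteq> 0"
        proof
          assume "k = 0"
          then show False using D zeroI[OF JE[OF D(1)]] by simp
        qed
        then obtain k' where k': "k = Suc k'" by (cases k) auto
        have comm: "commutator_op R D a \<in> J" if "D \<in> J" "a \<in> R" for D a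
        proof -
          have m: "mult_op R a \<in> carrier ops" using that mult_op_ops by blast
          have "D \<otimes>\<^bsub>ops\<^esub> mult_op R a \<ominus>\<^bsub>ops\<^esub> mult_op R a \<otimes>\<^bsub>ops\<^esub> D \<in> J"
            using m that Jops[OF that(1)] J.I_l_closed[OF that(1) m] J.I_r_closed[OF that(1) m]
            by (intro minus_J) (auto simp del: ops_simps)
          moreover have "D \<otimes>\<^bsub>ops\<^esub> mult_op R a \<ominus>\<^bsub>ops\<^esub> mult_op R a \<otimes>\<^bsub>ops\<^esub> D = commutator_op R D a"
            using m that Jops[OF that(1)] ops.m_closed[OF m Jops[OF that(1)]] EndD(2)[OF JE[OF that(1)]]
            unfolding a_minus_def
            by (subst ops_a_inv) (auto simp: compose_def commutator_op_def mult_op_def fun_eq_iff restrict_def)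
          ultimately show ?thesis by simp
        qed
        have c0: "commutator_op R D a = \<zero>\<^bsub>ops\<^esub>" if "a \<in> R" for a
          using k(2)[of k'] k' comm[OF D(1) that] D(3) that by (auto simp: P_def)
        have "D (a * x) - a * D x = 0" if "a \<in> R" "x \<in> R" for a x
          using fun_cong[OF c0[OF that(1)], of x] that(2) by (simp add: commutator_op_def)
        then have Dx: "D x = D 1 * x" if "x \<in> R" for x
          using that one_mem by (metis eq_iff_diff_eq_0 mult.commute mult.right_neutral)
        have D1: "D 1 \<in> R" using EndD(2)[OF JE[OF D(1)]] by simp
        have Dm: "D = mult_op R (D 1)"
        proof (rule End_eqI[OF EndD(1)[OF JE[OF D(1)]] EndD(1)[OF mult_op_End[OF D1]]])
          fix x assume x: "x \<in> R"
          show "D x = mult_op R (D 1) x" unfolding mult_op_def restrict_apply'[OF x] by (rule Dx[OF x])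
        qed
        \<comment> \<open>The multiplications in \<open>J\<close> form a stable ideal, because the
          commutator of a derivation with multiplication by \<open>b\<close> is multiplication by
          the derivative of \<open>b\<close>.\<close>
        define N where "N = {b \<in> R. mult_op R b \<in> J}"
        have "stable_ideal R \<Delta> N"
          unfolding stable_ideal_def
        proof (intro conjI ballI)
          show "ideal_set R N"
          proof
            have "mult_op R 0 = \<zero>\<^bsub>ops\<^esub>" by (auto simp: mult_op_def fun_eq_iff restrict_def)
            then have "mult_op R 0 \<in> J"
              using additive_subgroup.zero_closed[OF J.is_additive_subgroup] by (simp only:)
            then show "0 \<in> N" by (simp add: N_def)
          next
            fix x y assume "x \<in> N" "y \<in> N"
            then have "mult_op R x \<oplus>\<^bsub>ops\<^esub> mult_op R y \<in> J" "x \<in> R" "y \<in> R"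
              using additive_subgroup.a_closed[OF J.is_additive_subgroup] by (auto simp: N_def simp del: ops_simps)
            moreover have "mult_op R x \<oplus>\<^bsub>ops\<^esub> mult_op R y = mult_op R (x + y)"
              by (auto simp: mult_op_def fun_eq_iff restrict_def algebra_simps)
            ultimately show "x + y \<in> N" by (simp add: N_def)
          next
            fix x y assume "x \<in> R" "y \<in> N"
            then have "mult_op R x \<otimes>\<^bsub>ops\<^esub> mult_op R y \<in> J" "y \<in> R"
              using J.I_l_closed mult_op_ops by (auto simp: N_def simp del: ops_simps)
            moreover have "mult_op R x \<otimes>\<^bsub>ops\<^esub> mult_op R y = mult_op R (x * y)"
              using \<open>y \<in> R\<close> by (auto simp: mult_op_def compose_def fun_eq_iff restrict_def algebra_simps)
            ultimately show "x * y \<in> N" using \<open>x \<in> R\<close> by (simp add: N_def)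
          qed (auto simp: N_def)
        next
          fix \<delta> b assume \<delta>: "\<delta> \<in> \<Delta>" and b: "b \<in> N"
          have bR: "b \<in> R" and bJ: "mult_op R b \<in> J" using b by (auto simp: N_def)
          have \<delta>o: "\<delta> \<in> carrier ops" using \<delta> by (rule derivation_ops)
          have \<delta>b: "\<delta> b \<in> R" using EndD(2)[OF ops_End[OF \<delta>o] bR] .
          have "\<delta> \<otimes>\<^bsub>ops\<^esub> mult_op R b \<ominus>\<^bsub>ops\<^esub> mult_op R b \<otimes>\<^bsub>ops\<^esub> \<delta> \<in> J"
            using \<delta>o bJ J.I_l_closed[OF bJ \<delta>o] J.I_r_closed[OF bJ \<delta>o]
            by (intro minus_J) (auto simp del: ops_simps)
          moreover have "\<delta> \<otimes>\<^bsub>ops\<^esub> mult_op R b \<ominus>\<^bsub>ops\<^esub> mult_op R b \<otimes>\<^bsub>ops\<^esub> \<delta> = mult_op R (\<delta> b)"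
            using ops.m_closed[OF mult_op_ops[OF bR] \<delta>o] bR EndD(2)[OF ops_End[OF \<delta>o]] \<delta>
            unfolding a_minus_def
            by (subst ops_a_inv) (auto simp: compose_def mult_op_def fun_eq_iff restrict_def derivation_mult)
          ultimately show "\<delta> b \<in> N" using \<delta>b by (simp add: N_def)
        qed
        then have "N = {0} \<or> N = R" using simple simple_module_iff by blast
        moreover have "D 1 \<in> N" using D1 Dm D(1) by (simp add: N_def)
        moreover have "D 1 \<noteq> 0"
        proof
          assume "D 1 = 0"
          then have "\<forall>x\<in>R. D x = 0" using Dx by (metis mult_zero_left)
          then show False using zeroI[OF JE[OF D(1)]] D(2) by blast
        qed
        ultimately have "mult_op R 1 \<in> J" using one_mem by (auto simp: N_def)
        then have "\<one>\<^bsub>ops\<^esub> \<in> J" by (simp add: mult_op_def)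
        then show False using J.one_imp_carrier \<open>J \<noteq> carrier ops\<close> by blast
      qed
    qed
  qed
qed

end

section \<open>Largest stable ideals\<close>

text \<open>Functions on the whole type rather than extensional ones as in \<open>Der\<close>, so
  that one derivation of the field can be used on every localization.\<close>

definition derivation_on :: "'a::comm_ring_1 set \<Rightarrow> ('a \<Rightarrow> 'a) \<Rightarrow> bool" where
  "derivation_on R D \<longleftrightarrow> (\<forall>x\<in>R. D x \<in> R) \<and> (\<forall>x\<in>R. \<forall>y\<in>R. D (x + y) = D x + D y) \<and>
     (\<forall>x\<in>R. \<forall>y\<in>R. D (x * y) = D x * y + x * D y)"

definition largest_stable :: "'a::comm_ring_1 set \<Rightarrow> ('a \<Rightarrow> 'a) set \<Rightarrow> 'a set \<Rightarrow> 'a set" where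
  "largest_stable R \<Delta> N = \<Union>{M. stable_ideal R \<Delta> M \<and> M \<subseteq> N}"

context prime_set begin

context
  fixes \<Delta> :: "('a \<Rightarrow> 'a) set"
  assumes der: "\<And>D. D \<in> \<Delta> \<Longrightarrow> derivation_on R D"
begin

lemma der_simps:
  assumes "D \<in> \<Delta>" "x \<in> R"
  shows "D x \<in> R" "y \<in> R \<Longrightarrow> D (x + y) = D x + D y" "y \<in> R \<Longrightarrow> D (x * y) = D x * y + x * D y"
  using der[OF assms(1)] assms(2) by (auto simp: derivation_on_def)

lemma der_zero: "D \<in> \<Delta> \<Longrightarrow> D 0 = 0"
  using der_simps(2)[of D 0 0] by simp

lemma der_power: "D \<in> \<Delta> \<Longrightarrow> x \<in> R \<Longrightarrow> D (x ^ Suc k) = of_nat (Suc k) * x ^ k * D x"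
proof (induction k)
  case (Suc k)
  have "D (x ^ Suc (Suc k)) = D x * x ^ Suc k + x * D (x ^ Suc k)"
    using der_simps(3)[OF Suc.prems, of "x ^ Suc k"] Suc.prems by simp
  also have "\<dots> = of_nat (Suc (Suc k)) * x ^ Suc k * D x"
    by (subst Suc.IH[OF Suc.prems]) (simp add: algebra_simps)
  finally show ?case .
qed simp

lemma largest_stable_subset: "largest_stable R \<Delta> N \<subseteq> N"
  by (auto simp: largest_stable_def)

lemma largest_stable_maximal: "stable_ideal R \<Delta> M \<Longrightarrow> M \<subseteq> N \<Longrightarrow> M \<subseteq> largest_stable R \<Delta> N"
  by (auto simp: largest_stable_def)

lemma zero_stable: "stable_ideal R \<Delta> {0}"
  unfolding stable_ideal_def using der_zero by (auto intro!: ideal_set.intro subring_set_axioms ideal_set_axioms.intro)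

text \<open>The union is closed under addition because two stable ideals inside \<open>N\<close>
  have a sum that is again stable and inside \<open>N\<close>.\<close>

lemma stable_largest_stable: "stable_ideal R \<Delta> (largest_stable R \<Delta> N)"
  unfolding stable_ideal_def
proof (intro conjI ballI)
  show "ideal_set R (largest_stable R \<Delta> N)"
  proof
    show "largest_stable R \<Delta> N \<subseteq> R" using largest_stable_subset subset by blast
    show "0 \<in> largest_stable R \<Delta> N"
      using largest_stable_maximal[OF zero_stable] by auto
  next
    fix x y assume "x \<in> largest_stable R \<Delta> N" "y \<in> largest_stable R \<Delta> N"
    then obtain M M' where M: "stable_ideal R \<Delta> M" "M \<subseteq> N" "x \<in> M" "stable_ideal R \<Delta> M'" "M' \<subseteq> N" "y \<in> M'"
      by (auto simp: largest_stable_def)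
    interpret M: ideal_set R M using M by (simp add: stable_ideal_def)
    interpret M': ideal_set R M' using M by (simp add: stable_ideal_def)
    let ?S = "{a + b | a b. a \<in> M \<and> b \<in> M'}"
    have "ideal_set R ?S"
    proof
      show "?S \<subseteq> R" using M.in_ring M'.in_ring by auto
      show "0 \<in> ?S" by (intro CollectI exI[of _ 0]) auto
    next
      fix u v assume "u \<in> ?S" "v \<in> ?S"
      then obtain a b c d where "u = a + b" "v = c + d" "a \<in> M" "b \<in> M'" "c \<in> M" "d \<in> M'" by auto
      then show "u + v \<in> ?S" by (intro CollectI exI[of _ "a + c"] exI[of _ "b + d"]) auto
    next
      fix u v assume "u \<in> R" "v \<in> ?S"
      then obtain c d where "v = c + d" "c \<in> M" "d \<in> M'" by auto
      then show "u * v \<in> ?S" using \<open>u \<in> R\<close>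
        by (intro CollectI exI[of _ "u * c"] exI[of _ "u * d"]) (auto simp: algebra_simps)
    qed
    moreover have "D z \<in> ?S" if D: "D \<in> \<Delta>" and z: "z \<in> ?S" for D z
    proof -
      obtain c d where cd: "z = c + d" "c \<in> M" "d \<in> M'" using z by auto
      then have "D z = D c + D d" using der_simps(2)[OF D] M.in_ring M'.in_ring by auto
      then show ?thesis using M cd D unfolding stable_ideal_def by blast
    qed
    ultimately have "stable_ideal R \<Delta> ?S" by (auto simp: stable_ideal_def)
    moreover have "?S \<subseteq> N" using M by auto
    ultimately have "?S \<subseteq> largest_stable R \<Delta> N" by (rule largest_stable_maximal)
    then show "x + y \<in> largest_stable R \<Delta> N" using M by blast
  next
    fix x y assume "x \<in> R" "y \<in> largest_stable R \<Delta> N"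
    then obtain M where M: "stable_ideal R \<Delta> M" "M \<subseteq> N" "y \<in> M"
      by (auto simp: largest_stable_def)
    then show "x * y \<in> largest_stable R \<Delta> N"
      using \<open>x \<in> R\<close> largest_stable_maximal[OF M(1,2)] ideal_set.mult_in_right[of R M x y]
      by (auto simp: stable_ideal_def)
  qed
next
  fix D x assume "D \<in> \<Delta>" "x \<in> largest_stable R \<Delta> N"
  then show "D x \<in> largest_stable R \<Delta> N"
    by (auto simp: largest_stable_def stable_ideal_def)
qed

text \<open>The radical of a stable ideal is stable: from \<open>x\<^sup>k \<in> M\<close> one derives successively
  \<open>x\<^sup>k\<^sup>-\<^sup>i (D x)\<^sup>2\<^sup>i \<in> M\<close>, dividing by the exponent of \<open>x\<close> at each step.\<close>

lemma stable_radical: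
  assumes inv: "\<And>k. k > 0 \<Longrightarrow> \<exists>c\<in>R. c * of_nat k = 1"
    and M: "stable_ideal R \<Delta> M"
  shows "stable_ideal R \<Delta> {x \<in> R. \<exists>k. x ^ k \<in> M}"
proof -
  interpret M: ideal_set R M using M by (simp add: stable_ideal_def)
  have le: "x ^ l \<in> M" if "x ^ k \<in> M" "k \<le> l" "x \<in> R" for x k l
  proof -
    have "x ^ l = x ^ (l - k) * x ^ k" using that by (simp flip: power_add)
    then show ?thesis using that by auto
  qed
  have "ideal_set R {x \<in> R. \<exists>k. x ^ k \<in> M}"
  proof
    show "0 \<in> {x \<in> R. \<exists>k. x ^ k \<in> M}" by (auto intro: exI[of _ 1])
  next
    fix x y assume "x \<in> {x \<in> R. \<exists>k. x ^ k \<in> M}" "y \<in> {x \<in> R. \<exists>k. x ^ k \<in> M}"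
    then obtain k l where xy: "x ^ k \<in> M" "y ^ l \<in> M" "x \<in> R" "y \<in> R" by auto
    have "(x + y) ^ (k + l) = (\<Sum>i\<le>k + l. of_nat ((k + l) choose i) * x ^ i * y ^ (k + l - i))"
      by (rule binomial_ring)
    also have "\<dots> \<in> M"
    proof (rule M.sum_in)
      fix i assume "i \<in> {..k + l}"
      show "of_nat ((k + l) choose i) * x ^ i * y ^ (k + l - i) \<in> M"
      proof (cases "k \<le> i")
        case True
        then show ?thesis using le[OF xy(1) True xy(3)] xy by auto
      next
        case False
        then have "y ^ (k + l - i) \<in> M" by (intro le[OF xy(2) _ xy(4)]) simp
        then show ?thesis using xy by auto
      qed
    qed
    finally show "x + y \<in> {x \<in> R. \<exists>k. x ^ k \<in> M}" using xy by auto
  next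
    fix x y assume "x \<in> R" "y \<in> {x \<in> R. \<exists>k. x ^ k \<in> M}"
    then show "x * y \<in> {x \<in> R. \<exists>k. x ^ k \<in> M}" by (auto simp: power_mult_distrib)
  qed auto
  moreover have "D x \<in> {x \<in> R. \<exists>k. x ^ k \<in> M}"
    if D: "D \<in> \<Delta>" and x: "x \<in> {x \<in> R. \<exists>k. x ^ k \<in> M}" for D x
  proof -
    obtain k where k: "x ^ k \<in> M" "x \<in> R" using x by auto
    have Dx: "D x \<in> R" using der_simps(1)[OF D k(2)] .
    have "x ^ (k - i) * D x ^ (2 * i) \<in> M" if "i \<le> k" for i
      using that
    proof (induction i)
      case 0
      then show ?case using k by simp
    next
      case (Suc i)
      define e where "e = k - Suc i"
      have e: "k - i = Suc e" using Suc.prems by (simp add: e_def)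
      have IH: "x ^ Suc e * D x ^ (2 * i) \<in> M" using Suc by (simp add: e)
      then have "D (x ^ Suc e * D x ^ (2 * i)) \<in> M" using M D by (auto simp: stable_ideal_def)
      moreover have "D (x ^ Suc e * D x ^ (2 * i)) =
          of_nat (Suc e) * x ^ e * D x * D x ^ (2 * i) + x ^ Suc e * D (D x ^ (2 * i))"
        using der_simps(3)[OF D, of "x ^ Suc e" "D x ^ (2 * i)"] k Dx der_power[OF D k(2), of e] by simp
      \<comment> \<open>The extra factor \<open>D x\<close> turns the second summand into a multiple
        of the induction hypothesis. What is left is a positive integer times
        \<open>x ^ e * D x ^ (2 * Suc i)\<close>.\<close>
      ultimately have "D x * (of_nat (Suc e) * x ^ e * D x * D x ^ (2 * i) + x ^ Suc e * D (D x ^ (2 * i))) \<in> M"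
        using Dx by auto
      moreover have "D x * (x ^ Suc e * D (D x ^ (2 * i))) \<in> M"
      proof (cases i)
        case 0
        have "D 1 = 0" using der_simps(3)[OF D, of 1 1] by simp
        then show ?thesis using 0 by simp
      next
        case (Suc j)
        have "D (D x ^ (2 * i)) = of_nat (2 * i) * D x ^ (2 * i - 1) * D (D x)"
          using der_power[OF D Dx, of "2 * i - 1"] Suc by simp
        moreover have "D x * (x ^ Suc e * (of_nat (2 * i) * D x ^ (2 * i - 1) * D (D x))) =
          (of_nat (2 * i) * D (D x)) * (x ^ Suc e * D x ^ (2 * i))"
          using Suc by (simp add: algebra_simps)
        moreover have "of_nat (2 * i) * D (D x) \<in> R" using der_simps(1)[OF D Dx] by (intro mult_mem of_nat_mem)
        ultimately show ?thesis using M.mult_in_right[OF _ IH] by simp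
      qed
      ultimately have "D x * (of_nat (Suc e) * x ^ e * D x * D x ^ (2 * i)) \<in> M"
        using M.diff_in[of "D x * (of_nat (Suc e) * x ^ e * D x * D x ^ (2 * i) + x ^ Suc e * D (D x ^ (2 * i)))"
          "D x * (x ^ Suc e * D (D x ^ (2 * i)))"] by (simp add: algebra_simps)
      then have m: "of_nat (Suc e) * (x ^ e * D x ^ (2 * Suc i)) \<in> M" by (simp add: algebra_simps)
      obtain c where c: "c \<in> R" "c * of_nat (Suc e) = 1" using inv[of "Suc e"] by auto
      have "c * (of_nat (Suc e) * (x ^ e * D x ^ (2 * Suc i))) \<in> M" using M.mult_in_right[OF c(1) m] .
      then have "x ^ e * D x ^ (2 * Suc i) \<in> M" unfolding mult.assoc[symmetric] c(2) by simp
      then show ?case by (simp add: e_def)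
    qed
    from this[of k] have "D x ^ (2 * k) \<in> M" by simp
    then show ?thesis using Dx by blast
  qed
  ultimately show ?thesis by (simp add: stable_ideal_def)
qed

text \<open>For a radical stable ideal \<open>M\<close> the quotients \<open>(M : c)\<close> are stable as well; for \<open>c\<close> outside \<open>N\<close>
  such a quotient lies in \<open>N\<close>, hence in \<open>M\<close> if \<open>M\<close> is the largest stable ideal in \<open>N\<close>.\<close>

theorem prime_largest_stable:
  assumes inv: "\<And>k. k > 0 \<Longrightarrow> \<exists>c\<in>R. c * of_nat k = 1"
  shows "prime_set R (largest_stable R \<Delta> N)"
proof -
  let ?M = "largest_stable R \<Delta> N"
  have st: "stable_ideal R \<Delta> ?M" by (rule stable_largest_stable)
  interpret M: ideal_set R ?M using st by (simp add: stable_ideal_def)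
  have rad: "x \<in> ?M" if "x \<in> R" "x ^ k \<in> ?M" for x k
  proof -
    have "{x \<in> R. \<exists>k. x ^ k \<in> ?M} \<subseteq> N"
      using largest_stable_subset power_notin by blast
    then show ?thesis using largest_stable_maximal[OF stable_radical[OF inv st]] that by blast
  qed
  have quot: "stable_ideal R \<Delta> {x \<in> R. c * x \<in> ?M}" if c: "c \<in> R" for c
    unfolding stable_ideal_def
  proof (intro conjI ballI)
    show "ideal_set R {x \<in> R. c * x \<in> ?M}"
    proof
      fix x y assume "x \<in> R" "y \<in> {x \<in> R. c * x \<in> ?M}"
      then show "x * y \<in> {x \<in> R. c * x \<in> ?M}"
        using M.mult_in_right[of x "c * y"] by (simp add: mult.left_commute)
    qed (auto simp: distrib_left)
    fix D x assume D: "D \<in> \<Delta>" and x: "x \<in> {x \<in> R. c * x \<in> ?M}"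
    have xR: "x \<in> R" and cx: "c * x \<in> ?M" using x by auto
    have DR: "D c \<in> R" "D x \<in> R" using der_simps(1)[OF D] c xR by auto
    have "D (c * x) \<in> ?M" using st D cx by (auto simp: stable_ideal_def)
    then have "D c * x + c * D x \<in> ?M" using der_simps(3)[OF D c xR] by simp
    \<comment> \<open>Multiplied by \<open>c * D x\<close>, the term with \<open>D c\<close> becomes
      a multiple of \<open>c * x\<close>, so the square of \<open>c * D x\<close> is in the ideal,
      which is radical.\<close>
    then have "(c * D x) * (D c * x + c * D x) \<in> ?M" using c DR by auto
    moreover have "(c * D x) * (D c * x) \<in> ?M"
      using M.mult_in_right[OF _ cx, of "D x * D c"] DR by (simp add: algebra_simps)
    ultimately have "(c * D x) ^ 2 \<in> ?M"
      using M.diff_in[of "(c * D x) * (D c * x + c * D x)" "(c * D x) * (D c * x)"]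
      by (simp add: algebra_simps power2_eq_square)
    then show "D x \<in> {x \<in> R. c * x \<in> ?M}" using rad c DR by auto
  qed
  show ?thesis
  proof
    show "1 \<notin> ?M" using largest_stable_subset one_notin by blast
  next
    fix x y assume xy: "x \<in> R" "y \<in> R" "x * y \<in> ?M"
    show "x \<in> ?M \<or> y \<in> ?M"
    proof (rule disjCI)
      assume "y \<notin> ?M"
      \<comment> \<open>The quotient by \<open>x\<close> contains \<open>y\<close>, so it is not
        inside \<open>N\<close>. Any \<open>c\<close> in it outside \<open>N\<close> has a quotient
        inside \<open>N\<close>, and that quotient contains \<open>x\<close>.\<close>
      have "y \<in> {y \<in> R. x * y \<in> ?M}" using xy by simp
      then have "\<not> {y \<in> R. x * y \<in> ?M} \<subseteq> N"
        using largest_stable_maximal[OF quot[OF xy(1)]] \<open>y \<notin> ?M\<close> by (meson subsetD)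
      then obtain c where c: "c \<in> R" "x * c \<in> ?M" "c \<notin> N" by blast
      have "{x \<in> R. c * x \<in> ?M} \<subseteq> N"
        using prime_in[OF c(1)] c(3) largest_stable_subset by blast
      then have "{x \<in> R. c * x \<in> ?M} \<subseteq> ?M" by (rule largest_stable_maximal[OF quot[OF c(1)]])
      then show "x \<in> ?M" using c xy(1) by (auto simp: mult.commute)
    qed
  qed
qed

end

end

section \<open>Minors and independence\<close>

abbreviation entry_mat :: "('i \<Rightarrow> 'c \<Rightarrow> 'a) \<Rightarrow> 'i list \<Rightarrow> 'c list \<Rightarrow> 'a mat" where
  "entry_mat u xs ys \<equiv> mat (length xs) (length ys) (\<lambda>(i, j). u (xs ! i) (ys ! j))"

lemma (in subring_set) det_mem:
  assumes "A \<in> carrier_mat k k" "\<And>i j. i < k \<Longrightarrow> j < k \<Longrightarrow> A $$ (i, j) \<in> R"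
  shows "det A \<in> R"
proof -
  have "signof p * (\<Prod>i = 0..<k. A $$ (i, p i)) \<in> R" if "p permutes {0..<k}" for p
  proof (rule mult_mem)
    show "signof p \<in> R" by (simp add: sign_def)
    have "p i < k" if "i < k" for i using permutes_in_image[OF \<open>p permutes _\<close>, of i] that by simp
    then show "(\<Prod>i = 0..<k. A $$ (i, p i)) \<in> R" using assms(2) by (intro prod_mem) auto
  qed
  then show ?thesis unfolding det_def'[OF assms(1)] by (intro sum_mem) auto
qed

lemma sum_set_nth:
  "distinct xs \<Longrightarrow> (\<Sum>x\<in>set xs. h x) = (\<Sum>i<length xs. h (xs ! i))"
  by (simp add: sum.distinct_set_conv_list sum_list_sum_nth atLeast0LessThan)

context prime_set begin

text \<open>The products with the other vectors vanish exactly and not only modulo \<open>N\<close>.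
  Such a vector is a certificate of independence that survives ring maps and changes of the
  prime.\<close>

lemma indep_mod_dual_vector:
  assumes "finite X" "finite C" "indep_mod R N X u C" "x0 \<in> X"
    and u: "\<And>x j. x \<in> X \<Longrightarrow> j \<in> C \<Longrightarrow> u x j \<in> R"
  shows "\<exists>v. (\<forall>j\<in>C. v j \<in> R) \<and> (\<forall>x\<in>X - {x0}. (\<Sum>j\<in>C. u x j * v j) = 0) \<and> (\<Sum>j\<in>C. u x0 j * v j) \<notin> N"
proof (rule indep_mod_orthogonal)
  fix c e assume c: "\<And>i. i \<in> X - {x0} \<Longrightarrow> c i \<in> R" "e \<in> R"
    "\<And>j. j \<in> C \<Longrightarrow> (\<Sum>i\<in>X - {x0}. c i * u i j) + e * u x0 j \<in> N"
  define d where "d i = (if i = x0 then e else c i)" for i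
  have "(\<Sum>i\<in>X. d i * u i j) = (\<Sum>i\<in>X - {x0}. c i * u i j) + e * u x0 j" for j
  proof -
    have "(\<Sum>i\<in>X - {x0}. d i * u i j) = (\<Sum>i\<in>X - {x0}. c i * u i j)"
      by (rule sum.cong) (auto simp: d_def)
    then show ?thesis using sum.remove[OF assms(1,4), of "\<lambda>i. d i * u i j"] by (simp add: d_def add.commute)
  qed
  then have d: "d i \<in> N" if "i \<in> X" for i
    using indep_modD[OF assms(3), of d i] c that by (auto simp: d_def)
  show "e \<in> N \<and> (\<forall>i\<in>X - {x0}. c i \<in> N)"
  proof (intro conjI ballI)
    show "e \<in> N" using d[OF assms(4)] by (simp add: d_def)
    fix i assume "i \<in> X - {x0}"
    then show "c i \<in> N" using d[of i] by (simp add: d_def)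
  qed
qed (use assms in auto)

text \<open>Coefficients in \<open>R'\<close> need not come from \<open>R\<close>, so a relation
  cannot be lifted. Instead it is paired with the image of the dual vector of \<open>x0\<close>:
  only the term of \<open>x0\<close> survives, and its second factor is outside \<open>N'\<close> by
  \<open>ker\<close>.\<close>

lemma indep_mod_transfer:
  assumes P: "prime_set R' N'" and X: "finite X" "finite C" "indep_mod R N X u C"
    and u: "\<And>x j. x \<in> X \<Longrightarrow> j \<in> C \<Longrightarrow> u x j \<in> R"
    and hom: "\<And>x. x \<in> R \<Longrightarrow> h x \<in> R'" "\<And>x y. x \<in> R \<Longrightarrow> y \<in> R \<Longrightarrow> h (x + y) = h x + h y"
      "\<And>x y. x \<in> R \<Longrightarrow> y \<in> R \<Longrightarrow> h (x * y) = h x * h y" "h 0 = 0"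
    and ker: "\<And>x. x \<in> R \<Longrightarrow> h x \<in> N' \<Longrightarrow> x \<in> N"
  shows "indep_mod R' N' X (\<lambda>i j. h (u i j)) C"
  unfolding indep_mod_def
proof (intro allI impI ballI)
  interpret P: prime_set R' N' by fact
  fix c x0 assume c: "(\<forall>i\<in>X. c i \<in> R') \<and> (\<forall>j\<in>C. (\<Sum>i\<in>X. c i * h (u i j)) \<in> N')" and x0: "x0 \<in> X"
  obtain v where v: "\<forall>j\<in>C. v j \<in> R" "\<forall>x\<in>X - {x0}. (\<Sum>j\<in>C. u x j * v j) = 0" "(\<Sum>j\<in>C. u x0 j * v j) \<notin> N"
    using indep_mod_dual_vector[OF X x0 u] by blast
  have hsum: "h (sum g Z) = (\<Sum>z\<in>Z. h (g z))" if "\<And>z. z \<in> Z \<Longrightarrow> g z \<in> R" "Z \<subseteq> C" for g Z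
    using that
  proof (induction Z rule: infinite_finite_induct)
    case (insert z Z)
    then have "sum g Z \<in> R" by (intro sum_mem) auto
    then show ?case using insert by (simp add: hom(2))
  qed (use hom(4) in auto)
  have dot: "(\<Sum>j\<in>C. h (u x j) * h (v j)) = h (\<Sum>j\<in>C. u x j * v j)" if "x \<in> X" for x
    using hsum[of C "\<lambda>j. u x j * v j"] u[OF that] v(1) by (simp add: hom(3))
  have "(\<Sum>j\<in>C. h (v j) * (\<Sum>i\<in>X. c i * h (u i j))) \<in> N'"
    by (rule P.sum_in, rule P.mult_in_right) (use c v(1) hom(1) in auto)
  also have "(\<Sum>j\<in>C. h (v j) * (\<Sum>i\<in>X. c i * h (u i j))) = (\<Sum>j\<in>C. \<Sum>i\<in>X. c i * (h (u i j) * h (v j)))"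
    by (simp add: sum_distrib_left algebra_simps)
  also have "\<dots> = (\<Sum>i\<in>X. \<Sum>j\<in>C. c i * (h (u i j) * h (v j)))" by (rule sum.swap)
  also have "\<dots> = (\<Sum>i\<in>X. c i * h (\<Sum>j\<in>C. u i j * v j))"
    using dot by (simp add: sum_distrib_left[symmetric])
  also have "\<dots> = c x0 * h (\<Sum>j\<in>C. u x0 j * v j) + (\<Sum>i\<in>X - {x0}. c i * h (\<Sum>j\<in>C. u i j * v j))"
    by (rule sum.remove[OF X(1) x0])
  also have "(\<Sum>i\<in>X - {x0}. c i * h (\<Sum>j\<in>C. u i j * v j)) = 0"
    using v(2) hom(4) by (intro sum.neutral) simp
  finally have prod: "c x0 * h (\<Sum>j\<in>C. u x0 j * v j) \<in> N'" by simp
  have R: "(\<Sum>j\<in>C. u x0 j * v j) \<in> R" using v(1) u[OF x0] by (intro sum_mem mult_mem) auto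
  then show "c x0 \<in> N'" using P.prime_in[OF _ hom(1)[OF R] prod] c x0 ker[OF R] v(3) by blast
qed

lemma indep_mod_smaller_prime:
  assumes "prime_set R N'" "N' \<subseteq> N" "finite X" "finite C" "indep_mod R N X u C"
    and "\<And>x j. x \<in> X \<Longrightarrow> j \<in> C \<Longrightarrow> u x j \<in> R"
  shows "indep_mod R N' X u C"
  using indep_mod_transfer[OF assms(1,3-6), of "\<lambda>x. x"] assms(2) by auto

text \<open>Multiplied by the matrix of dual vectors, the matrix becomes diagonal with diagonal
  entries outside \<open>N\<close>, so its determinant divides an element outside
  \<open>N\<close>.\<close>

lemma det_notin:
  assumes d: "distinct xs" "distinct ys" "length xs = length ys"
    and ind: "indep_mod R N (set xs) u (set ys)"
    and u: "\<And>x j. x \<in> set xs \<Longrightarrow> j \<in> set ys \<Longrightarrow> u x j \<in> R"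
  shows "det (entry_mat u xs ys) \<notin> N"
proof
  let ?r = "length xs"
  let ?U = "entry_mat u xs ys"
  assume detU: "det ?U \<in> N"
  have "\<forall>x0\<in>set xs. \<exists>v. (\<forall>j\<in>set ys. v j \<in> R) \<and> (\<forall>x\<in>set xs - {x0}. (\<Sum>j\<in>set ys. u x j * v j) = 0) \<and>
      (\<Sum>j\<in>set ys. u x0 j * v j) \<notin> N"
    using indep_mod_dual_vector[OF _ _ ind _ u] by blast
  from bchoice[OF this] obtain v where
    v: "\<And>x j. x \<in> set xs \<Longrightarrow> j \<in> set ys \<Longrightarrow> v x j \<in> R"
    "\<And>x x0. x0 \<in> set xs \<Longrightarrow> x \<in> set xs - {x0} \<Longrightarrow> (\<Sum>j\<in>set ys. u x j * v x0 j) = 0"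
    "\<And>x0. x0 \<in> set xs \<Longrightarrow> (\<Sum>j\<in>set ys. u x0 j * v x0 j) \<notin> N" by metis
  define V where "V = mat ?r ?r (\<lambda>(j, i). v (xs ! i) (ys ! j))"
  have U: "?U \<in> carrier_mat ?r ?r" using d by simp
  have V: "V \<in> carrier_mat ?r ?r" by (simp add: V_def)
  have UV: "(?U * V) $$ (i, k) = (\<Sum>j\<in>set ys. u (xs ! i) j * v (xs ! k) j)" if "i < ?r" "k < ?r" for i k
    using that d unfolding sum_set_nth[OF d(2)]
    by (simp add: V_def scalar_prod_def atLeast0LessThan)
  have "upper_triangular (?U * V)"
    unfolding upper_triangular_def
  proof (intro allI impI)
    fix i k assume i: "i < dim_row (?U * V)" "k < i"
    then have "xs ! i \<noteq> xs ! k" using d(1) by (simp add: nth_eq_iff_index_eq)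
    then have "(\<Sum>j\<in>set ys. u (xs ! i) j * v (xs ! k) j) = 0"
      using i by (intro v(2)) auto
    then show "(?U * V) $$ (i, k) = 0" using UV[of i k] i by simp
  qed
  then have "det (?U * V) = prod_list (diag_mat (?U * V))"
    by (rule det_upper_triangular[of _ ?r]) (use U V in auto)
  also have "\<dots> = (\<Prod>i<?r. (?U * V) $$ (i, i))"
    unfolding diag_mat_def by (simp add: prod.distinct_set_conv_list[symmetric] atLeast0LessThan)
  also have "\<dots> \<notin> N"
  proof (rule prod_notin)
    fix i assume "i \<in> {..<?r}"
    then show "(?U * V) $$ (i, i) \<in> R \<and> (?U * V) $$ (i, i) \<notin> N"
      using UV[of i i] v(1,3) u by (auto intro!: sum_mem mult_mem)
  qed
  finally have "det ?U * det V \<notin> N" using det_mult[OF U V] by simp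
  moreover have "det V \<in> R"
    by (rule det_mem[OF V]) (use v(1) d in \<open>auto simp: V_def\<close>)
  ultimately show False using detU by auto
qed

text \<open>Cramer's rule: multiplying a relation by a column of the adjugate isolates one
  coefficient times the determinant.\<close>

lemma det_notin_imp_indep:
  assumes d: "distinct xs" "length xs = length ys" and det: "det (entry_mat u xs ys) \<notin> N"
    and u: "\<And>x j. x \<in> set xs \<Longrightarrow> j \<in> set ys \<Longrightarrow> u x j \<in> R"
  shows "indep_mod R N (set xs) u (set ys)"
  unfolding indep_mod_def
proof (intro allI impI ballI)
  let ?r = "length xs"
  let ?U = "entry_mat u xs ys"
  fix c x assume c: "(\<forall>i\<in>set xs. c i \<in> R) \<and> (\<forall>j\<in>set ys. (\<Sum>i\<in>set xs. c i * u i j) \<in> N)" and x: "x \<in> set xs"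
  obtain l where l: "l < ?r" "x = xs ! l" using x by (auto simp: in_set_conv_nth)
  have U: "?U \<in> carrier_mat ?r ?r" using d by simp
  have Ue: "?U $$ (i, j) = u (xs ! i) (ys ! j)" if "i < ?r" "j < ?r" for i j using that d by simp
  have UR: "?U $$ (i, j) \<in> R" if "i < ?r" "j < ?r" for i j using that d u by simp
  have detR: "det ?U \<in> R" by (rule det_mem[OF U UR])
  define B where "B = adj_mat ?U"
  have BR: "B $$ (j, k) \<in> R" if "j < ?r" "k < ?r" for j k
  proof -
    have "mat_delete ?U k j \<in> carrier_mat (?r - 1) (?r - 1)" using d by (intro carrier_matI) auto
    then have "det (mat_delete ?U k j) \<in> R"
      by (rule det_mem) (use that d u in \<open>auto simp: mat_delete_def\<close>)
    then show ?thesis using that d by (auto simp: B_def adj_mat_def cofactor_def)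
  qed
  have UB: "(\<Sum>j<?r. ?U $$ (i, j) * B $$ (j, k)) = (if i = k then det ?U else 0)" if "i < ?r" "k < ?r" for i k
  proof -
    have "(\<Sum>j<?r. ?U $$ (i, j) * B $$ (j, k)) = (?U * B) $$ (i, k)"
      using that adj_mat(1)[OF U] d by (simp add: B_def scalar_prod_def atLeast0LessThan)
    also have "?U * B = det ?U \<cdot>\<^sub>m 1\<^sub>m ?r" unfolding B_def by (rule adj_mat(2)[OF U])
    finally show ?thesis using that by simp
  qed
  have "(\<Sum>j<?r. (\<Sum>i<?r. c (xs ! i) * ?U $$ (i, j)) * B $$ (j, l)) \<in> N"
  proof (rule sum_in)
    fix j assume j: "j \<in> {..<?r}"
    have "(\<Sum>i<?r. c (xs ! i) * ?U $$ (i, j)) = (\<Sum>i\<in>set xs. c i * u i (ys ! j))"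
      unfolding sum_set_nth[OF d(1)] using j Ue by simp
    then show "(\<Sum>i<?r. c (xs ! i) * ?U $$ (i, j)) * B $$ (j, l) \<in> N"
      using c j d BR[of j l] l by (intro mult_in_left) auto
  qed
  also have "(\<Sum>j<?r. (\<Sum>i<?r. c (xs ! i) * ?U $$ (i, j)) * B $$ (j, l)) =
      (\<Sum>i<?r. c (xs ! i) * (\<Sum>j<?r. ?U $$ (i, j) * B $$ (j, l)))"
    by (simp only: sum_distrib_left sum_distrib_right mult.assoc) (rule sum.swap)
  also have "\<dots> = (\<Sum>i<?r. if i = l then c (xs ! i) * det ?U else 0)"
    by (rule sum.cong) (use UB l in auto)
  also have "\<dots> = c x * det ?U" using l by simp
  finally show "c x \<in> N" using prime_in[OF _ detR] c x det by blast
qed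

lemma indep_mod_card_le_coords:
  assumes "finite X" "finite C" "indep_mod R N X u C" "\<And>x j. x \<in> X \<Longrightarrow> j \<in> C \<Longrightarrow> u x j \<in> R"
  shows "card X \<le> card C"
proof (rule ccontr)
  assume "\<not> card X \<le> card C"
  then obtain c where c: "\<forall>y\<in>X. c y \<in> R" "\<exists>y\<in>X. c y \<notin> N" "\<forall>x\<in>C. (\<Sum>y\<in>X. u y x * c y) \<in> N"
    using underdetermined_system[OF assms(2,1), of "\<lambda>j x. u x j"] assms(4) by auto
  then show False using indep_modD[OF assms(3), of c] by (auto simp: mult.commute)
qed

text \<open>\<open>Y\<close> is a maximal independent set of columns. A relation among the rows on
  \<open>Y\<close> extends to all columns, since these are combinations of those in
  \<open>Y\<close>. So the rows stay independent on \<open>Y\<close>, and the two dimension bounds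
  give equal cardinalities.\<close>

lemma indep_mod_columns:
  assumes X: "finite X" "finite C" "indep_mod R N X u C" and u: "\<And>x j. x \<in> X \<Longrightarrow> j \<in> C \<Longrightarrow> u x j \<in> R"
  obtains Y where "Y \<subseteq> C" "card Y = card X" "indep_mod R N X u Y"
proof -
  have "indep_mod R N {} (\<lambda>j x. u x j) X" by (simp add: indep_mod_def)
  then obtain Y where Y: "Y \<subseteq> C" "indep_mod R N Y (\<lambda>j x. u x j) X"
    "\<And>j. j \<in> C \<Longrightarrow> in_span_mod R N Y (\<lambda>j x. u x j) X (\<lambda>x. u x j)"
    using exists_maximal_indep[OF X(2), of "{}" "\<lambda>j x. u x j" X] u by (metis empty_subsetI)
  have finY: "finite Y" using Y(1) X(2) finite_subset by blast
  have uY: "u x j \<in> R" if "x \<in> X" "j \<in> Y" for x j using u that Y(1) by blast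
  have ind: "indep_mod R N X u Y"
    unfolding indep_mod_def
  proof (intro allI impI)
    fix c assume c: "(\<forall>i\<in>X. c i \<in> R) \<and> (\<forall>j\<in>Y. (\<Sum>i\<in>X. c i * u i j) \<in> N)"
    have "(\<Sum>i\<in>X. c i * u i j) \<in> N" if j: "j \<in> C" for j
    proof -
      obtain s a where sa: "s \<in> R - N" "\<forall>y\<in>Y. a y \<in> R" "\<forall>x\<in>X. s * u x j - (\<Sum>y\<in>Y. a y * u x y) \<in> N"
        using Y(3)[OF j] by (auto simp: in_span_mod_def)
      have "s * (\<Sum>i\<in>X. c i * u i j) =
          (\<Sum>i\<in>X. c i * (s * u i j - (\<Sum>y\<in>Y. a y * u i y))) + (\<Sum>i\<in>X. \<Sum>y\<in>Y. c i * (a y * u i y))"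
        by (simp add: sum_distrib_left algebra_simps sum_subtractf)
      also have "(\<Sum>i\<in>X. \<Sum>y\<in>Y. c i * (a y * u i y)) = (\<Sum>y\<in>Y. a y * (\<Sum>i\<in>X. c i * u i y))"
        by (subst sum.swap) (simp add: sum_distrib_left algebra_simps)
      also have "(\<Sum>i\<in>X. c i * (s * u i j - (\<Sum>y\<in>Y. a y * u i y))) + (\<Sum>y\<in>Y. a y * (\<Sum>i\<in>X. c i * u i y)) \<in> N"
        proof (rule add_in)
          show "(\<Sum>i\<in>X. c i * (s * u i j - (\<Sum>y\<in>Y. a y * u i y))) \<in> N"
            by (rule sum_in, rule mult_in_right) (use c sa(3) in auto)
          show "(\<Sum>y\<in>Y. a y * (\<Sum>i\<in>X. c i * u i y)) \<in> N"
            by (rule sum_in, rule mult_in_right) (use c sa(2) in blast)+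
        qed
      finally show ?thesis
        using prime_in[of s "\<Sum>i\<in>X. c i * u i j"] sa(1) c u[OF _ j] by (auto intro!: sum_mem mult_mem)
    qed
    then show "\<forall>i\<in>X. c i \<in> N" using c X(3) unfolding indep_mod_def by blast
  qed
  have "card X \<le> card Y" using indep_mod_card_le_coords[OF X(1) finY ind] uY by blast
  moreover have "card Y \<le> card X" using indep_mod_card_le_coords[OF finY X(1) Y(2)] uY by blast
  ultimately show ?thesis using that[OF Y(1) _ ind] by simp
qed

lemma indep_mod_transpose:
  assumes X: "finite X" "finite Y" "card X = card Y" "indep_mod R N X u Y"
    and u: "\<And>x j. x \<in> X \<Longrightarrow> j \<in> Y \<Longrightarrow> u x j \<in> R"
  shows "indep_mod R N Y (\<lambda>j x. u x j) X"
proof -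
  obtain xs ys where l: "set xs = X" "distinct xs" "set ys = Y" "distinct ys"
    using finite_distinct_list[OF X(1)] finite_distinct_list[OF X(2)] by blast
  then have len: "length xs = length ys" using X(3) distinct_card by metis
  have "det (entry_mat u xs ys) \<notin> N" using det_notin[OF l(2,4) len] l X(4) u by simp
  moreover have "entry_mat (\<lambda>j x. u x j) ys xs = transpose_mat (entry_mat u xs ys)"
    by (rule eq_matI) auto
  moreover have "det (transpose_mat (entry_mat u xs ys)) = det (entry_mat u xs ys)"
    by (rule det_transpose[of _ "length xs"]) (simp add: len)
  ultimately have "det (entry_mat (\<lambda>j x. u x j) ys xs) \<notin> N" by simp
  then show ?thesis using det_notin_imp_indep[OF l(4) len[symmetric], of "\<lambda>j x. u x j"] l u by simp
qed

end

section \<open>The rank of a matrix over a field as a number of independent rows\<close>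

lemma prime_set_zero: "prime_set UNIV {0 :: 'q::field}"
  by unfold_locales auto

lemma (in vec_space) lin_indpt_iff_indep_mod:
  assumes "finite S" "S \<subseteq> carrier_vec n"
  shows "lin_indpt S \<longleftrightarrow> indep_mod UNIV {0} S (\<lambda>x i. x $ i) {..<n}"
proof
  assume li: "lin_indpt S"
  show "indep_mod UNIV {0} S (\<lambda>x i. x $ i) {..<n}"
    unfolding indep_mod_def
  proof (intro allI impI ballI, rule ccontr)
    fix c x assume c: "(\<forall>i\<in>S. c i \<in> UNIV) \<and> (\<forall>j\<in>{..<n}. (\<Sum>i\<in>S. c i * i $ j) \<in> {0})" "x \<in> S" "c x \<notin> {0}"
    have "lincomb c S = 0\<^sub>v n"
      by (rule eq_vecI) (use c lincomb_index[OF _ assms(2)] lincomb_dim[OF assms] in auto)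
    then have "lin_dep S" using lin_dep_crit[OF assms(1) subset_refl _ c(2), of c] c by simp
    then show False using li by simp
  qed
next
  assume ind: "indep_mod UNIV {0} S (\<lambda>x i. x $ i) {..<n}"
  show "lin_indpt S"
  proof
    assume "lin_dep S"
    then obtain a v where av: "lincomb a S = 0\<^sub>v n" "v \<in> S" "a v \<noteq> 0"
      using finite_lin_dep[OF assms(1)] assms(2) by auto
    have "(\<Sum>i\<in>S. a i * i $ j) \<in> {0}" if "j \<in> {..<n}" for j
      using lincomb_index[of j S a] assms(2) that av(1) by simp
    then have "a v \<in> {0}" using indep_modD[OF ind, of a v] av(2) by simp
    then show False using av(3) by simp
  qed
qed

text \<open>\<open>mat_rank\<close> counts independent columns as vectors. They are replaced by
  indices, \<open>y\<close> choosing one index for each vector, and columns are exchanged for rows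
  by \<open>indep_mod_columns\<close> and \<open>indep_mod_transpose\<close>.\<close>

lemma mat_rank_eq:
  fixes J :: "'q::field mat"
  assumes J: "J \<in> carrier_mat m n"
  shows "\<exists>X\<subseteq>{..<m}. card X = mat_rank J \<and> indep_mod UNIV {0} X (\<lambda>i j. J $$ (i, j)) {..<n}"
    and "X \<subseteq> {..<m} \<Longrightarrow> indep_mod UNIV {0} X (\<lambda>i j. J $$ (i, j)) {..<n} \<Longrightarrow> card X \<le> mat_rank J"
proof -
  interpret V: vec_space "TYPE('q)" m .
  interpret Z: prime_set UNIV "{0 :: 'q}" by (rule prime_set_zero)
  let ?u = "\<lambda>(x :: 'q vec) i. x $ i"
  let ?C = "set (cols J)"
  have C: "finite ?C" "?C \<subseteq> carrier_vec m" using cols_dim[of J] J by auto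
  have "indep_mod UNIV {0} {} ?u {..<m}" by (simp add: indep_mod_def)
  from Z.exists_maximal_indep[OF C(1) empty_subsetI this]
  obtain S where S: "S \<subseteq> ?C" "indep_mod UNIV {0} S ?u {..<m}"
    "\<And>y. y \<in> ?C \<Longrightarrow> in_span_mod UNIV {0} S ?u {..<m} (?u y)" by auto
  have finS: "finite S" using S(1) C(1) finite_subset by blast
  have le: "card T \<le> card S" if "finite T" "\<And>y. y \<in> T \<Longrightarrow> w y \<in> ?C" "indep_mod UNIV {0} T (\<lambda>y i. w y $ i) {..<m}"
    for T and w :: "'t \<Rightarrow> 'q vec"
    by (rule Z.indep_mod_card_le[OF that(1) finS that(3)]) (use S(3) that(2) in auto)
  have "maximal S (\<lambda>T. T \<subseteq> ?C \<and> V.lin_indpt T)"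
    unfolding maximal_def
  proof (intro conjI allI impI)
    show "V.lin_indpt S" using V.lin_indpt_iff_indep_mod[OF finS] S C by blast
    fix T assume T: "S \<subseteq> T \<and> T \<subseteq> ?C \<and> V.lin_indpt T"
    then have "finite T" using C finite_subset by blast
    then have "indep_mod UNIV {0} T ?u {..<m}" using V.lin_indpt_iff_indep_mod[of T] T C by blast
    then have "card T \<le> card S" using le[of T "\<lambda>x. x"] T \<open>finite T\<close> by blast
    then show "T = S" using T \<open>finite T\<close> card_seteq by blast
  qed (use S in auto)
  then have rank: "mat_rank J = card S"
    unfolding mat_rank_def using V.rank_card_indpt[OF J] J by simp
  have "\<forall>x\<in>S. \<exists>y. y < n \<and> col J y = x" using S(1) J by (fastforce simp: cols_def)
  from bchoice[OF this] obtain y where y: "\<And>x. x \<in> S \<Longrightarrow> y x < n" "\<And>x. x \<in> S \<Longrightarrow> col J (y x) = x" by blast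
  have inj: "inj_on y S" by (rule inj_on_inverseI[of _ "col J"]) (use y in auto)
  have "indep_mod UNIV {0} (y ` S) (\<lambda>j i. J $$ (i, j)) {..<m}"
    unfolding indep_mod_def
  proof (intro allI impI ballI)
    fix c k assume c: "(\<forall>i\<in>y ` S. c i \<in> UNIV) \<and> (\<forall>j\<in>{..<m}. (\<Sum>i\<in>y ` S. c i * J $$ (j, i)) \<in> {0})" "k \<in> y ` S"
    have "J $$ (j, y x) = x $ j" if "x \<in> S" "j < m" for x j
      using y(2)[OF that(1)] y(1)[OF that(1)] that(2) J by (metis carrier_matD index_col)
    then have "(\<Sum>x\<in>S. c (y x) * x $ j) = (\<Sum>i\<in>y ` S. c i * J $$ (j, i))" if "j < m" for j
      unfolding sum.reindex[OF inj] using that by (intro sum.cong) auto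
    then have "c (y x) \<in> {0}" if "x \<in> S" for x
      using indep_modD[OF S(2), of "\<lambda>x. c (y x)" x] that c by auto
    then show "c k \<in> {0}" using c(2) by auto
  qed
  from Z.indep_mod_columns[OF finite_imageI[OF finS] finite_lessThan this]
  obtain X where X: "X \<subseteq> {..<m}" "card X = card (y ` S)" "indep_mod UNIV {0} (y ` S) (\<lambda>j i. J $$ (i, j)) X"
    by auto
  have finX: "finite X" using X(1) finite_subset by blast
  have "indep_mod UNIV {0} X (\<lambda>i j. J $$ (i, j)) (y ` S)"
    using Z.indep_mod_transpose[OF finite_imageI[OF finS] finX X(2)[symmetric] X(3)] by auto
  then have "indep_mod UNIV {0} X (\<lambda>i j. J $$ (i, j)) {..<n}"
    unfolding indep_mod_def using y(1) by blast
  then show "\<exists>X\<subseteq>{..<m}. card X = mat_rank J \<and> indep_mod UNIV {0} X (\<lambda>i j. J $$ (i, j)) {..<n}"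
    using X(1,2) card_image[OF inj] rank by auto
  show "card X \<le> mat_rank J"
    if X: "X \<subseteq> {..<m}" "indep_mod UNIV {0} X (\<lambda>i j. J $$ (i, j)) {..<n}" for X
  proof -
    have finX: "finite X" using X(1) finite_subset by blast
    from Z.indep_mod_columns[OF finX finite_lessThan X(2)]
    obtain Y where Y: "Y \<subseteq> {..<n}" "card Y = card X" "indep_mod UNIV {0} X (\<lambda>i j. J $$ (i, j)) Y" by auto
    have finY: "finite Y" using Y(1) finite_subset by blast
    have t: "indep_mod UNIV {0} Y (\<lambda>j i. J $$ (i, j)) X"
      using Z.indep_mod_transpose[OF finX finY Y(2)[symmetric] Y(3)] by auto
    have "indep_mod UNIV {0} Y (\<lambda>j i. col J j $ i) {..<m}"
      unfolding indep_mod_def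
    proof (intro allI impI)
      fix c assume c: "(\<forall>i\<in>Y. c i \<in> UNIV) \<and> (\<forall>j\<in>{..<m}. (\<Sum>i\<in>Y. c i * col J i $ j) \<in> {0})"
      have "(\<Sum>i\<in>Y. c i * J $$ (j, i)) = (\<Sum>i\<in>Y. c i * col J i $ j)" if "j \<in> X" for j
        using that X(1) Y(1) J by (intro sum.cong) (auto simp: subset_iff)
      moreover have "(\<Sum>i\<in>Y. c i * col J i $ j) \<in> {0}" if "j \<in> X" for j using c that X(1) by blast
      ultimately have "(\<Sum>i\<in>Y. c i * J $$ (j, i)) \<in> {0}" if "j \<in> X" for j using that by simp
      then show "\<forall>i\<in>Y. c i \<in> {0}" using indep_modD[OF t, of c] by blast
    qed
    moreover have "col J y \<in> ?C" if "y \<in> Y" for y using that Y(1) J by (auto simp: cols_def)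
    ultimately have "card Y \<le> card S" using le[OF finY, of "col J"] by blast
    then show ?thesis using Y(2) rank by simp
  qed
qed

lemma minor_eq: "minor J iv jv = det (entry_mat (\<lambda>i j. J $$ (i, j)) iv jv)"
  by (simp add: minor_def)

text \<open>Laplace expansion along the appended last row \<open>i\<close>; the signs are those of
  row \<open>r\<close> counted from zero. For the Jacobi matrix the left side is the value of the
  natural derivation of \<open>iv\<close> and \<open>jv\<close> on \<open>f i\<close>.\<close>

lemma minor_expansion:
  assumes l: "length iv = r" "length jv = Suc r"
  shows "(\<Sum>k\<le>r. J $$ (i, jv ! k) * ((-1) ^ (r + k) * minor J iv (delete_nth k jv))) = minor J (iv @ [i]) jv"
proof -
  let ?M = "entry_mat (\<lambda>i j. J $$ (i, j)) (iv @ [i]) jv"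
  have M: "?M \<in> carrier_mat (Suc r) (Suc r)" using l by simp
  have "det ?M = (\<Sum>k<Suc r. ?M $$ (r, k) * cofactor ?M r k)"
    by (rule laplace_expansion_row[OF M]) simp
  also have "\<dots> = (\<Sum>k\<le>r. J $$ (i, jv ! k) * ((-1) ^ (r + k) * minor J iv (delete_nth k jv)))"
  proof (rule sum.cong)
    fix k assume k: "k \<in> {..r}"
    have "mat_delete ?M r k = entry_mat (\<lambda>i j. J $$ (i, j)) iv (delete_nth k jv)"
      by (rule eq_matI) (use l k in \<open>auto simp: mat_delete_def delete_nth_def nth_append min_def\<close>)
    then show "?M $$ (r, k) * cofactor ?M r k = J $$ (i, jv ! k) * ((-1) ^ (r + k) * minor J iv (delete_nth k jv))"
      using l k by (simp add: cofactor_def minor_eq nth_append)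
  qed (simp add: lessThan_Suc_atMost)
  finally show ?thesis by (simp add: minor_eq)
qed

section \<open>Localizations of affine domains inside the fraction field\<close>

text \<open>\<open>bar\<close> is the composite of reduction modulo \<open>I\<close> with the
  embedding into the fraction field, so \<open>A\<close> becomes the image of the polynomial ring
  under \<open>bar\<close> and cosets no longer occur.\<close>

locale affine_domain =
  fixes n m :: nat and f :: "nat \<Rightarrow> 'k::field_char_0 mpoly" and I :: "'k mpoly set"
    and bar :: "'k mpoly \<Rightarrow> 'q::field"
  assumes prime_I: "prime_set (polys_in {..<n}) I"
    and f_in: "i < m \<Longrightarrow> f i \<in> I"
    and I_generated: "p \<in> I \<Longrightarrow> \<exists>a. (\<forall>i<m. a i \<in> polys_in {..<n}) \<and> p = (\<Sum>i<m. a i * f i)"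
    and bar_add: "p \<in> polys_in {..<n} \<Longrightarrow> q \<in> polys_in {..<n} \<Longrightarrow> bar (p + q) = bar p + bar q"
    and bar_mult: "p \<in> polys_in {..<n} \<Longrightarrow> q \<in> polys_in {..<n} \<Longrightarrow> bar (p * q) = bar p * bar q"
    and bar_one: "bar 1 = 1"
    and bar_eq_0_iff: "p \<in> polys_in {..<n} \<Longrightarrow> bar p = 0 \<longleftrightarrow> p \<in> I"
    and bar_fraction: "\<exists>p\<in>polys_in {..<n}. \<exists>s\<in>polys_in {..<n}. bar s \<noteq> 0 \<and> x = bar p / bar s"
begin

abbreviation "B \<equiv> polys_in {..<n} :: 'k mpoly set"

sublocale I: prime_set B I by (rule prime_I)

lemma bar_zero [simp]: "bar 0 = 0"
  using bar_eq_0_iff[of 0] by simp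

lemma bar_uminus: "p \<in> B \<Longrightarrow> bar (- p) = - bar p"
  using bar_add[of p "- p"] by (simp add: eq_neg_iff_add_eq_0 add.commute)

lemma bar_diff: "p \<in> B \<Longrightarrow> q \<in> B \<Longrightarrow> bar (p - q) = bar p - bar q"
  using bar_add[of p "- q"] bar_uminus[of q] by simp

lemma bar_sum: "(\<And>i. i \<in> X \<Longrightarrow> g i \<in> B) \<Longrightarrow> bar (sum g X) = (\<Sum>i\<in>X. bar (g i))"
proof (induction X rule: infinite_finite_induct)
  case (insert x X)
  then have "sum g X \<in> B" by (intro polys.sum_mem) auto
  then show ?case using insert by (simp add: bar_add)
qed auto

lemma bar_eq_iff: "p \<in> B \<Longrightarrow> q \<in> B \<Longrightarrow> bar p = bar q \<longleftrightarrow> p - q \<in> I"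
  using bar_eq_0_iff[of "p - q"] bar_diff[of p q] by simp

text \<open>Denominators are polynomials and not elements of \<open>A\<close>; every ring of
  fractions that occurs is then \<open>Loc T\<close> for such a \<open>T\<close>, and fractions are
  handled through polynomial representatives.\<close>

definition mult_set :: "'k mpoly set \<Rightarrow> bool" where
  "mult_set T \<longleftrightarrow> T \<subseteq> B \<and> 1 \<in> T \<and> (\<forall>s\<in>T. \<forall>t\<in>T. s * t \<in> T) \<and> T \<inter> I = {}"

definition Loc :: "'k mpoly set \<Rightarrow> 'q set" where
  "Loc T = {bar p / bar s | p s. p \<in> B \<and> s \<in> T}"

definition contract :: "'q set \<Rightarrow> 'k mpoly set" where
  "contract P = {p \<in> B. bar p \<in> P}"

definition extend :: "'k mpoly set \<Rightarrow> 'k mpoly set \<Rightarrow> 'q set" where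
  "extend T N = {bar p / bar s | p s. p \<in> N \<and> s \<in> T}"

lemma mult_setD:
  assumes "mult_set T"
  shows "1 \<in> T" "s \<in> T \<Longrightarrow> s \<in> B" "s \<in> T \<Longrightarrow> t \<in> T \<Longrightarrow> s * t \<in> T" "s \<in> T \<Longrightarrow> bar s \<noteq> 0"
proof -
  show "bar s \<noteq> 0" if "s \<in> T" using that assms bar_eq_0_iff[of s] unfolding mult_set_def by blast
qed (use assms in \<open>auto simp: mult_set_def\<close>)

lemma mult_set_complement:
  assumes "prime_set B N" "I \<subseteq> N"
  shows "mult_set (B - N)"
proof -
  interpret N: prime_set B N by fact
  show ?thesis using assms(2) N.mult_notin by (auto simp: mult_set_def)
qed

context
  fixes T assumes T: "mult_set T"
begin

lemmas Tsimps = mult_setD[OF T]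

lemma LocI: "p \<in> B \<Longrightarrow> s \<in> T \<Longrightarrow> bar p / bar s \<in> Loc T"
  by (auto simp: Loc_def)

lemma LocE:
  assumes "x \<in> Loc T"
  obtains p s where "x = bar p / bar s" "p \<in> B" "s \<in> T" "s \<in> B" "bar s \<noteq> 0"
  using assms Tsimps by (auto simp: Loc_def)

lemma bar_in_Loc: "p \<in> B \<Longrightarrow> bar p \<in> Loc T"
  using LocI[of p 1] Tsimps(1) bar_one by simp

lemma inverse_in_Loc: "s \<in> T \<Longrightarrow> 1 / bar s \<in> Loc T"
  using LocI[of 1 s] bar_one by simp

lemma inverse_of_nat_in_Loc:
  assumes "k > 0"
  shows "\<exists>c\<in>Loc T. c * of_nat k = 1"
proof -
  have "bar (Const (inverse (of_nat k))) * bar (of_nat k) = 1"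
    using Const_inverse[of "of_nat k :: 'k"] assms bar_one by (simp flip: bar_mult add: Const_of_nat)
  moreover have "bar (of_nat k) = of_nat k"
    by (induction k) (auto simp: bar_add bar_one)
  ultimately show ?thesis using bar_in_Loc[of "Const (inverse (of_nat k))"] by auto
qed

lemma subring_Loc: "subring_set (Loc T)"
proof
  show "0 \<in> Loc T" "1 \<in> Loc T" using bar_in_Loc[of 0] bar_in_Loc[of 1] bar_one by auto
next
  fix x y assume "x \<in> Loc T" "y \<in> Loc T"
  then obtain p s q t where *: "x = bar p / bar s" "p \<in> B" "s \<in> T" "s \<in> B" "bar s \<noteq> 0"
    "y = bar q / bar t" "q \<in> B" "t \<in> T" "t \<in> B" "bar t \<noteq> 0" by (metis LocE)
  have "x + y = bar (p * t + q * s) / bar (s * t)"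
    using * by (simp add: bar_add bar_mult field_simps)
  then show "x + y \<in> Loc T" using * Tsimps(3) by (auto intro!: LocI)
  have "x * y = bar (p * q) / bar (s * t)" using * by (simp add: bar_mult)
  then show "x * y \<in> Loc T" using * Tsimps(3) by (auto intro!: LocI)
next
  fix x assume "x \<in> Loc T"
  then obtain p s where *: "x = bar p / bar s" "p \<in> B" "s \<in> T" by (metis LocE)
  then have "- x = bar (- p) / bar s" by (simp add: bar_uminus)
  then show "- x \<in> Loc T" using * by (auto intro!: LocI)
qed

lemma frac_in_iff:
  assumes "ideal_set (Loc T) P" "p \<in> B" "s \<in> T"
  shows "bar p / bar s \<in> P \<longleftrightarrow> bar p \<in> P"
proof -
  interpret P: ideal_set "Loc T" P by fact
  show ?thesis
  proof
    assume "bar p / bar s \<in> P"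
    then have "bar s * (bar p / bar s) \<in> P" using bar_in_Loc[OF Tsimps(2)[OF assms(3)]] by (intro P.mult_in_right)
    moreover have "bar s * (bar p / bar s) = bar p" using Tsimps(4)[OF assms(3)] by simp
    ultimately show "bar p \<in> P" by simp
  next
    assume "bar p \<in> P"
    then have "(1 / bar s) * bar p \<in> P" using inverse_in_Loc[OF assms(3)] by blast
    then show "bar p / bar s \<in> P" by simp
  qed
qed

lemma ideal_contract:
  assumes "ideal_set (Loc T) P"
  shows "ideal_set B (contract P)" "I \<subseteq> contract P"
proof -
  interpret P: ideal_set "Loc T" P by fact
  show "ideal_set B (contract P)"
    by unfold_locales (auto simp: contract_def bar_add bar_mult bar_in_Loc)
  show "I \<subseteq> contract P"
  proof
    fix p assume "p \<in> I"
    then have "p \<in> B" "bar p = 0" using I.in_ring bar_eq_0_iff by auto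
    then show "p \<in> contract P" by (simp add: contract_def)
  qed
qed

lemma prime_contract:
  assumes "prime_set (Loc T) P"
  shows "prime_set B (contract P)" "contract P \<inter> T = {}"
proof -
  interpret P: prime_set "Loc T" P by fact
  interpret C: ideal_set B "contract P" by (rule ideal_contract[OF P.ideal_set_axioms])
  show "prime_set B (contract P)"
  proof
    fix x y assume "x \<in> B" "y \<in> B" "x * y \<in> contract P"
    then show "x \<in> contract P \<or> y \<in> contract P"
      using P.prime_in[of "bar x" "bar y"] bar_in_Loc by (auto simp: contract_def bar_mult)
  qed (simp add: contract_def bar_one)
  have "bar s \<notin> P" if "s \<in> T" for s
  proof
    assume "bar s \<in> P"
    then have "(1 / bar s) * bar s \<in> P" using inverse_in_Loc[OF that] by blast
    then show False using Tsimps(4)[OF that] by simp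
  qed
  then show "contract P \<inter> T = {}" by (auto simp: contract_def)
qed

lemma contract_strict_mono:
  assumes "ideal_set (Loc T) P" "ideal_set (Loc T) P'" "P \<subset> P'"
  shows "contract P \<subset> contract P'"
proof -
  obtain x where x: "x \<in> P'" "x \<notin> P" using assms(3) by auto
  then have "x \<in> Loc T" using assms(2) unfolding ideal_set_def ideal_set_axioms_def by blast
  then obtain p s where "x = bar p / bar s" "p \<in> B" "s \<in> T" by (metis LocE)
  then have "p \<in> contract P'" "p \<notin> contract P"
    using x frac_in_iff[OF assms(1)] frac_in_iff[OF assms(2)] by (auto simp: contract_def)
  then show ?thesis using assms(3) by (auto simp: contract_def)
qed

lemma ideal_extend:
  assumes M: "ideal_set B M"
  shows "ideal_set (Loc T) (extend T M)"
proof -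
  interpret M: ideal_set B M by fact
  interpret R: subring_set "Loc T" by (rule subring_Loc)
  show ?thesis
  proof
    show "extend T M \<subseteq> Loc T" using M.in_ring by (auto simp: extend_def Loc_def)
    show "0 \<in> extend T M" unfolding extend_def using Tsimps(1) by (intro CollectI exI[of _ 0] exI[of _ 1]) auto
  next
    fix x y assume "x \<in> extend T M" "y \<in> extend T M"
    then obtain p s q t where *: "x = bar p / bar s" "p \<in> M" "s \<in> T" "y = bar q / bar t" "q \<in> M" "t \<in> T"
      by (auto simp: extend_def)
    then have **: "p \<in> B" "q \<in> B" "s \<in> B" "t \<in> B" "bar s \<noteq> 0" "bar t \<noteq> 0" using M.in_ring Tsimps by auto
    have "x + y = bar (p * t + q * s) / bar (s * t)"
      using * ** by (simp add: bar_add bar_mult field_simps)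
    moreover have "p * t + q * s \<in> M" "s * t \<in> T" using * ** Tsimps(3) by auto
    ultimately show "x + y \<in> extend T M" unfolding extend_def by blast
  next
    fix x y assume "x \<in> Loc T" "y \<in> extend T M"
    then obtain p s q t where *: "x = bar p / bar s" "p \<in> B" "s \<in> T" "y = bar q / bar t" "q \<in> M" "t \<in> T"
      by (auto simp: extend_def Loc_def)
    then have **: "q \<in> B" "s \<in> B" "t \<in> B" using M.in_ring Tsimps by auto
    then have "x * y = bar (p * q) / bar (s * t)" using * by (simp add: bar_mult)
    moreover have "p * q \<in> M" "s * t \<in> T" using * Tsimps(3) by auto
    ultimately show "x * y \<in> extend T M" unfolding extend_def by blast
  qed
qed

lemma frac_in_extend_iff:
  assumes "prime_set B N" "I \<subseteq> N" "N \<inter> T = {}" "p \<in> B" "s \<in> T"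
  shows "bar p / bar s \<in> extend T N \<longleftrightarrow> p \<in> N"
proof
  interpret N: prime_set B N by fact
  assume "bar p / bar s \<in> extend T N"
  then obtain q t where qt: "bar p / bar s = bar q / bar t" "q \<in> N" "t \<in> T" by (auto simp: extend_def)
  have B: "s \<in> B" "t \<in> B" "q \<in> B" using qt assms Tsimps N.in_ring by auto
  have "bar p * bar t = bar q * bar s" using qt Tsimps(4) assms(5) by (simp add: field_simps)
  then have "p * t - q * s \<in> I" using B assms(4) by (simp flip: bar_mult bar_eq_iff)
  then have "p * t \<in> N" using N.diff_in_imp[of "p * t" "q * s"] assms(2) qt(2) B by auto
  then show "p \<in> N" using N.prime_in[of p t] assms(3,4) qt(3) B by auto
qed (use assms in \<open>auto simp: extend_def\<close>)

lemma prime_extend: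
  assumes N: "prime_set B N" "I \<subseteq> N" "N \<inter> T = {}"
  shows "prime_set (Loc T) (extend T N)" "contract (extend T N) = N"
proof -
  interpret N: prime_set B N by fact
  interpret E: ideal_set "Loc T" "extend T N" by (rule ideal_extend[OF N.ideal_set_axioms])
  show "prime_set (Loc T) (extend T N)"
  proof
    show "1 \<notin> extend T N" using frac_in_extend_iff[OF N, of 1 1] Tsimps(1) bar_one by simp
  next
    fix x y assume "x \<in> Loc T" "y \<in> Loc T" "x * y \<in> extend T N"
    then obtain p s q t where *: "x = bar p / bar s" "p \<in> B" "s \<in> T" "y = bar q / bar t" "q \<in> B" "t \<in> T"
      by (auto simp: extend_def Loc_def)
    then have **: "s \<in> B" "t \<in> B" using Tsimps by auto
    then have "x * y = bar (p * q) / bar (s * t)" using * by (simp add: bar_mult)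
    then have "p * q \<in> N" using \<open>x * y \<in> extend T N\<close> * Tsimps(3) by (simp add: frac_in_extend_iff[OF N])
    then show "x \<in> extend T N \<or> y \<in> extend T N"
      using N.prime_in * by (auto simp: frac_in_extend_iff[OF N])
  qed
  have "bar p \<in> extend T N \<longleftrightarrow> p \<in> N" if "p \<in> B" for p
    using frac_in_extend_iff[OF N that Tsimps(1)] bar_one by simp
  then show "contract (extend T N) = N" using N.in_ring by (auto simp: contract_def)
qed

text \<open>An ideal is generated by the images of generators of its contraction, which is an ideal
  of the polynomial ring.\<close>

lemma noetherian_Loc: "noetherian_ring (subring_of (Loc T))"
proof -
  interpret R: subring_set "Loc T" by (rule subring_Loc)
  show ?thesis
  proof (rule R.noetherian_subring_ofI)
    fix P assume P: "ideal_set (Loc T) P"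
    then interpret P: ideal_set "Loc T" P .
    have "all_ideals_fg B" by (rule polys_in_fg) simp
    then obtain F where F: "finite F" "F \<subseteq> contract P" "contract P \<subseteq> span_of B F"
      using ideal_contract(1)[OF P] unfolding all_ideals_fg_def by blast
    have FP: "bar ` F \<subseteq> P" using F(2) by (auto simp: contract_def)
    have FB: "y \<in> B" if "y \<in> F" for y using that F(2) by (auto simp: contract_def)
    interpret S: ideal_set "Loc T" "span_of (Loc T) (bar ` F)"
      by (rule R.span_of_ideal) (use FP P.subset in blast)
    have "P \<subseteq> span_of (Loc T) (bar ` F)"
    proof
      fix x assume x: "x \<in> P"
      then obtain p s where *: "x = bar p / bar s" "p \<in> B" "s \<in> T" using P.in_ring LocE by metis
      then have "p \<in> contract P" using frac_in_iff[OF P] x by (auto simp: contract_def)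
      then obtain a where a: "p = (\<Sum>y\<in>F. a y * y)" "\<forall>y\<in>F. a y \<in> B"
        using F(3) unfolding span_of_def by auto
      have "bar p = (\<Sum>y\<in>F. bar (a y) * bar y)"
        unfolding a(1) using a(2) FB by (subst bar_sum) (auto simp: bar_mult)
      also have "\<dots> \<in> span_of (Loc T) (bar ` F)"
        using a(2) F(1) by (intro S.sum_in S.mult_in_right bar_in_Loc R.span_of_incl) auto
      finally have "(1 / bar s) * bar p \<in> span_of (Loc T) (bar ` F)"
        using inverse_in_Loc[OF *(3)] by blast
      then show "x \<in> span_of (Loc T) (bar ` F)" using * by simp
    qed
    then show "\<exists>F. finite F \<and> F \<subseteq> P \<and> (\<forall>x\<in>P. \<exists>a. (\<forall>y\<in>F. a y \<in> Loc T) \<and> x = (\<Sum>y\<in>F. a y * y))"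
      using F(1) FP unfolding span_of_def by (intro exI[of _ "bar ` F"]) blast
  qed
qed

text \<open>Localizing twice is localizing once, at the contracted prime. Hence regularity only
  concerns the rings \<open>Loc (B - N)\<close> with a prime \<open>N\<close> above
  \<open>I\<close>.\<close>

lemma fractions_Loc:
  assumes "prime_set (Loc T) P"
  shows "fractions (Loc T) (Loc T - P) = Loc (B - contract P)"
proof -
  interpret P: prime_set "Loc T" P by fact
  have nT: "s \<notin> contract P" if "s \<in> T" for s using prime_contract(2)[OF assms] that by blast
  interpret C: prime_set B "contract P" by (rule prime_contract(1)[OF assms])
  show ?thesis
  proof (intro subset_antisym subsetI)
    fix x assume "x \<in> fractions (Loc T) (Loc T - P)"
    then obtain a b where ab: "x = a / b" "a \<in> Loc T" "b \<in> Loc T" "b \<notin> P" by (auto simp: fractions_def)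
    obtain p s where ps: "a = bar p / bar s" "p \<in> B" "s \<in> T" "s \<in> B" "bar s \<noteq> 0" using ab(2) by (metis LocE)
    obtain q t where qt: "b = bar q / bar t" "q \<in> B" "t \<in> T" "t \<in> B" "bar t \<noteq> 0" using ab(3) by (metis LocE)
    have "q \<notin> contract P"
      using ab(4) qt frac_in_iff[OF P.ideal_set_axioms qt(2,3)] by (auto simp: contract_def)
    then have "s * q \<in> B - contract P" using ps qt nT C.mult_notin by auto
    moreover have "x = bar (p * t) / bar (s * q)" using ab ps qt by (simp add: bar_mult)
    ultimately show "x \<in> Loc (B - contract P)" using ps qt unfolding Loc_def by blast
  next
    fix x assume "x \<in> Loc (B - contract P)"
    then obtain p s where "x = bar p / bar s" "p \<in> B" "s \<in> B" "s \<notin> contract P" by (auto simp: Loc_def)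
    then show "x \<in> fractions (Loc T) (Loc T - P)"
      unfolding fractions_def contract_def using bar_in_Loc by blast
  qed
qed

end

section \<open>Derivations of the fraction field\<close>

definition directional :: "(nat \<Rightarrow> 'q) \<Rightarrow> 'k mpoly \<Rightarrow> 'q" where
  "directional v p = (\<Sum>j<n. v j * bar (pdiff j p))"

text \<open>The condition for \<open>directional v\<close> to descend to \<open>A\<close>. It can be
  tested on the generators \<open>f i\<close>, where it says that \<open>v\<close> is in the kernel
  of the Jacobi matrix.\<close>

definition tangent :: "(nat \<Rightarrow> 'q) \<Rightarrow> bool" where
  "tangent v \<longleftrightarrow> (\<forall>p\<in>I. directional v p = 0)"

text \<open>The quotient rule for an arbitrary representation of \<open>x\<close>; for tangent
  \<open>v\<close> the value does not depend on the representation, by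
  \<open>vec_derivation_frac\<close>.\<close>

definition vec_derivation :: "(nat \<Rightarrow> 'q) \<Rightarrow> 'q \<Rightarrow> 'q" where
  "vec_derivation v x = (SOME d. \<exists>p\<in>B. \<exists>s\<in>B. bar s \<noteq> 0 \<and> x = bar p / bar s \<and>
     d = (bar s * directional v p - bar p * directional v s) / (bar s)\<^sup>2)"

lemma directional_add: "p \<in> B \<Longrightarrow> q \<in> B \<Longrightarrow> directional v (p + q) = directional v p + directional v q"
  by (simp add: directional_def bar_add pdiff_in distrib_left sum.distrib)

lemma directional_mult:
  "p \<in> B \<Longrightarrow> q \<in> B \<Longrightarrow> directional v (p * q) = directional v p * bar q + bar p * directional v q"
  by (simp add: directional_def pdiff_mult bar_add bar_mult pdiff_in distrib_left sum.distrib
      sum_distrib_left sum_distrib_right mult_ac)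

lemma directional_Const: "directional v (Const c) = 0"
  by (simp add: directional_def)

lemma directional_one: "directional v 1 = 0"
  by (simp add: directional_def)

lemma directional_zero: "directional v 0 = 0"
  by (simp add: directional_def)

lemma directional_Var: "j < n \<Longrightarrow> directional v (Var j) = v j"
  by (simp add: directional_def pdiff_Var if_distrib[of bar] bar_one if_distrib[of "\<lambda>x. _ * x"] sum.delta cong: if_cong)

lemma directional_sum: "(\<And>i. i \<in> X \<Longrightarrow> g i \<in> B) \<Longrightarrow> directional v (sum g X) = (\<Sum>i\<in>X. directional v (g i))"
proof (induction X rule: infinite_finite_induct)
  case (insert x X)
  then have "sum g X \<in> B" by (intro polys.sum_mem) auto
  then show ?case using insert by (simp add: directional_add)
qed (auto simp: directional_zero)

lemma tangentI:
  assumes "\<And>i. i < m \<Longrightarrow> directional v (f i) = 0"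
  shows "tangent v"
  unfolding tangent_def
proof
  fix p assume "p \<in> I"
  then obtain a where a: "\<And>i. i < m \<Longrightarrow> a i \<in> B" "p = (\<Sum>i<m. a i * f i)" using I_generated by blast
  have fB: "f i \<in> B" "bar (f i) = 0" if "i < m" for i using f_in[OF that] I.in_ring bar_eq_0_iff by auto
  have "directional v p = (\<Sum>i<m. directional v (a i) * bar (f i) + bar (a i) * directional v (f i))"
    unfolding a(2) using a(1) fB by (subst directional_sum) (auto simp: directional_mult)
  also have "\<dots> = 0" using assms fB by (intro sum.neutral) auto
  finally show "directional v p = 0" .
qed

lemma directional_cong: "tangent v \<Longrightarrow> p \<in> B \<Longrightarrow> q \<in> B \<Longrightarrow> bar p = bar q \<Longrightarrow> directional v p = directional v q"
proof -
  assume *: "tangent v" "p \<in> B" "q \<in> B" "bar p = bar q"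
  have "p - q \<in> I" using * bar_eq_iff by simp
  then have "directional v (p - q) = 0" using * by (simp add: tangent_def)
  then show ?thesis using directional_add[of "p - q" q v] * by simp
qed

lemma vec_derivation_frac:
  assumes v: "tangent v" and p: "p \<in> B" "s \<in> B" "bar s \<noteq> 0"
  shows "vec_derivation v (bar p / bar s) = (bar s * directional v p - bar p * directional v s) / (bar s)\<^sup>2"
  unfolding vec_derivation_def
proof (rule some_equality)
  fix d assume "\<exists>p'\<in>B. \<exists>s'\<in>B. bar s' \<noteq> 0 \<and> bar p / bar s = bar p' / bar s' \<and>
    d = (bar s' * directional v p' - bar p' * directional v s') / (bar s')\<^sup>2"
  then obtain p' s' where *: "p' \<in> B" "s' \<in> B" "bar s' \<noteq> 0" "bar p / bar s = bar p' / bar s'"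
    and d: "d = (bar s' * directional v p' - bar p' * directional v s') / (bar s')\<^sup>2" by blast
  \<comment> \<open>With \<open>x\<close> the common value of the two fractions, both quotients take
    the form \<open>(directional v p - x * directional v s) / bar s\<close>, and these agree by the
    product rule.\<close>
  define x where "x = bar p / bar s"
  have "x = bar p' / bar s'" using *(4) by (simp add: x_def)
  then have x: "bar p = x * bar s" "bar p' = x * bar s'" using *(3) p(3) x_def by (metis nonzero_mult_div_cancel_right times_divide_eq_left)+
  have "bar (p * s') = bar (p' * s)" using * p x by (simp add: bar_mult)
  then have "directional v (p * s') = directional v (p' * s)"
    using directional_cong[OF v, of "p * s'" "p' * s"] * p by auto
  then have e: "directional v p * bar s' + x * bar s * directional v s' =
      directional v p' * bar s + x * bar s' * directional v s"
    using * p x by (simp add: directional_mult)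
  have "(directional v p - x * directional v s) * bar s' = (directional v p' - x * directional v s') * bar s"
    using e by (simp add: algebra_simps)
  then have "(directional v p - x * directional v s) / bar s = (directional v p' - x * directional v s') / bar s'"
    using * p by (simp add: frac_eq_eq)
  moreover have "d = (directional v p' - x * directional v s') / bar s'"
    unfolding d x using *(3) by (simp add: power2_eq_square field_simps)
  moreover have "(bar s * directional v p - bar p * directional v s) / (bar s)\<^sup>2 = (directional v p - x * directional v s) / bar s"
    unfolding x using p(3) by (simp add: power2_eq_square field_simps)
  ultimately show "d = (bar s * directional v p - bar p * directional v s) / (bar s)\<^sup>2" by simp
qed (use p in blast)

lemma vec_derivation_bar: "tangent v \<Longrightarrow> p \<in> B \<Longrightarrow> vec_derivation v (bar p) = directional v p"
  using vec_derivation_frac[of v p 1] by (simp add: bar_one directional_one)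

lemma vec_derivation_eq:
  assumes "tangent v" "p \<in> B" "s \<in> B" "bar s \<noteq> 0" "x = bar p / bar s"
  shows "vec_derivation v x = (directional v p - x * directional v s) / bar s"
  unfolding assms(5) vec_derivation_frac[OF assms(1-4)] using assms(4) by (simp add: power2_eq_square field_simps)

lemma vec_derivation_add_mult:
  assumes "tangent v"
  shows "vec_derivation v (x + y) = vec_derivation v x + vec_derivation v y"
    and "vec_derivation v (x * y) = vec_derivation v x * y + x * vec_derivation v y"
proof -
  obtain p s where x: "p \<in> B" "s \<in> B" "bar s \<noteq> 0" "x = bar p / bar s" using bar_fraction[of x] by blast
  obtain q t where y: "q \<in> B" "t \<in> B" "bar t \<noteq> 0" "y = bar q / bar t" using bar_fraction[of y] by blast
  have st: "s * t \<in> B" "bar (s * t) \<noteq> 0" using x y by (auto simp: bar_mult)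
  have B: "p * t + q * s \<in> B" "p * q \<in> B" using x y by auto
  have bp: "bar p = x * bar s" "bar q = y * bar t" using x y by auto
  note Dx = vec_derivation_eq[OF assms x] and Dy = vec_derivation_eq[OF assms y]
  have "x + y = bar (p * t + q * s) / bar (s * t)"
    using x y by (simp add: bar_add bar_mult field_simps)
  note Ds = vec_derivation_eq[OF assms B(1) st this]
  have "directional v (p * t + q * s) - (x + y) * directional v (s * t) =
      bar t * (directional v p - x * directional v s) + bar s * (directional v q - y * directional v t)"
    using x(1,2) y(1,2) bp by (simp add: directional_add directional_mult algebra_simps)
  then show "vec_derivation v (x + y) = vec_derivation v x + vec_derivation v y"
    unfolding Dx Dy Ds using x(2,3) y(1,3) y(2) by (simp add: bar_mult add_divide_distrib)
  have "x * y = bar (p * q) / bar (s * t)"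
    using x y by (simp add: bar_mult)
  note Dp = vec_derivation_eq[OF assms B(2) st this]
  have "directional v (p * q) - x * y * directional v (s * t) =
      (directional v p - x * directional v s) * y * bar t + x * bar s * (directional v q - y * directional v t)"
    using x(1,2) y(1,2) bp by (simp add: directional_add directional_mult algebra_simps)
  then show "vec_derivation v (x * y) = vec_derivation v x * y + x * vec_derivation v y"
    unfolding Dx Dy Dp using x(2,3) y(1,3) y(2) by (simp add: bar_mult add_divide_distrib)
qed

text \<open>By the quotient rule every value is a combination of the \<open>v j\<close> over the
  localization. With the whole ring as \<open>P\<close> this says that the derivation preserves
  \<open>Loc T\<close>; a prime that contains all coordinates becomes stable.\<close>

lemma vec_derivation_in:
  assumes T: "mult_set T" and P: "ideal_set (Loc T) P" and v: "tangent v" "\<And>j. j < n \<Longrightarrow> v j \<in> P"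
    and x: "x \<in> Loc T"
  shows "vec_derivation v x \<in> P"
proof -
  interpret P: ideal_set "Loc T" P by fact
  obtain p s where *: "x = bar p / bar s" "p \<in> B" "s \<in> T" "s \<in> B" "bar s \<noteq> 0" using LocE[OF T x] by metis
  have d: "directional v q \<in> P" if "q \<in> B" for q
    unfolding directional_def
    by (intro P.sum_in P.mult_in_left bar_in_Loc[OF T] pdiff_in that) (use v(2) in auto)
  have "1 / bar s \<in> Loc T" "bar s \<in> Loc T" "bar p \<in> Loc T"
    using * inverse_in_Loc[OF T] bar_in_Loc[OF T] by auto
  then have "(1 / bar s) * ((1 / bar s) * (bar s * directional v p - bar p * directional v s)) \<in> P"
    using d * by (intro P.mult_in_right P.diff_in) auto
  also have "(1 / bar s) * ((1 / bar s) * (bar s * directional v p - bar p * directional v s)) = vec_derivation v x"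
    unfolding *(1) vec_derivation_frac[OF v(1) *(2,4,5)] by (simp add: power2_eq_square)
  finally show ?thesis .
qed

lemma Loc_ideal: "mult_set T \<Longrightarrow> ideal_set (Loc T) (Loc T)"
proof -
  assume "mult_set T"
  then interpret R: subring_set "Loc T" by (rule subring_Loc)
  show ?thesis by unfold_locales auto
qed

lemma derivation_on_vec_derivation:
  assumes "mult_set T" "tangent v" "\<And>j. j < n \<Longrightarrow> v j \<in> Loc T"
  shows "derivation_on (Loc T) (vec_derivation v)"
  using vec_derivation_in[OF assms(1) Loc_ideal[OF assms(1)] assms(2,3)] vec_derivation_add_mult[OF assms(2)]
  by (auto simp: derivation_on_def)

lemma vec_derivation_Der:
  assumes "mult_set T" "tangent v" "\<And>j. j < n \<Longrightarrow> v j \<in> Loc T"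
  shows "restrict (vec_derivation v) (Loc T) \<in> Der (\<lambda>c. bar (Const c)) (Loc T)"
proof -
  interpret R: subring_set "Loc T" by (rule subring_Loc[OF assms(1)])
  have c: "bar (Const c) \<in> Loc T" for c using bar_in_Loc[OF assms(1)] by simp
  have "vec_derivation v (bar (Const c) * x) = bar (Const c) * vec_derivation v x" for c x
    using vec_derivation_add_mult(2)[OF assms(2)] vec_derivation_bar[OF assms(2), of "Const c"]
    by (simp add: directional_Const)
  then show ?thesis
    unfolding Der_def End_ring_def
    using vec_derivation_in[OF assms(1) Loc_ideal[OF assms(1)] assms(2,3)] vec_derivation_add_mult[OF assms(2)] c
    by auto
qed

text \<open>Linearity and the product rule determine \<open>D\<close> on polynomials from its values
  on the variables, and then on fractions. This is the uniqueness behind the definite description in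
  \<open>nat_derivation\<close>.\<close>

lemma Der_eq_vec_derivation:
  assumes T: "mult_set T" and D: "D \<in> Der (\<lambda>c. bar (Const c)) (Loc T)"
    and v: "tangent v" "\<And>j. j < n \<Longrightarrow> v j = D (bar (Var j))"
  shows "D = restrict (vec_derivation v) (Loc T)"
proof -
  interpret R: subring_set "Loc T" by (rule subring_Loc[OF T])
  have DE: "D \<in> Loc T \<rightarrow>\<^sub>E Loc T" and Dadd: "\<And>x y. x \<in> Loc T \<Longrightarrow> y \<in> Loc T \<Longrightarrow> D (x + y) = D x + D y"
    and Dmult: "\<And>x y. x \<in> Loc T \<Longrightarrow> y \<in> Loc T \<Longrightarrow> D (x * y) = D x * y + x * D y"
    and Dlin: "\<And>c x. x \<in> Loc T \<Longrightarrow> D (bar (Const c) * x) = bar (Const c) * D x"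
    using D by (auto simp: Der_def End_ring_def)
  have D1: "D 1 = 0" using Dmult[of 1 1] by (metis R.one_mem add_cancel_left_left mult_1 mult_1_right)
  have bL: "bar p \<in> Loc T" if "p \<in> B" for p using bar_in_Loc[OF T that] .
  have Db: "D (bar p) = directional v p" if "p \<in> B" for p
    using that
  proof (induction rule: polys_in_induct)
    case (Const c)
    then show ?case using Dlin[of 1 c] D1 by (simp add: directional_Const)
  next
    case (add p q)
    then show ?case by (simp add: bar_add Dadd bL directional_add)
  next
    case (mult p j)
    then show ?case by (simp add: bar_mult Dmult bL directional_mult directional_Var v(2))
  qed
  have "D x = vec_derivation v x" if x: "x \<in> Loc T" for x
  proof -
    obtain p s where *: "x = bar p / bar s" "p \<in> B" "s \<in> T" "s \<in> B" "bar s \<noteq> 0" using LocE[OF T x] by metis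
    have "D (x * bar s) = D x * bar s + x * D (bar s)" using x * bL by (intro Dmult) auto
    moreover have "x * bar s = bar p" using * by simp
    ultimately have "D x * bar s = directional v p - x * directional v s" using Db * by simp
    then have "D x = (directional v p - x * directional v s) / bar s" using *(5) by (simp add: eq_divide_eq)
    also have "\<dots> = vec_derivation v x"
      unfolding *(1) vec_derivation_frac[OF v(1) *(2,4,5)] using *(5) by (simp add: power2_eq_square field_simps)
    finally show ?thesis .
  qed
  then show ?thesis using DE by (intro ext) (auto simp: restrict_def PiE_iff extensional_def)
qed

end

section \<open>The Jacobian criterion\<close>

lemma (in prime_set) in_span_mod_trans:
  assumes "finite Y" "in_span_mod R N Y w C x" "\<And>y. y \<in> Y \<Longrightarrow> in_span_mod R N Z u C (w y)"
  shows "in_span_mod R N Z u C x"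
proof -
  obtain s a where sa: "s \<in> R - N" "\<forall>y\<in>Y. a y \<in> R" "\<forall>j\<in>C. s * x j - (\<Sum>y\<in>Y. a y * w y j) \<in> N"
    using assms(2) by (auto simp: in_span_mod_def)
  have "\<forall>y\<in>Y. \<exists>t b. t \<in> R - N \<and> (\<forall>z\<in>Z. b z \<in> R) \<and> (\<forall>j\<in>C. t * w y j - (\<Sum>z\<in>Z. b z * u z j) \<in> N)"
    using assms(3) unfolding in_span_mod_def by blast
  from bchoice[OF this] obtain t where "\<forall>y\<in>Y. \<exists>b. t y \<in> R - N \<and> (\<forall>z\<in>Z. b z \<in> R) \<and> (\<forall>j\<in>C. t y * w y j - (\<Sum>z\<in>Z. b z * u z j) \<in> N)"
    by blast
  from bchoice[OF this] obtain b where tb: "\<And>y. y \<in> Y \<Longrightarrow> t y \<in> R - N" "\<And>y z. y \<in> Y \<Longrightarrow> z \<in> Z \<Longrightarrow> b y z \<in> R"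
    "\<And>y j. y \<in> Y \<Longrightarrow> j \<in> C \<Longrightarrow> t y * w y j - (\<Sum>z\<in>Z. b y z * u z j) \<in> N" by blast
  \<comment> \<open>\<open>T\<close> is a common denominator of the inner combinations, and
    \<open>P y\<close> is the complementary product for \<open>y\<close>.\<close>
  define P where "P y = (\<Prod>y'\<in>Y - {y}. t y')" for y
  define T where "T = (\<Prod>y\<in>Y. t y)"
  have PT: "P y * t y = T" "P y \<in> R" if "y \<in> Y" for y
    using prod.remove[OF assms(1) that, of t] tb(1) by (auto simp: P_def T_def mult.commute intro!: prod_mem)
  have T: "T \<in> R" "T \<notin> N" using tb(1) by (auto simp: T_def intro!: prod_mem prod_notin)
  show ?thesis
    unfolding in_span_mod_def
  proof (intro bexI[of _ "T * s"] exI[of _ "\<lambda>z. \<Sum>y\<in>Y. a y * P y * b y z"] conjI ballI)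
    show "T * s \<in> R - N" using T sa(1) mult_notin by auto
    show "(\<Sum>y\<in>Y. a y * P y * b y z) \<in> R" if "z \<in> Z" for z
      using that sa(2) PT tb(2) by (intro sum_mem mult_mem) auto
    fix j assume j: "j \<in> C"
    have "T * s * x j - (\<Sum>z\<in>Z. (\<Sum>y\<in>Y. a y * P y * b y z) * u z j) =
        T * (s * x j - (\<Sum>y\<in>Y. a y * w y j)) + (\<Sum>y\<in>Y. (a y * T) * w y j) - (\<Sum>z\<in>Z. \<Sum>y\<in>Y. (a y * P y) * (b y z * u z j))"
      by (simp add: algebra_simps sum_distrib_left sum_distrib_right)
    also have "(\<Sum>z\<in>Z. \<Sum>y\<in>Y. (a y * P y) * (b y z * u z j)) = (\<Sum>y\<in>Y. (a y * P y) * (\<Sum>z\<in>Z. b y z * u z j))"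
      by (subst sum.swap) (simp add: sum_distrib_left)
    also have "(\<Sum>y\<in>Y. (a y * T) * w y j) = (\<Sum>y\<in>Y. (a y * P y) * (t y * w y j))"
      by (rule sum.cong) (simp_all add: PT(1)[symmetric] mult_ac)
    finally have "T * s * x j - (\<Sum>z\<in>Z. (\<Sum>y\<in>Y. a y * P y * b y z) * u z j) =
        T * (s * x j - (\<Sum>y\<in>Y. a y * w y j)) + (\<Sum>y\<in>Y. (a y * P y) * (t y * w y j - (\<Sum>z\<in>Z. b y z * u z j)))"
      by (simp add: sum_subtractf right_diff_distrib)
    moreover have "(a y * P y) * (t y * w y j - (\<Sum>z\<in>Z. b y z * u z j)) \<in> N" if "y \<in> Y" for y
      using that sa(2) PT(2) tb(3)[OF that j] by auto
    ultimately show "T * s * x j - (\<Sum>z\<in>Z. (\<Sum>y\<in>Y. a y * P y * b y z) * u z j) \<in> N"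
      using T(1) sa(3) j by (simp add: sum_in)
  qed
qed

lemma grad_rank_mono:
  assumes "prime_set (polys_in W) (N :: 'k::field_char_0 mpoly set)" "prime_set (polys_in W) N'" "finite W" "N \<subseteq> N'"
  shows "grad_rank W N \<le> grad_rank W N'"
proof (cases "N = N'")
  case False
  then have "N \<subset> N'" using assms(4) by blast
  then show ?thesis using grad_rank_strict_mono[OF assms(1-3)] by simp
qed simp

context affine_domain begin

abbreviation "W \<equiv> {..<n}"

lemma f_B: "i < m \<Longrightarrow> f i \<in> B"
  using f_in I.in_ring by blast

lemma I_subset_ideal:
  assumes "ideal_set B M" "\<And>i. i < m \<Longrightarrow> f i \<in> M"
  shows "I \<subseteq> M"
proof
  interpret M: ideal_set B M by fact
  fix p assume "p \<in> I"
  then obtain a where "\<forall>i<m. a i \<in> B" "p = (\<Sum>i<m. a i * f i)" using I_generated by blast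
  then show "p \<in> M" using assms(2) by (auto intro!: M.sum_in)
qed

section \<open>The local ring at a prime containing \<open>I\<close>\<close>

context
  fixes N assumes N: "prime_set B N" and IN: "I \<subseteq> N"
begin

abbreviation (input) "U \<equiv> B - N"

interpretation N: prime_set B N by (rule N)

lemma mult_set_U: "mult_set U"
  by (rule mult_set_complement[OF N IN])

lemma prime_extend_U: "prime_set (Loc U) (extend U N)" "contract (extend U N) = N"
  using prime_extend[OF mult_set_U N IN] by auto

lemma frac_in_extend_U: "p \<in> B \<Longrightarrow> s \<in> U \<Longrightarrow> bar p / bar s \<in> extend U N \<longleftrightarrow> p \<in> N"
  using frac_in_extend_iff[OF mult_set_U N IN] by auto

lemma bar_in_extend_U: "p \<in> B \<Longrightarrow> bar p \<in> extend U N \<longleftrightarrow> p \<in> N"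
  using frac_in_extend_U[of p 1] bar_one by simp

interpretation R: subring_set "Loc U" by (rule subring_Loc[OF mult_set_U])
interpretation M: prime_set "Loc U" "extend U N" by (rule prime_extend_U)

lemma ideal_subset_extend_U:
  assumes "ideal_set (Loc U) L" "1 \<notin> L"
  shows "L \<subseteq> extend U N"
proof
  interpret L: ideal_set "Loc U" L by fact
  fix x assume x: "x \<in> L"
  then obtain p s where *: "x = bar p / bar s" "p \<in> B" "s \<in> U" "s \<in> B" "bar s \<noteq> 0"
    using LocE[OF mult_set_U] L.in_ring by metis
  show "x \<in> extend U N"
  proof (rule ccontr)
    assume "x \<notin> extend U N"
    then have "p \<in> U" using * frac_in_extend_U by auto
    then have "bar s / bar p \<in> Loc U" "bar p \<noteq> 0" using * LocI[OF mult_set_U] mult_setD(4)[OF mult_set_U] by auto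
    then have "(bar s / bar p) * x \<in> L" using x by blast
    then show False using assms(2) * \<open>bar p \<noteq> 0\<close> by simp
  qed
qed

lemma maximalideal_Loc_U: "maximalideal P (subring_of (Loc U)) \<longleftrightarrow> P = extend U N"
proof
  assume "maximalideal P (subring_of (Loc U))"
  then interpret P: maximalideal P "subring_of (Loc U)" .
  interpret P': ideal_set "Loc U" P using R.ideal_subring_of_iff P.is_ideal by simp
  have "1 \<notin> P"
  proof
    assume "1 \<in> P"
    then have "Loc U \<subseteq> P" using P'.mult_in_right[of _ 1] by auto
    then show False using P.I_notcarr P'.subset by auto
  qed
  then have "P \<subseteq> extend U N" by (rule ideal_subset_extend_U[OF P'.ideal_set_axioms])
  then show "P = extend U N"
    using P.I_maximal[OF M.ideal_subring_of] M.subset M.one_notin R.one_mem by fastforce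
next
  assume P: "P = extend U N"
  show "maximalideal P (subring_of (Loc U))"
    unfolding P
  proof (rule maximalidealI[OF M.ideal_subring_of])
    show "carrier (subring_of (Loc U)) \<noteq> extend U N" using M.one_notin R.one_mem by (metis subring_of_simps(1))
    fix L assume L: "ideal L (subring_of (Loc U))" "extend U N \<subseteq> L" "L \<subseteq> carrier (subring_of (Loc U))"
    then interpret L: ideal_set "Loc U" L using R.ideal_subring_of_iff by simp
    show "L = extend U N \<or> L = carrier (subring_of (Loc U))"
    proof (cases "1 \<in> L")
      case True
      then have "Loc U \<subseteq> L" using L.mult_in_right[of _ 1] by auto
      then show ?thesis using L.subset by auto
    next
      case False
      then show ?thesis using ideal_subset_extend_U[OF L.ideal_set_axioms] L(2) by auto
    qed
  qed
qed

text \<open>The contractions of the chain lie between \<open>I\<close> and \<open>N\<close>, and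
  each strict inclusion raises \<open>grad_rank\<close> by at least one.\<close>

lemma chain_length_le:
  assumes "prime_chain (subring_of (Loc U)) l P"
  shows "l + grad_rank W I \<le> grad_rank W N"
proof -
  have P: "prime_set (Loc U) (P i)" if "i \<le> l" for i
    using assms that R.primeideal_subring_of_iff by (auto simp: prime_chain_def)
  have Pi: "ideal_set (Loc U) (P i)" if "i \<le> l" for i
    using P[OF that] by (simp add: prime_set_def)
  have C: "prime_set B (contract (P i))" if "i \<le> l" for i
    using prime_contract(1)[OF mult_set_U P[OF that]] .
  have "i + grad_rank W I \<le> grad_rank W (contract (P i))" if "i \<le> l" for i
    using that
  proof (induction i)
    case 0
    show ?case
      using grad_rank_mono[OF prime_I C _ ideal_contract(2)[OF mult_set_U Pi]] by simp
  next
    case (Suc i)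
    have "P i \<subset> P (Suc i)" using assms Suc.prems by (auto simp: prime_chain_def)
    then have "contract (P i) \<subset> contract (P (Suc i))"
      using contract_strict_mono[OF mult_set_U Pi Pi] Suc.prems by simp
    then have "grad_rank W (contract (P i)) < grad_rank W (contract (P (Suc i)))"
      using Suc.prems by (intro grad_rank_strict_mono C) auto
    then show ?case using Suc by simp
  qed
  moreover have "contract (P l) \<subseteq> N"
    using prime_contract(2)[OF mult_set_U P[of l]] by (auto simp: contract_def)
  then have "grad_rank W (contract (P l)) \<le> grad_rank W N"
    using C[of l] by (intro grad_rank_mono N) auto
  ultimately show ?thesis by (meson le_refl le_trans)
qed

text \<open>The \<open>f i\<close> and the \<open>q l\<close> generate \<open>N\<close> locally, so
  their gradients span those of \<open>N\<close>, and the gradients of the \<open>f i\<close> reduce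
  to those with index in \<open>X\<close>. Besides both directions of the criterion it serves, with
  \<open>N = I\<close> and \<open>L\<close> empty, to compute the rank of the Jacobi matrix.\<close>

lemma grad_rank_le_generators:
  assumes L: "finite L" "\<And>l. l \<in> L \<Longrightarrow> q l \<in> N"
    and gen: "N \<subseteq> local_span B N ({..<m} <+> L) (case_sum f q)"
    and X: "X \<subseteq> {..<m}" "\<And>i. i < m \<Longrightarrow> in_span_mod B N X (grad f) W (grad f i)"
  shows "grad_rank W N \<le> card L + card X"
proof -
  have finX: "finite X" using X(1) finite_subset by blast
  let ?w = "grad (case_sum f q)"
  have qB: "q l \<in> B" if "l \<in> L" for l using L(2)[OF that] N.in_ring by blast
  have fN: "f i \<in> N" if "i < m" for i using f_in[OF that] IN by blast
  have "grad_rank W N \<le> card (X <+> L)"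
  proof (rule grad_rank_le_card[OF N, where w = ?w])
    show "?w y j \<in> B" if "y \<in> X <+> L" for y j
      using that X(1) f_B qB by (auto intro!: pdiff_in)
    fix p assume p: "p \<in> N"
    then obtain s a where sa: "s \<in> B - N" "\<forall>z\<in>{..<m} <+> L. a z \<in> B"
      "s * p = (\<Sum>z\<in>{..<m} <+> L. a z * case_sum f q z)"
      using gen by (auto simp: local_span_def)
    have "in_span_mod B N ({..<m} <+> L) ?w W (\<lambda>j. pdiff j p)"
      by (rule grad_in_span_mod[OF N sa(1) p _ _ sa(3)]) (use sa(2) fN L(2) in auto)
    then show "in_span_mod B N (X <+> L) ?w W (\<lambda>j. pdiff j p)"
    proof (rule N.in_span_mod_trans[rotated])
      fix y assume y: "y \<in> {..<m} <+> L"
      show "in_span_mod B N (X <+> L) ?w W (?w y)"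
      proof (cases y)
        case (Inl i)
        then obtain s a where sa: "s \<in> B - N" "\<forall>x\<in>X. a x \<in> B" "\<forall>j\<in>W. s * pdiff j (f i) - (\<Sum>x\<in>X. a x * pdiff j (f x)) \<in> N"
          using X(2)[of i] y by (auto simp: in_span_mod_def)
        show ?thesis unfolding in_span_mod_def
        proof (intro bexI[of _ s] exI[of _ "case_sum a (\<lambda>_. 0)"] conjI ballI)
          fix j assume "j \<in> W"
          then show "s * ?w y j - (\<Sum>z\<in>X <+> L. case_sum a (\<lambda>_. 0) z * ?w z j) \<in> N"
            using sa(3) Inl finX L(1) by (simp add: sum.Plus)
        qed (use sa in auto)
      next
        case (Inr l)
        then have l: "l \<in> L" using y by auto
        have "(\<Sum>z\<in>L. (if z = l then 1 else 0) * pdiff j (q z)) = pdiff j (q l)" for j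
          using l L(1) by (simp add: if_distrib[of "\<lambda>x. x * _"] sum.delta cong: if_cong)
        then show ?thesis unfolding in_span_mod_def Inr
          by (intro bexI[of _ 1] exI[of _ "case_sum (\<lambda>_. 0) (\<lambda>z. if z = l then 1 else 0)"] conjI ballI)
            (use finX L(1) in \<open>auto simp: sum.Plus\<close>)
      qed
    qed (use L(1) in auto)
  qed (use finX L(1) in auto)
  then show ?thesis using finX L(1) by (simp add: card_Plus)
qed

text \<open>Generators of the maximal ideal are fractions with numerators in \<open>N\<close>. The
  \<open>f i\<close> are added so that the local span contains \<open>I\<close>; then equations
  between fractions can be read back in the polynomial ring.\<close>

lemma local_span_of_generators:
  assumes y: "finite L" "y ` L \<subseteq> Loc U" "extend U N = genideal (subring_of (Loc U)) (y ` L)"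
  shows "\<exists>q. (\<forall>l\<in>L. q l \<in> N) \<and> N \<subseteq> local_span B N ({..<m} <+> L) (case_sum f q)"
proof -
  have "y ` L \<subseteq> extend U N" using y(3) unfolding genideal_def by blast
  then have "\<forall>l\<in>L. \<exists>q t. q \<in> N \<and> t \<in> U \<and> y l = bar q / bar t"
    unfolding extend_def image_subset_iff by blast
  from bchoice[OF this] obtain q where "\<forall>l\<in>L. \<exists>t. q l \<in> N \<and> t \<in> U \<and> y l = bar (q l) / bar t" by blast
  then have q: "\<And>l. l \<in> L \<Longrightarrow> q l \<in> N" "\<And>l. l \<in> L \<Longrightarrow> \<exists>t\<in>U. y l = bar (q l) / bar t" by blast+
  let ?S = "local_span B N ({..<m} <+> L) (case_sum f q)"
  interpret S: ideal_set B ?S by (rule N.local_span_ideal)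
  have incl: "case_sum f q z \<in> ?S" if "z \<in> {..<m} <+> L" for z
    by (rule N.local_span_incl) (use that y(1) q(1) N.in_ring f_B in auto)
  have fS: "f i \<in> ?S" if "i < m" for i using incl[of "Inl i"] that by auto
  have IS: "I \<subseteq> ?S" by (rule I_subset_ideal[OF S.ideal_set_axioms fS])
  have "extend U N \<subseteq> extend U ?S"
  proof -
    have "ideal (extend U ?S) (subring_of (Loc U))"
      using ideal_extend[OF mult_set_U S.ideal_set_axioms] R.ideal_subring_of_iff by simp
    moreover have "y ` L \<subseteq> extend U ?S"
    proof
      fix z assume "z \<in> y ` L"
      then obtain l where l: "l \<in> L" "z = y l" by blast
      then show "z \<in> extend U ?S" using q(2)[OF l(1)] incl[of "Inr l"] unfolding extend_def by auto
    qed
    ultimately show ?thesis unfolding y(3) genideal_def by blast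
  qed
  moreover have "p \<in> ?S" if p: "p \<in> N" "bar p \<in> extend U ?S" for p
  proof -
    obtain p' s where ps: "bar p = bar p' / bar s" "p' \<in> ?S" "s \<in> U" using p(2) by (auto simp: extend_def)
    have B: "p \<in> B" "p' \<in> B" "s \<in> B" "bar s \<noteq> 0"
      using ps p N.in_ring S.in_ring mult_setD(4)[OF mult_set_U] by auto
    then have "bar (s * p) = bar p'" using ps by (simp add: bar_mult)
    then have "s * p - p' \<in> I" using B bar_eq_iff by auto
    then have "s * p \<in> ?S" using S.diff_in_imp ps(2) IS by blast
    then show ?thesis using N.local_span_cancel ps(3) B(1) by blast
  qed
  ultimately have "N \<subseteq> ?S" using bar_in_extend_U N.in_ring by blast
  then show ?thesis using q(1) by blast
qed

lemma regular_imp_indep_rows: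
  assumes reg: "regular_local_ring (subring_of (Loc U))"
  shows "\<exists>X\<subseteq>{..<m}. card X = grad_rank W I \<and> indep_mod B N X (grad f) W"
proof -
  obtain P d g where P: "maximalideal P (subring_of (Loc U))" and d: "krull_dim (subring_of (Loc U)) = enat d"
    and g: "g ` {..<d} \<subseteq> Loc U" "P = genideal (subring_of (Loc U)) (g ` {..<d})"
    using reg by (auto simp: regular_local_ring_def)
  have PM: "P = extend U N" using P maximalideal_Loc_U by simp
  have "d + grad_rank W I \<le> grad_rank W N"
  proof (cases "\<exists>P. prime_chain (subring_of (Loc U)) d P")
    case True
    then show ?thesis using chain_length_le by blast
  next
    case False
    \<comment> \<open>A finite supremum of a nonempty set in \<open>enat\<close> is attained, so if
      no chain has length \<open>d\<close>, the set is empty and \<open>d = 0\<close>.\<close>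
    let ?S = "{enat l | l. \<exists>P. prime_chain (subring_of (Loc U)) l P}"
    have S: "Sup ?S = enat d" using d by (simp add: krull_dim_def)
    have "enat d \<notin> ?S" using False by auto
    moreover have "Sup ?S \<in> ?S" if "?S \<noteq> {}"
    proof -
      have fin: "finite ?S" using S that by (auto simp: Sup_enat_def split: if_splits)
      moreover from this have "Sup ?S = Max ?S" using that unfolding Sup_enat_def by (simp only: if_False if_True)
      ultimately show ?thesis using Max_in[OF fin that] by argo
    qed
    ultimately have "?S = {}" using S by auto
    then have "d = 0" using S by (simp add: bot_enat_def zero_enat_def)
    then show ?thesis using grad_rank_mono[OF prime_I N _ IN] by simp
  qed
  obtain q where q: "\<forall>l\<in>{..<d}. q l \<in> N" "N \<subseteq> local_span B N ({..<m} <+> {..<d}) (case_sum f q)"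
    using local_span_of_generators[of "{..<d}" g] g PM by auto
  have e: "indep_mod B N {} (grad f) W" by (simp add: indep_mod_def)
  have gB: "grad f i j \<in> B" if "i \<in> {..<m}" for i j
    using pdiff_in[OF f_B[of i]] that by simp
  obtain X where "{} \<subseteq> X" and X: "X \<subseteq> {..<m}" "indep_mod B N X (grad f) W"
    "\<And>i. i \<in> {..<m} \<Longrightarrow> in_span_mod B N X (grad f) W (grad f i)"
    by (rule N.exists_maximal_indep[OF finite_lessThan[of m] empty_subsetI e gB]) (assumption, rule that)
  \<comment> \<open>The \<open>d\<close> generators and the Jacobi rows in \<open>X\<close> together
    account for \<open>grad_rank W N\<close>. As \<open>d\<close> is at most
    \<open>grad_rank W N - grad_rank W I\<close>, there are at least \<open>grad_rank W I\<close>
    elements in \<open>X\<close>.\<close>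
  have "grad_rank W N \<le> card {..<d} + card X"
    by (rule grad_rank_le_generators[OF _ _ q(2) X(1)]) (use q(1) X(3) in auto)
  then have "grad_rank W I \<le> card X" using \<open>d + grad_rank W I \<le> grad_rank W N\<close> by simp
  then obtain X' where X': "X' \<subseteq> X" "card X' = grad_rank W I" by (meson obtain_subset_with_card_n)
  have "indep_mod B N X' (grad f) W"
    by (rule N.indep_mod_subset[OF X(2) X'(1)]) (use X(1) finite_subset in blast)
  then show ?thesis using X' X(1) by blast
qed

section \<open>The case of enough Jacobi rows that are independent modulo \<open>N\<close>\<close>

context
  fixes X assumes X: "X \<subseteq> {..<m}" "card X = grad_rank W I" and X_indep: "indep_mod B N X (grad f) W"
begin

lemma finX: "finite X"
  using X(1) finite_subset by blast

lemma grad_f_B: "i < m \<Longrightarrow> pdiff j (f i) \<in> B"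
  using f_B pdiff_in by blast

text \<open>\<open>X\<close> is extended to a maximal set \<open>Y\<close> of rows independent
  modulo \<open>N'\<close>. Independence passes to smaller primes, so \<open>Y\<close> is
  independent modulo \<open>I\<close> and has at most \<open>grad_rank W I\<close> elements, which
  is the size of \<open>X\<close>.\<close>

lemma rows_span:
  assumes "prime_set B N'" "I \<subseteq> N'" "N' \<subseteq> N" "i < m"
  shows "in_span_mod B N' X (grad f) W (grad f i)"
proof -
  interpret N': prime_set B N' by fact
  have sm: "indep_mod B Q Y (grad f) W" if "prime_set B Q" "Q \<subseteq> P" "prime_set B P" "Y \<subseteq> {..<m}" "indep_mod B P Y (grad f) W" for P Q Y
    by (rule prime_set.indep_mod_smaller_prime[OF that(3,1,2) finite_subset[OF that(4) finite_lessThan] finite_lessThan that(5)])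
      (use that(4) grad_f_B in \<open>auto simp: subset_iff\<close>)
  have "indep_mod B N' X (grad f) W" using sm[OF assms(1,3) N X(1) X_indep] .
  then obtain Y where Y: "X \<subseteq> Y" "Y \<subseteq> {..<m}" "indep_mod B N' Y (grad f) W"
    "\<And>i. i \<in> {..<m} \<Longrightarrow> in_span_mod B N' Y (grad f) W (grad f i)"
    using N'.exists_maximal_indep[OF finite_lessThan X(1), of "grad f" W] grad_f_B by (metis lessThan_iff)
  have finY: "finite Y" using Y(2) finite_subset by blast
  have "card Y \<le> grad_rank W I"
    by (rule card_le_grad_rank[OF prime_I _ finY, of f])
      (use sm[OF prime_I assms(2,1) Y(2,3)] f_in Y(2) in auto)
  then have "Y = X" using card_seteq[OF finY Y(1)] X(2) by simp
  then show ?thesis using Y(4) assms(4) by simp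
qed

text \<open>Nakayama's lemma in elementary form. A relation among the gradients gives a combination
  \<open>h0\<close> of the generators whose partial derivatives are all in \<open>N\<close>; by the
  presentation \<open>Z\<close> it is, locally, a combination with coefficients in \<open>N\<close>.
  If the coefficient of some \<open>g z0\<close> in \<open>h0\<close> were outside \<open>N\<close>,
  this generator would be redundant, against the least cardinality of \<open>H\<close>.\<close>

lemma minimal_generators:
  obtains H :: "nat set" and g :: "nat \<Rightarrow> 'k mpoly" where "finite H" "\<And>z. z \<in> H \<Longrightarrow> g z \<in> N"
    "N \<subseteq> local_span B N ({..<m} <+> H) (case_sum f g)"
    "indep_mod B N (X <+> H) (grad (case_sum f g)) W"
proof -
  obtain Z g where Z: "presents W N W Z g" using grad_rankE[OF N finite_lessThan] by blast
  have finZ: "finite Z" using Z finite_subset by (auto simp: presents_def)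
  have gN: "g z \<in> N" if "z \<in> Z" for z using Z that by (auto simp: presents_def)
  have gB: "g z \<in> B" if "z \<in> Z" for z using gN[OF that] N.in_ring by blast
  have NZ: "N \<subseteq> local_span B N Z g" using Z N.subset by (auto simp: presents_def)
  have Zind: "indep_mod B N Z (grad g) W" using Z by (simp add: presents_def)
  let ?h = "case_sum f g"
  let ?S = "\<lambda>H. local_span B N ({..<m} <+> H) ?h"
  let ?P = "\<lambda>H. H \<subseteq> Z \<and> N \<subseteq> ?S H"
  have incl: "?h z \<in> ?S H" if "z \<in> {..<m} <+> H" "H \<subseteq> Z" for z H
    by (rule N.local_span_incl) (use that finZ finite_subset gB f_B in \<open>auto dest: finite_subset\<close>)
  have "?P Z"
  proof
    have "local_span B N Z g \<subseteq> ?S Z"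
      using incl[of "Inr z" Z for z] by (intro N.local_span_mono) fastforce
    then show "N \<subseteq> ?S Z" using NZ by blast
  qed simp
  define H where "H = arg_min card ?P"
  have PH: "?P H" and Hmin: "\<And>H'. ?P H' \<Longrightarrow> card H \<le> card H'"
    unfolding H_def using \<open>?P Z\<close> arg_min_nat_lemma[of ?P Z card] by auto
  have HZ: "H \<subseteq> Z" using PH by simp
  have finH: "finite H" using HZ finZ finite_subset by blast
  have fN: "f i \<in> N" if "i < m" for i using f_in[OF that] IN by blast
  have "indep_mod B N (X <+> H) (grad ?h) W"
    unfolding indep_mod_def
  proof (intro allI impI)
    fix c assume c: "(\<forall>i\<in>X <+> H. c i \<in> B) \<and> (\<forall>j\<in>W. (\<Sum>i\<in>X <+> H. c i * grad ?h i j) \<in> N)"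
    have cX: "c (Inl x) \<in> B" if "x \<in> X" for x using c that by auto
    have cH: "c (Inr z) \<in> B" if "z \<in> H" for z using c that by auto
    have sp: "(\<Sum>i\<in>X <+> H. F i) = (\<Sum>x\<in>X. F (Inl x)) + (\<Sum>z\<in>H. F (Inr z))" for F :: "_ \<Rightarrow> 'k mpoly"
      using finX finH by (simp add: sum.Plus)
    have cs: "(\<Sum>x\<in>X. c (Inl x) * pdiff j (f x)) + (\<Sum>z\<in>H. c (Inr z) * pdiff j (g z)) \<in> N" if "j < n" for j
      using c that by (simp add: sp)
    have all_H: "\<forall>z\<in>H. c (Inr z) \<in> N"
    proof (rule ccontr)
      assume "\<not> (\<forall>z\<in>H. c (Inr z) \<in> N)"
      then obtain z0 where z0: "z0 \<in> H" "c (Inr z0) \<notin> N" by blast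
      define H' where "H' = H - {z0}"
      let ?M = "?S H'"
      interpret M': ideal_set B ?M by (rule N.local_span_ideal)
      have fM: "f i \<in> ?M" if "i < m" for i using incl[of "Inl i" H'] that HZ by (auto simp: H'_def)
      have gM: "g z \<in> ?M" if "z \<in> H'" for z using incl[of "Inr z" H'] that HZ by (auto simp: H'_def)
      \<comment> \<open>Elements that, locally and modulo the ideal \<open>?M\<close> of the other
        generators, are multiples of \<open>g z0\<close> by an element of \<open>K\<close>. All of
        \<open>N\<close> is in \<open>Q B\<close>, so products of two elements of \<open>N\<close>
        are in \<open>Q N\<close>.\<close>
      define Q where "Q K = {p \<in> B. \<exists>s\<in>B - N. \<exists>b\<in>K. s * p - b * g z0 \<in> ?M}" for K
      have gz0: "g z0 \<in> B" using gB z0 HZ by blast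
      have NQ: "N \<subseteq> Q B"
      proof
        fix p assume p: "p \<in> N"
        then obtain s a where sa: "s \<in> B - N" "\<forall>z\<in>{..<m} <+> H. a z \<in> B" "s * p = (\<Sum>z\<in>{..<m} <+> H. a z * ?h z)"
          using PH by (auto simp: local_span_def)
        have "s * p - a (Inr z0) * g z0 = (\<Sum>i<m. a (Inl i) * f i) + (\<Sum>z\<in>H'. a (Inr z) * g z)"
          unfolding sa(3) using finH sum.remove[OF finH z0(1), of "\<lambda>z. a (Inr z) * g z"]
          by (simp add: sum.Plus H'_def)
        also have "\<dots> \<in> ?M" using sa(2) fM gM
          by (intro M'.add_in M'.sum_in M'.mult_in_right) (auto simp: H'_def)
        finally show "p \<in> Q B" unfolding Q_def using sa(1,2) p N.in_ring z0(1) by blast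
      qed
      have Qadd: "p + q \<in> Q N" if pq: "p \<in> Q N" "q \<in> Q N" for p q
      proof -
        obtain s b t e where *: "p \<in> B" "q \<in> B" "s \<in> B - N" "b \<in> N" "s * p - b * g z0 \<in> ?M"
          "t \<in> B - N" "e \<in> N" "t * q - e * g z0 \<in> ?M" using pq unfolding Q_def by blast
        have "t * (s * p - b * g z0) + s * (t * q - e * g z0) \<in> ?M" using * by auto
        moreover have "t * (s * p - b * g z0) + s * (t * q - e * g z0) = (s * t) * (p + q) - (t * b + s * e) * g z0"
          by (simp add: algebra_simps)
        ultimately have "(s * t) * (p + q) - (t * b + s * e) * g z0 \<in> ?M" by simp
        moreover have "s * t \<in> B - N" "t * b + s * e \<in> N" using * N.mult_notin by auto
        ultimately show ?thesis unfolding Q_def using * by blast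
      qed
      have Qmult: "a * p \<in> Q N" if ap: "a \<in> N" "p \<in> Q B" for a p
      proof -
        obtain s b where *: "p \<in> B" "s \<in> B - N" "b \<in> B" "s * p - b * g z0 \<in> ?M" using ap by (auto simp: Q_def)
        have "a * (s * p - b * g z0) \<in> ?M" using * ap N.in_ring by auto
        moreover have "a * (s * p - b * g z0) = s * (a * p) - (a * b) * g z0" by (simp add: algebra_simps)
        ultimately have "s * (a * p) - (a * b) * g z0 \<in> ?M" by simp
        moreover have "a * b \<in> N" "a * p \<in> B" using * ap N.in_ring by auto
        ultimately show ?thesis unfolding Q_def using *(2) by blast
      qed
      have Q0: "0 \<in> Q N" unfolding Q_def by (auto intro!: bexI[of _ 1] bexI[of _ 0])
      define h0 where "h0 = (\<Sum>x\<in>X. c (Inl x) * f x) + (\<Sum>z\<in>H. c (Inr z) * g z)"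
      have h0N: "h0 \<in> N" unfolding h0_def
        using cX cH fN gN X(1) HZ by (intro N.add_in N.sum_in N.mult_in_right) auto
      have dh0: "pdiff j h0 \<in> N" if "j < n" for j
      proof -
        have "pdiff j h0 = ((\<Sum>x\<in>X. c (Inl x) * pdiff j (f x)) + (\<Sum>z\<in>H. c (Inr z) * pdiff j (g z))) +
            ((\<Sum>x\<in>X. pdiff j (c (Inl x)) * f x) + (\<Sum>z\<in>H. pdiff j (c (Inr z)) * g z))"
          by (simp add: h0_def pdiff_sum pdiff_mult sum.distrib algebra_simps)
        moreover have "(\<Sum>x\<in>X. pdiff j (c (Inl x)) * f x) + (\<Sum>z\<in>H. pdiff j (c (Inr z)) * g z) \<in> N"
          using pdiff_in[OF cX] pdiff_in[OF cH] fN gN X(1) HZ by (intro N.add_in N.sum_in N.mult_in_right) auto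
        ultimately show ?thesis using cs[OF that] by auto
      qed
      obtain s a where sa: "s \<in> B - N" "\<forall>z\<in>Z. a z \<in> B" "s * h0 = (\<Sum>z\<in>Z. a z * g z)"
        using NZ h0N by (auto simp: local_span_def)
      have aN: "a z \<in> N" if "z \<in> Z" for z
      proof (rule indep_modD[OF Zind _ _ that])
        fix j assume j: "j \<in> W"
        have "s * pdiff j h0 + pdiff j s * h0 = (\<Sum>z\<in>Z. a z * pdiff j (g z)) + (\<Sum>z\<in>Z. pdiff j (a z) * g z)"
          using arg_cong[OF sa(3), of "pdiff j"] by (simp add: pdiff_mult pdiff_sum sum.distrib algebra_simps)
        then have "(\<Sum>z\<in>Z. a z * pdiff j (g z)) = s * pdiff j h0 + pdiff j s * h0 - (\<Sum>z\<in>Z. pdiff j (a z) * g z)"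
          by (simp add: algebra_simps)
        also have "\<dots> \<in> N" using sa(1,2) dh0 j h0N gN pdiff_in[of s W] pdiff_in[of "a z" W for z]
          by (intro N.diff_in N.add_in N.sum_in N.mult_in_right) auto
        finally show "(\<Sum>z\<in>Z. a z * pdiff j (g z)) \<in> N" .
      qed (use sa(2) in auto)
      have "(\<Sum>z\<in>Y. a z * g z) \<in> Q N" if "Y \<subseteq> Z" for Y
        using that
      proof (induction Y rule: infinite_finite_induct)
        case (insert y Y)
        then have "a y * g y \<in> Q N" using gN NQ by (intro Qmult aN) auto
        then show ?case using insert Qadd by simp
      qed (use Q0 in auto)
      then have "s * h0 \<in> Q N" unfolding sa(3) by blast
      then obtain t b where tb: "t \<in> B - N" "b \<in> N" "t * (s * h0) - b * g z0 \<in> ?M" by (auto simp: Q_def)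
      have h0M: "h0 - c (Inr z0) * g z0 \<in> ?M"
      proof -
        have "h0 - c (Inr z0) * g z0 = (\<Sum>x\<in>X. c (Inl x) * f x) + (\<Sum>z\<in>H'. c (Inr z) * g z)"
          using sum.remove[OF finH z0(1), of "\<lambda>z. c (Inr z) * g z"] by (simp add: h0_def H'_def)
        also have "\<dots> \<in> ?M" using cX cH fM gM X(1)
          by (intro M'.add_in M'.sum_in M'.mult_in_right) (auto simp: H'_def)
        finally show ?thesis .
      qed
      \<comment> \<open>Up to multipliers, \<open>h0\<close> is a multiple of \<open>g z0\<close>
        modulo \<open>?M\<close> in two ways: with the coefficient \<open>b\<close> in
        \<open>N\<close> and with \<open>c (Inr z0)\<close> outside \<open>N\<close>. The difference
        is \<open>g z0\<close> times an element outside \<open>N\<close>.\<close>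
      have "(t * (s * h0) - b * g z0) - (t * s) * (h0 - c (Inr z0) * g z0) \<in> ?M"
        by (rule M'.diff_in[OF tb(3) M'.mult_in_right[OF _ h0M]]) (use tb(1) sa(1) in auto)
      moreover have "(t * (s * h0) - b * g z0) - (t * s) * (h0 - c (Inr z0) * g z0) =
          (t * s * c (Inr z0) - b) * g z0" by (simp add: algebra_simps)
      ultimately have "(t * s * c (Inr z0) - b) * g z0 \<in> ?M" by simp
      moreover have "t * s * c (Inr z0) - b \<in> B - N"
      proof -
        have "t * s * c (Inr z0) \<notin> N" using tb(1) sa(1) z0 cH[OF z0(1)] by (intro N.mult_notin) auto
        then have "t * s * c (Inr z0) - b \<notin> N" using N.diff_in_imp[OF _ tb(2)] by blast
        moreover have "t * s * c (Inr z0) - b \<in> B" using tb(1) sa(1) cH[OF z0(1)] N.in_ring[OF tb(2)] by auto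
        ultimately show ?thesis by blast
      qed
      ultimately have "g z0 \<in> ?M" using N.local_span_cancel gz0 by blast
      then have "g z \<in> ?M" if "z \<in> H" for z using gM that by (cases "z = z0") (auto simp: H'_def)
      then have "?h y \<in> ?M" if "y \<in> {..<m} <+> H" for y
        using that fM by auto
      then have "?S H \<subseteq> ?M" by (rule N.local_span_mono)
      then have "?P H'" using PH by (auto simp: H'_def)
      then have "card H \<le> card H'" by (rule Hmin)
      then show False using z0(1) finH unfolding H'_def by (metis card_Diff1_less not_le)
    qed
    have "(\<Sum>x\<in>X. c (Inl x) * pdiff j (f x)) \<in> N" if "j \<in> W" for j
    proof -
      have H: "(\<Sum>z\<in>H. c (Inr z) * pdiff j (g z)) \<in> N"
        using all_H gB HZ by (intro N.sum_in N.mult_in_left pdiff_in) auto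
      have "j < n" using that by simp
      from N.diff_in[OF cs[OF this] H] show ?thesis by simp
    qed
    then have "\<forall>x\<in>X. c (Inl x) \<in> N" using indep_modD[OF X_indep, of "\<lambda>x. c (Inl x)"] cX by blast
    then show "\<forall>i\<in>X <+> H. c i \<in> N" using all_H by auto
  qed
  moreover have "g z \<in> N" if "z \<in> H" for z using gN HZ that by blast
  ultimately show ?thesis using that[of H g] finH PH by blast
qed

text \<open>Modulo \<open>I\<close> all Jacobi rows are combinations of those in \<open>X\<close>,
  so orthogonality to the latter suffices.\<close>

lemma tangent_of_orthogonal:
  assumes v: "\<And>j. j < n \<Longrightarrow> v j \<in> B" and o: "\<And>x. x \<in> X \<Longrightarrow> (\<Sum>j<n. pdiff j (f x) * v j) = 0"
  shows "tangent (\<lambda>j. bar (v j))"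
proof (rule tangentI)
  fix i assume i: "i < m"
  obtain s a where sa: "s \<in> B - I" "\<forall>x\<in>X. a x \<in> B" "\<forall>j\<in>W. s * pdiff j (f i) - (\<Sum>x\<in>X. a x * pdiff j (f x)) \<in> I"
    using rows_span[OF prime_I subset_refl IN i] by (auto simp: in_span_mod_def)
  have "(\<Sum>j<n. (s * pdiff j (f i) - (\<Sum>x\<in>X. a x * pdiff j (f x))) * v j) \<in> I"
    using sa(3) v by (intro I.sum_in I.mult_in_left) auto
  also have "(\<Sum>j<n. (s * pdiff j (f i) - (\<Sum>x\<in>X. a x * pdiff j (f x))) * v j) =
      s * (\<Sum>j<n. pdiff j (f i) * v j) - (\<Sum>j<n. \<Sum>x\<in>X. a x * (pdiff j (f x) * v j))"
    by (simp add: sum_subtractf left_diff_distrib sum_distrib_left sum_distrib_right mult.assoc)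
  also have "(\<Sum>j<n. \<Sum>x\<in>X. a x * (pdiff j (f x) * v j)) = (\<Sum>x\<in>X. a x * (\<Sum>j<n. pdiff j (f x) * v j))"
    by (subst sum.swap) (simp add: sum_distrib_left)
  also have "\<dots> = 0" using o by simp
  finally have "s * (\<Sum>j<n. pdiff j (f i) * v j) \<in> I" by simp
  moreover have B: "(\<Sum>j<n. pdiff j (f i) * v j) \<in> B" using grad_f_B[OF i] v by (intro polys.sum_mem polys.mult_mem) auto
  ultimately have "(\<Sum>j<n. pdiff j (f i) * v j) \<in> I" using I.prime_in sa(1) by blast
  then have "bar (\<Sum>j<n. pdiff j (f i) * v j) = 0" using bar_eq_0_iff[OF B] by simp
  moreover have "bar (\<Sum>j<n. pdiff j (f i) * v j) = (\<Sum>j<n. bar (v j) * bar (pdiff j (f i)))"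
    using grad_f_B[OF i] v by (subst bar_sum) (auto simp: bar_mult mult.commute)
  ultimately show "directional (\<lambda>j. bar (v j)) (f i) = 0" by (simp add: directional_def)
qed

lemma chain_exists:
  assumes zs: "distinct zs" "set zs = H" and gN: "\<And>z. z \<in> H \<Longrightarrow> g z \<in> N"
    and ind: "indep_mod B N (X <+> H) (grad (case_sum f g)) W"
  shows "\<exists>P. prime_chain (subring_of (Loc U)) (length zs) P"
proof -
  let ?d = "length zs"
  let ?h = "case_sum f g"
  have finH: "finite H" using zs(2) by auto
  have gB: "g z \<in> B" if "z \<in> H" for z using gN[OF that] N.in_ring by blast
  \<comment> \<open>Derivations of the local ring that kill the first \<open>i\<close> generators.
    There are fewer of them as \<open>i\<close> grows, so the ideals \<open>P i\<close>
    increase.\<close>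
  define V where "V i = {v. (\<forall>j<n. v j \<in> Loc U) \<and> tangent v \<and> (\<forall>l<i. directional v (g (zs ! l)) = 0)}" for i
  define P where "P i = largest_stable (Loc U) (vec_derivation ` V i) (extend U N)" for i
  have der: "derivation_on (Loc U) D" if "D \<in> vec_derivation ` V i" for D i
    using that derivation_on_vec_derivation[OF mult_set_U] by (auto simp: V_def)
  have prime: "prime_set (Loc U) (P i)" for i
    unfolding P_def by (rule M.prime_largest_stable[OF der inverse_of_nat_in_Loc[OF mult_set_U]])
  have sub: "P i \<subseteq> extend U N" for i unfolding P_def by (rule M.largest_stable_subset[OF der])
  have st: "stable_ideal (Loc U) (vec_derivation ` V i) (P i)" for i
    unfolding P_def by (rule M.stable_largest_stable[OF der])
  have mono: "P i \<subseteq> P (Suc i)" for i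
  proof -
    have "V (Suc i) \<subseteq> V i" by (auto simp: V_def)
    then have stS: "stable_ideal (Loc U) (vec_derivation ` V (Suc i)) (P i)"
      using st[of i] by (auto simp: stable_ideal_def)
    show ?thesis unfolding P_def[of "Suc i"]
      by (rule M.largest_stable_maximal[OF _ stS sub]) (rule der)
  qed
  have zH: "zs ! i \<in> H" if "i < ?d" for i using zs(2) that by auto
  \<comment> \<open>The ideal of the first \<open>Suc i\<close> generators is stable: a derivation
    from \<open>V (Suc i)\<close> kills these generators and so acts only on the coefficients. The
    ideal lies in the maximal ideal, hence in \<open>P (Suc i)\<close>.\<close>
  have mem: "bar (g (zs ! i)) \<in> P (Suc i)" if i: "i < ?d" for i
  proof -
    let ?F = "(\<lambda>l. bar (g (zs ! l))) ` {..<Suc i}"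
    have F: "?F \<subseteq> extend U N" using i gN gB zH bar_in_extend_U by (auto simp: less_Suc_eq)
    have S: "ideal_set (Loc U) (span_of (Loc U) ?F)" by (rule R.span_of_ideal) (use F M.subset in blast)
    interpret S: ideal_set "Loc U" "span_of (Loc U) ?F" by (rule S)
    have "stable_ideal (Loc U) (vec_derivation ` V (Suc i)) (span_of (Loc U) ?F)"
      unfolding stable_ideal_def
    proof (intro conjI ballI)
      fix D x assume D: "D \<in> vec_derivation ` V (Suc i)" and x: "x \<in> span_of (Loc U) ?F"
      obtain v where v: "D = vec_derivation v" "v \<in> V (Suc i)" using D by blast
      have tv: "tangent v" using v by (simp add: V_def)
      have Dy: "D y = 0" if y: "y \<in> ?F" for y
      proof -
        obtain l where l': "y = bar (g (zs ! l))" "l \<in> {..<Suc i}" using y by (rule imageE)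
        then have l: "l < Suc i" "y = bar (g (zs ! l))" by simp_all
        then have "D y = directional v (g (zs ! l))" using v tv i gB zH by (auto simp: vec_derivation_bar less_Suc_eq)
        then show ?thesis using v(2) l by (simp add: V_def)
      qed
      have DL: "D y \<in> Loc U" if "y \<in> Loc U" for y using der[OF D] that by (auto simp: derivation_on_def)
      obtain a where a: "x = (\<Sum>y\<in>?F. a y * y)" "\<forall>y\<in>?F. a y \<in> Loc U" using x by (auto simp: span_of_def)
      have "D (\<Sum>y\<in>Y. a y * y) = (\<Sum>y\<in>Y. D (a y) * y)" if "Y \<subseteq> ?F" for Y
        using that
      proof (induction Y rule: infinite_finite_induct)
        case (insert y Y)
        then show ?case using Dy vec_derivation_add_mult[OF tv] by (simp add: v(1))
      next
        case empty
        then show ?case using vec_derivation_bar[OF tv, of 0] by (simp add: v(1) directional_zero)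
      next
        case (infinite Y)
        then show ?case using finite_subset by blast
      qed
      then have "D x = (\<Sum>y\<in>?F. D (a y) * y)" unfolding a(1) by blast
      also have "\<dots> \<in> span_of (Loc U) ?F"
        using a(2) DL by (intro S.sum_in S.mult_in_right R.span_of_incl) auto
      finally show "D x \<in> span_of (Loc U) ?F" .
    qed (rule S)
    moreover have "span_of (Loc U) ?F \<subseteq> extend U N"
      by (rule R.span_of_minimal[OF M.ideal_set_axioms F])
    ultimately have "span_of (Loc U) ?F \<subseteq> P (Suc i)"
      unfolding P_def by (intro M.largest_stable_maximal[OF der])
    moreover have "bar (g (zs ! i)) \<in> span_of (Loc U) ?F" by (rule R.span_of_incl) auto
    ultimately show ?thesis by blast
  qed
  \<comment> \<open>A dual vector, orthogonal to the Jacobi rows in \<open>X\<close> and to the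
    gradients of the earlier generators, gives a derivation in \<open>V i\<close> that sends the
    next generator outside the maximal ideal. So this generator is not in the stable ideal
    \<open>P i\<close>.\<close>
  have notmem: "bar (g (zs ! i)) \<notin> P i" if i: "i < ?d" for i
  proof
    assume gP: "bar (g (zs ! i)) \<in> P i"
    let ?Y = "X <+> (!) zs ` {..<i}"
    have Ysub: "insert (Inr (zs ! i)) ?Y \<subseteq> X <+> H" using i zH by auto
    have notY: "Inr (zs ! i) \<notin> ?Y" using zs(1) i by (auto simp: nth_eq_iff_index_eq)
    have hB: "grad ?h y j \<in> B" if "y \<in> X <+> H" for y j
      using that X(1) gB f_B by (auto intro!: pdiff_in)
    have indY: "indep_mod B N (insert (Inr (zs ! i)) ?Y) (grad ?h) W"
      by (rule N.indep_mod_subset[OF ind Ysub]) (use finX finH in auto)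
    have finY: "finite (insert (Inr (zs ! i)) ?Y)" using finX by simp
    have hY: "grad ?h y j \<in> B" if "y \<in> insert (Inr (zs ! i)) ?Y" for y j
      using hB[OF subsetD[OF Ysub that]] .
    obtain v where v: "\<forall>j\<in>W. v j \<in> B" "\<forall>x\<in>insert (Inr (zs ! i)) ?Y - {Inr (zs ! i)}. (\<Sum>j\<in>W. grad ?h x j * v j) = 0"
      "(\<Sum>j\<in>W. grad ?h (Inr (zs ! i)) j * v j) \<notin> N"
      using N.indep_mod_dual_vector[OF finY finite_lessThan indY insertI1 hY] by blast
    have v0: "(\<Sum>j<n. pdiff j (f x) * v j) = 0" if "x \<in> X" for x
      using bspec[OF v(2), of "Inl x"] that by auto
    have v1: "(\<Sum>j<n. pdiff j (g (zs ! l)) * v j) = 0" if "l < i" for l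
      using bspec[OF v(2), of "Inr (zs ! l)"] that notY by auto
    let ?v = "\<lambda>j. bar (v j)"
    have t: "tangent ?v" using v(1) v0 by (intro tangent_of_orthogonal) auto
    have dir: "directional ?v p = bar (\<Sum>j<n. pdiff j p * v j)" if "p \<in> B" for p
      using that v(1) unfolding directional_def by (subst bar_sum) (auto simp: bar_mult pdiff_in mult.commute)
    have "?v \<in> V i"
      unfolding V_def using t v(1) bar_in_Loc[OF mult_set_U] v1 i gB zH by (auto simp: dir)
    then have "vec_derivation ?v (bar (g (zs ! i))) \<in> P i" using st[of i] gP by (auto simp: stable_ideal_def)
    then have "bar (\<Sum>j<n. pdiff j (g (zs ! i)) * v j) \<in> extend U N"
      using sub vec_derivation_bar[OF t] dir gB zH[OF i] by auto
    moreover have "(\<Sum>j<n. pdiff j (g (zs ! i)) * v j) \<in> B"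
      using v(1) gB[OF zH[OF i]] by (intro polys.sum_mem polys.mult_mem pdiff_in) auto
    ultimately have "(\<Sum>j<n. pdiff j (g (zs ! i)) * v j) \<in> N" using bar_in_extend_U by blast
    then show False using v(3) by simp
  qed
  have "prime_chain (subring_of (Loc U)) ?d P"
    unfolding prime_chain_def using prime mono mem notmem R.primeideal_subring_of_iff by blast
  then show ?thesis by blast
qed

lemma indep_rows_imp_regular: "regular_local_ring (subring_of (Loc U))"
proof -
  obtain H and g :: "nat \<Rightarrow> 'k mpoly" where H: "finite H" "\<And>z. z \<in> H \<Longrightarrow> g z \<in> N"
    "N \<subseteq> local_span B N ({..<m} <+> H) (case_sum f g)"
    "indep_mod B N (X <+> H) (grad (case_sum f g)) W" using minimal_generators by blast
  obtain zs where zs: "set zs = H" "distinct zs" using finite_distinct_list[OF H(1)] by blast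
  let ?d = "length zs"
  have d: "card H = ?d" using zs distinct_card by fastforce
  have gB: "g z \<in> B" if "z \<in> H" for z using H(2)[OF that] N.in_ring by blast
  \<comment> \<open>The number of generators bounds the gain in \<open>grad_rank\<close>, which
    bounds the length of chains; \<open>chain_exists\<close> shows that the bound is
    attained.\<close>
  have "grad_rank W N \<le> ?d + grad_rank W I"
    using grad_rank_le_generators[OF H(1-3) X(1) rows_span[OF N IN subset_refl]] X(2) d by simp
  then have le: "l \<le> ?d" if "prime_chain (subring_of (Loc U)) l P" for l P
    using chain_length_le[OF that] by simp
  obtain P where "prime_chain (subring_of (Loc U)) ?d P"
    using chain_exists[OF zs(2,1) H(2,4)] by blast
  then have dim: "krull_dim (subring_of (Loc U)) = enat ?d"
    unfolding krull_dim_def using le by (intro antisym Sup_least Sup_upper) auto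
  let ?y = "\<lambda>l. bar (g (zs ! l))"
  have zH: "zs ! i \<in> H" if "i < ?d" for i using zs(1) that by auto
  have yL: "?y ` {..<?d} \<subseteq> Loc U" using gB zH bar_in_Loc[OF mult_set_U] by auto
  have "extend U N = {\<Sum>l<?d. a l * ?y l | a. \<forall>l<?d. a l \<in> Loc U}" (is "_ = ?G")
  proof
    show "?G \<subseteq> extend U N"
      using H(2) gB zH bar_in_extend_U by (auto intro!: M.sum_in)
    show "extend U N \<subseteq> ?G"
    proof
      fix x assume "x \<in> extend U N"
      then obtain p s where ps: "x = bar p / bar s" "p \<in> N" "s \<in> U" by (auto simp: extend_def)
      obtain t a where ta: "t \<in> B - N" "\<forall>z\<in>{..<m} <+> H. a z \<in> B" "t * p = (\<Sum>z\<in>{..<m} <+> H. a z * case_sum f g z)"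
        using H(3) ps(2) by (auto simp: local_span_def)
      have B: "p \<in> B" "s \<in> B" "t \<in> B" "bar s \<noteq> 0" "bar t \<noteq> 0"
        using ps ta N.in_ring mult_setD(4)[OF mult_set_U] by auto
      have bf: "bar (f i) = 0" if "i < m" for i using f_in[OF that] f_B[OF that] bar_eq_0_iff by simp
      have "bar t * bar p = bar (\<Sum>z\<in>{..<m} <+> H. a z * case_sum f g z)"
        using B ta(3) by (simp flip: bar_mult)
      also have "\<dots> = (\<Sum>z\<in>{..<m} <+> H. bar (a z) * bar (case_sum f g z))"
      proof -
        have "a z \<in> B" "case_sum f g z \<in> B" if "z \<in> {..<m} <+> H" for z using that ta(2) f_B gB by auto
        then show ?thesis by (subst bar_sum, blast, intro sum.cong refl bar_mult)
      qed
      also have "\<dots> = (\<Sum>z\<in>H. bar (a (Inr z)) * bar (g z))"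
        using H(1) bf by (simp add: sum.Plus)
      also have "\<dots> = (\<Sum>l<?d. bar (a (Inr (zs ! l))) * ?y l)"
        using sum_set_nth[OF zs(2), of "\<lambda>z. bar (a (Inr z)) * bar (g z)"] zs(1) by simp
      finally have e: "bar t * bar p = (\<Sum>l<?d. bar (a (Inr (zs ! l))) * ?y l)" .
      have "x = (bar t * bar p) / bar (s * t)" using B ps(1) by (simp add: bar_mult)
      then have "x = (\<Sum>l<?d. (bar (a (Inr (zs ! l))) / bar (s * t)) * ?y l)"
        unfolding e by (simp add: sum_divide_distrib)
      moreover have "s * t \<in> U" using ps ta N.mult_notin by auto
      then have "\<forall>l<?d. bar (a (Inr (zs ! l))) / bar (s * t) \<in> Loc U"
        using ta(2) zH by (auto intro!: LocI[OF mult_set_U])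
      ultimately show "x \<in> ?G" by (intro CollectI exI[of _ "\<lambda>l. bar (a (Inr (zs ! l))) / bar (s * t)"] conjI)
    qed
  qed
  then have gen: "extend U N = genideal (subring_of (Loc U)) (?y ` {..<?d})"
    using R.genideal_eq[OF finite_lessThan yL] by auto
  show ?thesis
    unfolding regular_local_ring_def
  proof (intro conjI exI[of _ "extend U N"] exI[of _ ?d] exI[of _ ?y])
    show "cring (subring_of (Loc U))" by (rule R.cring_subring_of)
    show "noetherian_ring (subring_of (Loc U))" by (rule noetherian_Loc[OF mult_set_U])
  qed (use maximalideal_Loc_U dim yL gen in auto)
qed

end

end

theorem regular_Loc_iff:
  assumes T: "mult_set T"
  shows "regular (Loc T) \<longleftrightarrow> (\<forall>P. prime_set (Loc T) P \<longrightarrow>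
    (\<exists>X\<subseteq>{..<m}. card X = grad_rank W I \<and> indep_mod B (contract P) X (grad f) W))"
proof -
  interpret R: subring_set "Loc T" by (rule subring_Loc[OF T])
  have "regular_local_ring (subring_of (fractions (Loc T) (Loc T - P))) \<longleftrightarrow>
      (\<exists>X\<subseteq>{..<m}. card X = grad_rank W I \<and> indep_mod B (contract P) X (grad f) W)"
    if P: "prime_set (Loc T) P" for P
  proof -
    have C: "prime_set B (contract P)" "I \<subseteq> contract P"
      using prime_contract(1)[OF T P] ideal_contract(2)[OF T] P by (auto simp: prime_set_def)
    show ?thesis
      unfolding fractions_Loc[OF T P]
      using regular_imp_indep_rows[OF C] indep_rows_imp_regular[OF C] by blast
  qed
  then show ?thesis
    unfolding regular_def using noetherian_Loc[OF T] R.primeideal_subring_of_iff by blast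
qed

end

section \<open>Natural derivations\<close>

lemma entry_det_zero:
  assumes "\<not> distinct xs" "length xs = length ys"
  shows "det (entry_mat u xs ys :: 'a::comm_ring_1 mat) = 0"
proof -
  obtain i j where ij: "i < length xs" "j < length xs" "i \<noteq> j" "xs ! i = xs ! j"
    using assms(1) by (auto simp: distinct_conv_nth)
  have "row (entry_mat u xs ys) i = row (entry_mat u xs ys) j"
    using ij by (intro eq_vecI) auto
  then show ?thesis
    using det_identical_rows[of "entry_mat u xs ys" "length xs" i j] ij assms(2) by auto
qed

lemma finite_increasing_tuples: "finite (increasing_tuples k N)"
proof -
  have "increasing_tuples k N \<subseteq> {xs. set xs \<subseteq> {..<N} \<and> length xs = k}"
    by (auto simp: increasing_tuples_def index_tuples_def)
  then show ?thesis using finite_lists_length_eq[of "{..<N}" k] finite_subset by blast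
qed

lemma dropWhile_less_ge:
  "sorted_wrt (<) jv \<Longrightarrow> x \<in> set (dropWhile (\<lambda>x. x < k) jv) \<Longrightarrow> (k :: nat) \<le> x"
  by (induction jv) (auto split: if_splits)

text \<open>The position \<open>i\<close> of the new index is recorded because it fixes the sign and
  the minor with which that variable enters the natural derivation.\<close>

lemma insert_into_increasing:
  assumes "sorted_wrt (<) jv" "(k :: nat) \<notin> set jv"
  obtains i jv' where "i \<le> length jv" "sorted_wrt (<) jv'" "set jv' = insert k (set jv)"
    "length jv' = Suc (length jv)" "jv' ! i = k" "delete_nth i jv' = jv"
proof -
  let ?a = "takeWhile (\<lambda>x. x < k) jv" and ?b = "dropWhile (\<lambda>x. x < k) jv"
  have ab: "?a @ ?b = jv" by simp
  have len: "length ?a + length ?b = length jv" using ab by (metis length_append)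
  have sab: "set ?a \<union> set ?b = set jv" using ab by (metis set_append)
  have kb: "k < x" if "x \<in> set ?b" for x
  proof -
    have "k \<le> x" by (rule dropWhile_less_ge[OF assms(1) that])
    moreover have "x \<in> set jv" using that sab by blast
    ultimately show ?thesis using assms(2) by (cases "x = k") auto
  qed
  have ka: "x < k" if "x \<in> set ?a" for x using set_takeWhileD[OF that] by simp
  have "sorted_wrt (<) ?a" "sorted_wrt (<) ?b"
    using assms(1) unfolding sorted_wrt_append[of "(<)" ?a ?b, simplified ab] by blast+
  then have "sorted_wrt (<) (?a @ k # ?b)"
    unfolding sorted_wrt_append sorted_wrt.simps list.set ball_simps(7) using ka kb by (meson less_trans)
  moreover have "set (?a @ k # ?b) = insert k (set jv)" using sab by auto
  moreover have "delete_nth (length ?a) (?a @ k # ?b) = jv" by (simp add: delete_nth_def)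
  ultimately show ?thesis using that[of "length ?a" "?a @ k # ?b"] len by auto
qed

lemma sorted_wrt_less_distinct: "sorted_wrt (<) (xs :: nat list) \<Longrightarrow> distinct xs"
  by (induction xs) auto

lemma Der_lincomb:
  assumes R: "subring_set R" and D: "\<And>i. i \<in> X \<Longrightarrow> D i \<in> Der \<kappa> R" "\<And>i. i \<in> X \<Longrightarrow> a i \<in> R" and \<kappa>: "\<And>c. \<kappa> c \<in> R"
  shows "(\<lambda>x\<in>R. \<Sum>i\<in>X. a i * D i x) \<in> Der \<kappa> R"
proof -
  interpret subring_set R by fact
  have d: "D i x \<in> R" "D i (x + y) = D i x + D i y" "D i (\<kappa> c * x) = \<kappa> c * D i x" "D i (x * y) = D i x * y + x * D i y"
    if "i \<in> X" "x \<in> R" "y \<in> R" for i x y c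
    using D(1)[OF that(1)] that(2,3) by (auto simp: Der_def End_ring_def)
  have "(\<Sum>i\<in>X. a i * D i x) \<in> R" if "x \<in> R" for x
    using d(1)[OF _ that that] D(2) by (intro sum_mem mult_mem) auto
  moreover have "(\<Sum>i\<in>X. a i * D i (x + y)) = (\<Sum>i\<in>X. a i * D i x) + (\<Sum>i\<in>X. a i * D i y)" if "x \<in> R" "y \<in> R" for x y
    using d(2)[OF _ that] by (simp add: sum.distrib distrib_left)
  moreover have "(\<Sum>i\<in>X. a i * D i (\<kappa> c * x)) = \<kappa> c * (\<Sum>i\<in>X. a i * D i x)" if "x \<in> R" for x c
    using d(3)[OF _ that that] by (simp add: sum_distrib_left mult.left_commute)
  moreover have "(\<Sum>i\<in>X. a i * D i (x * y)) = (\<Sum>i\<in>X. a i * D i x) * y + x * (\<Sum>i\<in>X. a i * D i y)"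
    if "x \<in> R" "y \<in> R" for x y
    using d(4)[OF _ that] by (simp add: sum_distrib_left sum_distrib_right sum.distrib distrib_left mult_ac)
  ultimately show ?thesis using \<kappa> by (auto simp: Der_def End_ring_def)
qed

section \<open>The Jacobi matrix and its minors\<close>

context affine_domain begin

abbreviation "J \<equiv> jacobi_matrix m n f bar"
abbreviation "r \<equiv> mat_rank J"

lemma J_carrier: "J \<in> carrier_mat m n"
  by (simp add: jacobi_matrix_def)

lemma J_dim [simp]: "dim_row J = m" "dim_col J = n"
  by (simp_all add: jacobi_matrix_def)

lemma J_entry: "i < m \<Longrightarrow> j < n \<Longrightarrow> J $$ (i, j) = bar (pdiff j (f i))"
  by (simp add: jacobi_matrix_def)

lemma J_entry_Loc: "mult_set T \<Longrightarrow> i < m \<Longrightarrow> j < n \<Longrightarrow> J $$ (i, j) \<in> Loc T"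
  using bar_in_Loc[of T "pdiff j (f i)"] pdiff_in[OF f_B[of i]] by (simp add: J_entry)

lemma indep_mod_pullback:
  assumes P: "prime_set R P" "\<And>p. p \<in> B \<Longrightarrow> bar p \<in> R" and X: "X \<subseteq> {..<m}" "indep_mod R P X (\<lambda>i j. J $$ (i, j)) W"
    and N: "\<And>p. p \<in> B \<Longrightarrow> bar p \<in> P \<longleftrightarrow> p \<in> N"
  shows "indep_mod B N X (grad f) W"
  unfolding indep_mod_def
proof (intro allI impI ballI)
  interpret P: prime_set R P by fact
  fix c i assume c: "(\<forall>i\<in>X. c i \<in> B) \<and> (\<forall>j\<in>W. (\<Sum>i\<in>X. c i * grad f i j) \<in> N)" and i: "i \<in> X"
  have m: "i < m" if "i \<in> X" for i using X(1) that by auto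
  have "(\<Sum>i\<in>X. bar (c i) * J $$ (i, j)) \<in> P" if j: "j \<in> W" for j
  proof -
    have B: "c i * grad f i j \<in> B" if "i \<in> X" for i
      using c that m[OF that] f_B by (intro polys.mult_mem pdiff_in) auto
    have "bar (\<Sum>i\<in>X. c i * grad f i j) = (\<Sum>i\<in>X. bar (c i * grad f i j))"
      by (rule bar_sum) (rule B)
    then have "(\<Sum>i\<in>X. bar (c i) * J $$ (i, j)) = bar (\<Sum>i\<in>X. c i * grad f i j)"
      using c m j f_B by (auto simp: J_entry bar_mult pdiff_in intro!: sum.cong)
    moreover have "(\<Sum>i\<in>X. c i * grad f i j) \<in> B" using B by (rule polys.sum_mem)
    ultimately show ?thesis using N c j by auto
  qed
  then have "bar (c i) \<in> P" using indep_modD[OF X(2), of "\<lambda>i. bar (c i)" i] c P(2) i by auto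
  then show "c i \<in> N" using N c i by blast
qed

text \<open>A relation over \<open>R\<close> may have coefficients that are not values of
  \<open>bar\<close>, so it cannot be pulled back directly; the dual vectors of
  \<open>indep_mod_transfer\<close> can be pushed forward.\<close>

lemma indep_mod_pushforward:
  assumes N: "prime_set B N" and P: "prime_set R P" "\<And>p. p \<in> B \<Longrightarrow> bar p \<in> R"
    and ker: "\<And>p. p \<in> B \<Longrightarrow> bar p \<in> P \<Longrightarrow> p \<in> N"
    and Z: "finite Z" "\<And>z. z \<in> Z \<Longrightarrow> g z \<in> B" "indep_mod B N Z (grad g) W"
  shows "indep_mod R P Z (\<lambda>z j. bar (pdiff j (g z))) W"
  by (rule prime_set.indep_mod_transfer[OF N P(1) Z(1) finite_lessThan Z(3)])
    (use Z(2) P(2) ker in \<open>auto simp: pdiff_in bar_add bar_mult\<close>)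

text \<open>Independent rows over the field pull back to elements of \<open>I\<close> with
  independent gradients. Conversely the \<open>f i\<close> generate \<open>I\<close>, so a maximal
  set of rows independent modulo \<open>I\<close> has at least \<open>grad_rank W I\<close>
  elements, and it stays independent over the field.\<close>

lemma rank_eq: "r = grad_rank W I"
proof (rule antisym)
  obtain X where X: "X \<subseteq> {..<m}" "card X = r" "indep_mod UNIV {0} X (\<lambda>i j. J $$ (i, j)) W"
    using mat_rank_eq(1)[OF J_carrier] by blast
  have fX: "finite X" using X(1) finite_subset by blast
  have "indep_mod B I X (grad f) W"
    by (rule indep_mod_pullback[OF prime_set_zero _ X(1,3)]) (use bar_eq_0_iff in auto)
  then have "card X \<le> grad_rank W I"
    by (intro card_le_grad_rank[OF prime_I _ fX, of f]) (use f_in X(1) in auto)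
  then show "r \<le> grad_rank W I" using X(2) by simp
  have e: "indep_mod B I {} (grad f) W" by (simp add: indep_mod_def)
  have gB: "grad f i j \<in> B" if "i \<in> {..<m}" for i j using pdiff_in[OF f_B[of i]] that by simp
  obtain Y where "{} \<subseteq> Y" and Y: "Y \<subseteq> {..<m}" "indep_mod B I Y (grad f) W"
    "\<And>i. i \<in> {..<m} \<Longrightarrow> in_span_mod B I Y (grad f) W (grad f i)"
    by (rule I.exists_maximal_indep[OF finite_lessThan[of m] empty_subsetI e gB]) (assumption, rule that)
  have fY: "finite Y" using Y(1) finite_subset by blast
  define q :: "nat \<Rightarrow> 'k mpoly" where "q = undefined"
  let ?S = "local_span B I ({..<m} <+> {}) (case_sum f q)"
  have "f i \<in> ?S" if "i < m" for i
    using I.local_span_incl[of "{..<m} <+> {}" "Inl i" "case_sum f q"] InlI[of i "{..<m}" "{}"] that f_B by simp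
  then have "I \<subseteq> ?S" by (intro I_subset_ideal[OF I.local_span_ideal]) auto
  then have "grad_rank W I \<le> card ({} :: nat set) + card Y"
    by (intro grad_rank_le_generators[OF prime_I subset_refl _ _ _ Y(1), of "{}" q]) (use Y(3) in auto)
  moreover have "indep_mod UNIV {0} Y (\<lambda>i j. bar (pdiff j (f i))) W"
    by (rule indep_mod_pushforward[OF prime_I prime_set_zero _ _ fY _ Y(2)]) (use bar_eq_0_iff f_B Y(1) in auto)
  then have "indep_mod UNIV {0} Y (\<lambda>i j. J $$ (i, j)) W"
  proof -
    have "(\<Sum>i\<in>Y. c i * J $$ (i, j)) = (\<Sum>i\<in>Y. c i * bar (pdiff j (f i)))" if "j \<in> W" for c j
      using that Y(1) by (intro sum.cong) (auto simp: J_entry subset_iff)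
    then show ?thesis using \<open>indep_mod UNIV {0} Y (\<lambda>i j. bar (pdiff j (f i))) W\<close>
      unfolding indep_mod_def by simp
  qed
  then have "card Y \<le> r" by (rule mat_rank_eq(2)[OF J_carrier Y(1)])
  ultimately show "grad_rank W I \<le> r" by simp
qed

lemma minor_nonzero_length:
  assumes "length iv = k" "length jv = k" "set iv \<subseteq> {..<m}" "set jv \<subseteq> {..<n}" "minor J iv jv \<noteq> 0"
  shows "k \<le> r"
proof -
  interpret Z: prime_set UNIV "{0 :: 'q}" by (rule prime_set_zero)
  have det: "det (entry_mat (\<lambda>i j. J $$ (i, j)) iv jv) \<noteq> 0" using assms(5) by (simp add: minor_eq)
  then have d: "distinct iv" using entry_det_zero[of iv jv "\<lambda>i j. J $$ (i, j)"] assms(1,2) by auto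
  have "indep_mod UNIV {0} (set iv) (\<lambda>i j. J $$ (i, j)) (set jv)"
    by (rule Z.det_notin_imp_indep[OF d]) (use assms det in auto)
  then have "indep_mod UNIV {0} (set iv) (\<lambda>i j. J $$ (i, j)) W"
    using assms(4) unfolding indep_mod_def by blast
  then have "card (set iv) \<le> r" using mat_rank_eq(2)[OF J_carrier assms(3)] by blast
  then show ?thesis using distinct_card[OF d] assms(1) by simp
qed

text \<open>Columns are selected that make the \<open>r\<close> rows a square matrix with
  determinant outside \<open>P\<close>. This minor is nonzero, so both sorted index lists are
  non-singular.\<close>

lemma nonsingular_minor:
  assumes P: "prime_set R P" and X: "X \<subseteq> {..<m}" "card X = r" "indep_mod R P X (\<lambda>i j. J $$ (i, j)) W"
    and R: "\<And>i j. i < m \<Longrightarrow> j < n \<Longrightarrow> J $$ (i, j) \<in> R"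
  shows "\<exists>iv\<in>nonsing_rows J. \<exists>jv\<in>nonsing_cols J. minor J iv jv \<notin> P"
proof -
  interpret P: prime_set R P by fact
  have fX: "finite X" using X(1) finite_subset by blast
  have JR: "J $$ (x, j) \<in> R" if "x \<in> X" "j \<in> W" for x j using R[of x j] X(1) that by auto
  obtain Y where Y: "Y \<subseteq> W" "card Y = card X" "indep_mod R P X (\<lambda>i j. J $$ (i, j)) Y"
    by (rule P.indep_mod_columns[OF fX finite_lessThan[of n] X(3) JR]) (assumption, assumption, rule that)
  have fY: "finite Y" using Y(1) finite_subset by blast
  let ?iv = "sorted_list_of_set X" and ?jv = "sorted_list_of_set Y"
  have "minor J ?iv ?jv \<notin> P"
    unfolding minor_eq by (rule P.det_notin) (use fX fY Y JR in auto)
  moreover from this have "minor J ?iv ?jv \<noteq> 0" by auto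
  moreover have "?iv \<in> increasing_tuples r m" "?jv \<in> increasing_tuples r n"
    using fX fY X(1,2) Y(1,2) by (auto simp: increasing_tuples_def index_tuples_def)
  ultimately show ?thesis
    unfolding nonsing_rows_def nonsing_cols_def Let_def increasing_tuples_def by (simp, blast)
qed

lemma minor_mem:
  assumes "subring_set R" "\<And>i j. i < m \<Longrightarrow> j < n \<Longrightarrow> J $$ (i, j) \<in> R"
    and "set iv \<subseteq> {..<m}" "set jv \<subseteq> {..<n}" "length iv = length jv"
  shows "minor J iv jv \<in> R"
proof -
  interpret subring_set R by fact
  have "iv ! i < m" "jv ! i < n" if "i < length jv" for i
    using that assms(3-5) nth_mem by (metis lessThan_iff subsetD)+
  then show ?thesis unfolding minor_eq using assms(2,5) by (intro det_mem[of _ "length jv"]) auto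
qed

lemma indep_rows_of_minor:
  assumes T: "mult_set T" and P: "prime_set (Loc T) P"
    and iv: "iv \<in> index_tuples r m" and jv: "jv \<in> index_tuples r n" and "minor J iv jv \<notin> P"
  shows "\<exists>X\<subseteq>{..<m}. card X = r \<and> indep_mod B (contract P) X (grad f) W"
proof -
  interpret P: prime_set "Loc T" P by fact
  have t: "length iv = r" "length jv = r" "set iv \<subseteq> {..<m}" "set jv \<subseteq> {..<n}"
    using iv jv by (auto simp: index_tuples_def)
  have det: "det (entry_mat (\<lambda>i j. J $$ (i, j)) iv jv) \<notin> P" using assms(5) by (simp add: minor_eq)
  then have "det (entry_mat (\<lambda>i j. J $$ (i, j)) iv jv) \<noteq> 0" by auto
  then have d: "distinct iv" using entry_det_zero[of iv jv "\<lambda>i j. J $$ (i, j)"] t by auto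
  have "indep_mod (Loc T) P (set iv) (\<lambda>i j. J $$ (i, j)) (set jv)"
    by (rule P.det_notin_imp_indep[OF d _ det]) (use t J_entry_Loc[OF T] in auto)
  then have "indep_mod (Loc T) P (set iv) (\<lambda>i j. J $$ (i, j)) W"
    using t(4) unfolding indep_mod_def by blast
  then have "indep_mod B (contract P) (set iv) (grad f) W"
    by (intro indep_mod_pullback[OF P bar_in_Loc[OF T] t(3)]) (auto simp: contract_def)
  then show ?thesis using t(1,3) distinct_card[OF d] by auto
qed

text \<open>The coefficients of the natural derivation, indexed by all variables. When the entries
  of \<open>jv\<close> are distinct, at most one position contributes.\<close>

definition natural_vec :: "nat list \<Rightarrow> nat list \<Rightarrow> nat \<Rightarrow> 'q" where
  "natural_vec iv jv l = (\<Sum>k\<le>r. if jv ! k = l then (-1) ^ (r + k) * minor J iv (delete_nth k jv) else 0)"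

lemma delete_nth_tuple:
  assumes "length jv = Suc r" "set jv \<subseteq> {..<n}" "k \<le> r"
  shows "length (delete_nth k jv) = r" "set (delete_nth k jv) \<subseteq> {..<n}"
  using assms set_take_subset[of k jv] set_drop_subset[of "Suc k" jv] by (auto simp: delete_nth_def)

section \<open>The natural derivation of one pair of index tuples\<close>

context
  fixes iv jv assumes iv: "iv \<in> nonsing_rows J" and jv: "jv \<in> nonsing_cols_Suc J"
begin

lemma iv_props: "length iv = r" "set iv \<subseteq> {..<m}"
  using iv by (auto simp: nonsing_rows_def increasing_tuples_def index_tuples_def Let_def)

lemma jv_props: "length jv = Suc r" "set jv \<subseteq> {..<n}" "distinct jv"
  using jv sorted_wrt_less_distinct by (auto simp: nonsing_cols_Suc_def increasing_tuples_def index_tuples_def Let_def)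

lemma natural_vec_nth:
  assumes "k \<le> r"
  shows "natural_vec iv jv (jv ! k) = (-1) ^ (r + k) * minor J iv (delete_nth k jv)"
proof -
  have "jv ! k' = jv ! k \<longleftrightarrow> k' = k" if "k' \<le> r" for k'
    using that assms jv_props by (simp add: nth_eq_iff_index_eq)
  then have "natural_vec iv jv (jv ! k) =
      (\<Sum>k'\<le>r. if k' = k then (-1) ^ (r + k) * minor J iv (delete_nth k jv) else 0)"
    unfolding natural_vec_def by (intro sum.cong) auto
  then show ?thesis using assms by simp
qed

lemma natural_vec_notin: "l \<notin> set jv \<Longrightarrow> natural_vec iv jv l = 0"
  unfolding natural_vec_def using jv_props by (intro sum.neutral) (auto simp: less_Suc_eq_le)

text \<open>By \<open>minor_expansion\<close> the value on \<open>f i\<close> is a minor of order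
  \<open>r + 1\<close>, which vanishes because \<open>r\<close> is the rank.\<close>

lemma natural_vec_tangent: "tangent (natural_vec iv jv)"
proof (rule tangentI)
  fix i assume i: "i < m"
  have "directional (natural_vec iv jv) (f i) = (\<Sum>l<n. natural_vec iv jv l * J $$ (i, l))"
    unfolding directional_def using i by (intro sum.cong) (auto simp: J_entry)
  also have "\<dots> = (\<Sum>l<n. \<Sum>k\<le>r. if jv ! k = l then J $$ (i, jv ! k) * ((-1) ^ (r + k) * minor J iv (delete_nth k jv)) else 0)"
    unfolding natural_vec_def sum_distrib_right by (intro sum.cong refl) auto
  also have "\<dots> = (\<Sum>k\<le>r. \<Sum>l<n. if jv ! k = l then J $$ (i, jv ! k) * ((-1) ^ (r + k) * minor J iv (delete_nth k jv)) else 0)"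
    by (rule sum.swap)
  also have "\<dots> = (\<Sum>k\<le>r. J $$ (i, jv ! k) * ((-1) ^ (r + k) * minor J iv (delete_nth k jv)))"
  proof (rule sum.cong)
    fix k assume "k \<in> {..r}"
    then have "jv ! k \<in> set jv" using jv_props(1) by (intro nth_mem) simp
    then have "jv ! k < n" using jv_props(2) by auto
    then show "(\<Sum>l<n. if jv ! k = l then J $$ (i, jv ! k) * ((-1) ^ (r + k) * minor J iv (delete_nth k jv)) else 0) =
        J $$ (i, jv ! k) * ((-1) ^ (r + k) * minor J iv (delete_nth k jv))" by simp
  qed simp
  also have "\<dots> = minor J (iv @ [i]) jv" by (rule minor_expansion[OF iv_props(1) jv_props(1)])
  also have "\<dots> = 0"
  proof (rule ccontr)
    assume "minor J (iv @ [i]) jv \<noteq> 0"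
    then have "Suc r \<le> r"
      using iv_props jv_props i by (intro minor_nonzero_length[of "iv @ [i]" "Suc r" jv]) auto
    then show False by simp
  qed
  finally show "directional (natural_vec iv jv) (f i) = 0" .
qed

lemma natural_vec_in:
  assumes "ideal_set R N" "\<And>k. k \<le> r \<Longrightarrow> minor J iv (delete_nth k jv) \<in> N"
  shows "natural_vec iv jv l \<in> N"
proof -
  interpret N: ideal_set R N by fact
  have "(-1) ^ k \<in> R" for k by auto
  then show ?thesis unfolding natural_vec_def using assms(2) by (intro N.sum_in) auto
qed

context
  fixes T assumes T: "mult_set T"
begin

lemma natural_vec_Loc: "natural_vec iv jv l \<in> Loc T"
proof (rule natural_vec_in[OF Loc_ideal[OF T]])
  fix k assume "k \<le> r"
  then show "minor J iv (delete_nth k jv) \<in> Loc T"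
    using minor_mem[OF subring_Loc[OF T] J_entry_Loc[OF T]] iv_props delete_nth_tuple[OF jv_props(1,2)] by simp
qed

lemma nat_derivation_eq:
  "nat_derivation n bar J (Loc T) iv jv = restrict (vec_derivation (natural_vec iv jv)) (Loc T)"
proof -
  let ?D = "restrict (vec_derivation (natural_vec iv jv)) (Loc T)"
  have jn: "jv ! k < n" if "k \<le> r" for k
  proof -
    have "jv ! k \<in> set jv" using that jv_props(1) by (intro nth_mem) simp
    then show ?thesis using jv_props(2) by auto
  qed
  have val: "?D (bar (Var j)) = natural_vec iv jv j" if "j < n" for j
    using that bar_in_Loc[OF T, of "Var j"] vec_derivation_bar[OF natural_vec_tangent, of "Var j"]
    by (simp add: directional_Var)
  show ?thesis
    unfolding nat_derivation_def Let_def
  proof (rule the_equality)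
    show "?D \<in> Der (\<lambda>c. bar (Const c)) (Loc T) \<and>
      (\<forall>k\<le>r. ?D (bar (Var (jv ! k))) = (-1) ^ (r + k) * minor J iv (delete_nth k jv)) \<and>
      (\<forall>l<n. l \<notin> set jv \<longrightarrow> ?D (bar (Var l)) = 0)"
    proof (intro conjI allI impI)
      show "?D \<in> Der (\<lambda>c. bar (Const c)) (Loc T)"
        by (rule vec_derivation_Der[OF T natural_vec_tangent natural_vec_Loc])
      show "?D (bar (Var (jv ! k))) = (-1) ^ (r + k) * minor J iv (delete_nth k jv)" if "k \<le> r" for k
        using val[OF jn[OF that]] natural_vec_nth[OF that] by (simp only:)
      show "?D (bar (Var l)) = 0" if "l < n" "l \<notin> set jv" for l
        using val[OF that(1)] natural_vec_notin[OF that(2)] by (simp only:)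
    qed
  next
    fix D assume D: "D \<in> Der (\<lambda>c. bar (Const c)) (Loc T) \<and>
      (\<forall>k\<le>r. D (bar (Var (jv ! k))) = (-1) ^ (r + k) * minor J iv (delete_nth k jv)) \<and>
      (\<forall>l<n. l \<notin> set jv \<longrightarrow> D (bar (Var l)) = 0)"
    show "D = ?D"
    proof (rule Der_eq_vec_derivation[OF T _ natural_vec_tangent])
      fix l assume l: "l < n"
      show "natural_vec iv jv l = D (bar (Var l))"
      proof (cases "l \<in> set jv")
        case True
        then obtain k where k: "k < Suc r" "l = jv ! k" using jv_props(1) by (auto simp: in_set_conv_nth)
        then have "k \<le> r" by simp
        then show ?thesis using D natural_vec_nth k(2) by simp
      next
        case False
        then show ?thesis using D natural_vec_notin l by simp
      qed
    qed (use D in blast)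
  qed
qed

end

end

lemma finite_nonsing: "finite (nonsing_rows J)" "finite (nonsing_cols_Suc J)"
  by (rule finite_subset[OF _ finite_increasing_tuples], fastforce simp: nonsing_rows_def nonsing_cols_Suc_def Let_def)+

section \<open>Ideals stable under the natural derivations\<close>

context
  fixes T assumes T: "mult_set T"
begin

lemma nat_derivation_Der:
  "iv \<in> nonsing_rows J \<Longrightarrow> jv \<in> nonsing_cols_Suc J \<Longrightarrow>
    nat_derivation n bar J (Loc T) iv jv \<in> Der (\<lambda>c. bar (Const c)) (Loc T)"
  unfolding nat_derivation_eq[OF _ _ T]
  by (intro vec_derivation_Der T natural_vec_tangent natural_vec_Loc)

lemma operator_ring_natural: "operator_ring (Loc T) (\<lambda>c. bar (Const c)) (nat_der n bar J (Loc T))"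
proof -
  interpret R: subring_set "Loc T" by (rule subring_Loc[OF T])
  have c: "bar (Const c) \<in> Loc T" for c using bar_in_Loc[OF T] by simp
  show ?thesis
  proof
    show "nat_der n bar J (Loc T) \<subseteq> Der (\<lambda>c. bar (Const c)) (Loc T)"
    proof
      fix D assume "D \<in> nat_der n bar J (Loc T)"
      then obtain a where a: "\<forall>iv\<in>nonsing_rows J. \<forall>jv\<in>nonsing_cols_Suc J. a iv jv \<in> Loc T"
        and D: "D = (\<lambda>x\<in>Loc T. \<Sum>iv\<in>nonsing_rows J. \<Sum>jv\<in>nonsing_cols_Suc J. a iv jv * nat_derivation n bar J (Loc T) iv jv x)"
        by (auto simp: nat_der_def)
      define E where "E iv = (\<lambda>x\<in>Loc T. \<Sum>jv\<in>nonsing_cols_Suc J. a iv jv * nat_derivation n bar J (Loc T) iv jv x)" for iv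
      have "E iv \<in> Der (\<lambda>c. bar (Const c)) (Loc T)" if "iv \<in> nonsing_rows J" for iv
        unfolding E_def using that a c nat_derivation_Der by (intro Der_lincomb R.subring_set_axioms) auto
      then have "(\<lambda>x\<in>Loc T. \<Sum>iv\<in>nonsing_rows J. 1 * E iv x) \<in> Der (\<lambda>c. bar (Const c)) (Loc T)"
        using c by (intro Der_lincomb R.subring_set_axioms) auto
      moreover have "(\<lambda>x\<in>Loc T. \<Sum>iv\<in>nonsing_rows J. 1 * E iv x) = D"
        unfolding D E_def by (auto simp: fun_eq_iff restrict_def)
      ultimately show "D \<in> Der (\<lambda>c. bar (Const c)) (Loc T)" by simp
    qed
  qed (rule c)
qed

abbreviation "natural_derivations \<equiv>
  {vec_derivation (natural_vec iv jv) | iv jv. iv \<in> nonsing_rows J \<and> jv \<in> nonsing_cols_Suc J}"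

text \<open>An ideal absorbs coefficients from the ring, so linear combinations of stabilizing
  derivations stabilize it too; indicator coefficients recover a single natural derivation.\<close>

lemma stable_ideal_nat_der:
  "stable_ideal (Loc T) (nat_der n bar J (Loc T)) N \<longleftrightarrow> stable_ideal (Loc T) natural_derivations N"
proof
  assume st: "stable_ideal (Loc T) (nat_der n bar J (Loc T)) N"
  then interpret N: ideal_set "Loc T" N by (simp add: stable_ideal_def)
  show "stable_ideal (Loc T) natural_derivations N"
    unfolding stable_ideal_def
  proof (intro conjI ballI)
    fix D x assume "D \<in> natural_derivations" and x: "x \<in> N"
    then obtain iv jv where D: "D = vec_derivation (natural_vec iv jv)" "iv \<in> nonsing_rows J" "jv \<in> nonsing_cols_Suc J"
      by blast
    define a where "a iv' jv' = (if iv' = iv then if jv' = jv then 1 else 0 else 0 :: 'q)" for iv' jv'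
    have "a iv' jv' \<in> Loc T" for iv' jv' by (simp add: a_def)
    then have "(\<lambda>x\<in>Loc T. \<Sum>iv'\<in>nonsing_rows J. \<Sum>jv'\<in>nonsing_cols_Suc J. a iv' jv' * nat_derivation n bar J (Loc T) iv' jv' x)
        \<in> nat_der n bar J (Loc T)"
      unfolding nat_der_def by blast
    then have "(\<Sum>iv'\<in>nonsing_rows J. \<Sum>jv'\<in>nonsing_cols_Suc J. a iv' jv' * nat_derivation n bar J (Loc T) iv' jv' x) \<in> N"
      using st x N.in_ring[OF x] unfolding stable_ideal_def by force
    also have "(\<Sum>iv'\<in>nonsing_rows J. \<Sum>jv'\<in>nonsing_cols_Suc J. a iv' jv' * nat_derivation n bar J (Loc T) iv' jv' x) =
        (\<Sum>iv'\<in>nonsing_rows J. if iv' = iv then nat_derivation n bar J (Loc T) iv jv x else 0)"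
    proof (rule sum.cong)
      fix iv'
      have "(\<Sum>jv'\<in>nonsing_cols_Suc J. a iv' jv' * nat_derivation n bar J (Loc T) iv' jv' x) =
          (\<Sum>jv'\<in>nonsing_cols_Suc J. if jv' = jv then (if iv' = iv then nat_derivation n bar J (Loc T) iv jv x else 0) else 0)"
        by (rule sum.cong) (auto simp: a_def)
      then show "(\<Sum>jv'\<in>nonsing_cols_Suc J. a iv' jv' * nat_derivation n bar J (Loc T) iv' jv' x) =
          (if iv' = iv then nat_derivation n bar J (Loc T) iv jv x else 0)"
        using D(3) finite_nonsing by simp
    qed simp
    also have "\<dots> = nat_derivation n bar J (Loc T) iv jv x" using D(2) finite_nonsing by simp
    also have "\<dots> = D x" unfolding nat_derivation_eq[OF D(2,3) T] D(1) using N.in_ring[OF x] by simp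
    finally show "D x \<in> N" .
  qed (rule N.ideal_set_axioms)
next
  assume st: "stable_ideal (Loc T) natural_derivations N"
  then interpret N: ideal_set "Loc T" N by (simp add: stable_ideal_def)
  show "stable_ideal (Loc T) (nat_der n bar J (Loc T)) N"
    unfolding stable_ideal_def
  proof (intro conjI ballI)
    fix D x assume "D \<in> nat_der n bar J (Loc T)" and x: "x \<in> N"
    then obtain a where a: "\<forall>iv\<in>nonsing_rows J. \<forall>jv\<in>nonsing_cols_Suc J. a iv jv \<in> Loc T"
      and D: "D = (\<lambda>x\<in>Loc T. \<Sum>iv\<in>nonsing_rows J. \<Sum>jv\<in>nonsing_cols_Suc J. a iv jv * nat_derivation n bar J (Loc T) iv jv x)"
      by (auto simp: nat_der_def)
    have "nat_derivation n bar J (Loc T) iv jv x \<in> N" if "iv \<in> nonsing_rows J" "jv \<in> nonsing_cols_Suc J" for iv jv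
      unfolding nat_derivation_eq[OF that T] using st x N.in_ring[OF x] that by (auto simp: stable_ideal_def)
    then show "D x \<in> N"
      unfolding D using N.in_ring[OF x] a by (auto intro!: N.sum_in)
  qed (rule N.ideal_set_axioms)
qed

lemma simple_module_Loc_iff:
  "simple_left_module (nat_diff_ops n bar J (Loc T)) (evaluation_module (Loc T)) \<longleftrightarrow>
     (\<forall>N. stable_ideal (Loc T) natural_derivations N \<longrightarrow> N = {0} \<or> N = Loc T)"
  "simple_ring (nat_diff_ops n bar J (Loc T)) \<longleftrightarrow>
     simple_left_module (nat_diff_ops n bar J (Loc T)) (evaluation_module (Loc T))"
proof -
  interpret O: operator_ring "Loc T" "\<lambda>c. bar (Const c)" "nat_der n bar J (Loc T)" by (rule operator_ring_natural)
  have eq: "nat_diff_ops n bar J (Loc T) = O.ops"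
    unfolding nat_diff_ops_def Let_def O.ops_def O.gens_def ..
  show "simple_left_module (nat_diff_ops n bar J (Loc T)) (evaluation_module (Loc T)) \<longleftrightarrow>
     (\<forall>N. stable_ideal (Loc T) natural_derivations N \<longrightarrow> N = {0} \<or> N = Loc T)"
    unfolding eq O.simple_module_iff stable_ideal_nat_der ..
  show "simple_ring (nat_diff_ops n bar J (Loc T)) \<longleftrightarrow>
     simple_left_module (nat_diff_ops n bar J (Loc T)) (evaluation_module (Loc T))"
    unfolding eq by (rule O.simple_ring_iff_simple_module)
qed

lemma regular_of_simple_module:
  assumes simple: "\<And>N. stable_ideal (Loc T) natural_derivations N \<Longrightarrow> N = {0} \<or> N = Loc T"
  shows "regular (Loc T)"
  unfolding regular_Loc_iff[OF T] rank_eq[symmetric]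
proof (intro allI impI)
  fix P assume P: "prime_set (Loc T) P"
  interpret P: prime_set "Loc T" P by (rule P)
  show "\<exists>X\<subseteq>{..<m}. card X = r \<and> indep_mod B (contract P) X (grad f) W"
  proof (cases "\<exists>iv\<in>nonsing_rows J. \<exists>jv\<in>index_tuples r n. minor J iv jv \<notin> P")
    case True
    then obtain iv jv where *: "iv \<in> nonsing_rows J" "jv \<in> index_tuples r n" "minor J iv jv \<notin> P" by blast
    then have "iv \<in> index_tuples r m" by (auto simp: nonsing_rows_def increasing_tuples_def Let_def)
    then show ?thesis using indep_rows_of_minor[OF T P] * by blast
  next
    case False
    have "stable_ideal (Loc T) natural_derivations P"
      unfolding stable_ideal_def
    proof (intro conjI ballI)
      fix D x assume "D \<in> natural_derivations" and x: "x \<in> P"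
      then obtain iv jv where D: "D = vec_derivation (natural_vec iv jv)" "iv \<in> nonsing_rows J" "jv \<in> nonsing_cols_Suc J"
        by blast
      have "minor J iv (delete_nth k jv) \<in> P" if "k \<le> r" for k
        using False D(2) delete_nth_tuple[OF jv_props(1,2)[OF D(2,3)] that] by (auto simp: index_tuples_def)
      then have "natural_vec iv jv l \<in> P" for l by (rule natural_vec_in[OF D(2,3) P.ideal_set_axioms])
      then show "D x \<in> P" unfolding D(1)
        by (intro vec_derivation_in[OF T P.ideal_set_axioms natural_vec_tangent[OF D(2,3)]] P.in_ring x)
    qed (rule P.ideal_set_axioms)
    then have "P = {0} \<or> P = Loc T" by (rule simple)
    then have P0: "P = {0}" using P.one_notin P.one_mem by blast
    \<comment> \<open>Over the field \<open>J\<close> has \<open>r\<close> independent rows, so some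
      minor of order \<open>r\<close> is nonzero and the zero prime cannot contain all of
      them.\<close>
    obtain X where X: "X \<subseteq> {..<m}" "card X = r" "indep_mod UNIV {0} X (\<lambda>i j. J $$ (i, j)) W"
      using mat_rank_eq(1)[OF J_carrier] by blast
    obtain iv jv where "iv \<in> nonsing_rows J" "jv \<in> nonsing_cols J" "minor J iv jv \<notin> {0}"
      using nonsingular_minor[OF prime_set_zero X] by auto
    then show ?thesis using False P0 by (auto simp: nonsing_cols_def increasing_tuples_def Let_def)
  qed
qed

text \<open>The natural derivation for \<open>jv\<close> enlarged by \<open>k\<close> involves only the variables in \<open>jv\<close> and \<open>x\<^sub>k\<close>, the
  latter with the given minor as coefficient. Hence modulo \<open>P\<close> a combination of gradients
  of elements of the contraction is determined by its entries in \<open>jv\<close>, and at most \<open>r\<close> of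
  them are independent.\<close>

lemma stable_prime_zero:
  assumes P: "prime_set (Loc T) P" and st: "stable_ideal (Loc T) natural_derivations P"
    and iv: "iv \<in> nonsing_rows J" and jv: "jv \<in> nonsing_cols J" and minor: "minor J iv jv \<notin> P"
  shows "P = {0}"
proof (rule ccontr)
  interpret P: prime_set "Loc T" P by (rule P)
  have C: "prime_set B (contract P)" "I \<subseteq> contract P"
    using prime_contract(1)[OF T P] ideal_contract(2)[OF T P.ideal_set_axioms] by auto
  interpret C: prime_set B "contract P" by (rule C)
  assume "P \<noteq> {0}"
  then obtain x where x: "x \<in> P" "x \<noteq> 0" using P.zero_in by blast
  obtain p s where ps: "x = bar p / bar s" "p \<in> B" "s \<in> T" "s \<in> B" "bar s \<noteq> 0"
    using LocE[OF T P.in_ring[OF x(1)]] by metis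
  have "p \<in> contract P" using x(1) ps frac_in_iff[OF T P.ideal_set_axioms] by (auto simp: contract_def)
  moreover have "p \<notin> I" using x(2) ps bar_eq_0_iff by auto
  ultimately have "I \<subset> contract P" using C(2) by blast
  then have less: "r < grad_rank W (contract P)"
    unfolding rank_eq by (intro grad_rank_strict_mono prime_I C(1)) auto
  have jp: "length jv = r" "set jv \<subseteq> {..<n}" "sorted_wrt (<) jv"
    using jv by (auto simp: nonsing_cols_def increasing_tuples_def index_tuples_def Let_def)
  obtain Z g where Z: "presents W (contract P) W Z g" "grad_rank W (contract P) = card Z"
    using grad_rankE[OF C(1) finite_lessThan] .
  have fZ: "finite Z" using Z(1) finite_subset by (auto simp: presents_def)
  have gC: "g z \<in> contract P" if "z \<in> Z" for z using Z(1) that by (auto simp: presents_def)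
  have gB: "g z \<in> B" "bar (g z) \<in> P" if "z \<in> Z" for z using gC[OF that] by (auto simp: contract_def)
  let ?u = "\<lambda>z j. bar (pdiff j (g z))"
  have ind: "indep_mod (Loc T) P Z ?u W"
    by (rule indep_mod_pushforward[OF C(1) P bar_in_Loc[OF T] _ fZ gB(1)])
      (use Z(1) in \<open>auto simp: contract_def presents_def\<close>)
  have uL: "?u z j \<in> Loc T" if "z \<in> Z" for z j using bar_in_Loc[OF T pdiff_in[OF gB(1)[OF that]]] .
  have "indep_mod (Loc T) P Z ?u (set jv)"
    unfolding indep_mod_def
  proof (intro allI impI)
    fix c assume c: "(\<forall>z\<in>Z. c z \<in> Loc T) \<and> (\<forall>j\<in>set jv. (\<Sum>z\<in>Z. c z * ?u z j) \<in> P)"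
    \<comment> \<open>The combination of gradients as one vector: its entries in \<open>jv\<close>
      are in \<open>P\<close> by assumption, and each remaining entry is isolated by one natural
      derivation.\<close>
    define w where "w j = (\<Sum>z\<in>Z. c z * ?u z j)" for j
    have wL: "w j \<in> Loc T" for j unfolding w_def using c uL by (intro P.sum_mem P.mult_mem) auto
    have wjv: "w j \<in> P" if "j \<in> set jv" for j unfolding w_def using c that by blast
    have "w k \<in> P" if k: "k \<in> W" "k \<notin> set jv" for k
    proof -
      obtain i jv' where jv': "i \<le> length jv" "sorted_wrt (<) jv'" "set jv' = insert k (set jv)"
        "length jv' = Suc (length jv)" "jv' ! i = k" "delete_nth i jv' = jv"
        using insert_into_increasing[OF jp(3) k(2)] .
      have jv'_mem: "jv' \<in> nonsing_cols_Suc J"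
        unfolding nonsing_cols_Suc_def Let_def increasing_tuples_def index_tuples_def
        using jv' jp k jv by auto
      let ?v = "natural_vec iv jv'"
      have vk: "?v k = (-1) ^ (r + i) * minor J iv jv"
        using natural_vec_nth[OF iv jv'_mem, of i] jv' jp by simp
      have vL: "?v l \<in> Loc T" for l by (rule natural_vec_Loc[OF iv jv'_mem T])
      have t: "tangent ?v" by (rule natural_vec_tangent[OF iv jv'_mem])
      have "directional ?v (g z) \<in> P" if "z \<in> Z" for z
        using st gB[OF that] vec_derivation_bar[OF t gB(1)[OF that]] iv jv'_mem unfolding stable_ideal_def by force
      then have "(\<Sum>z\<in>Z. c z * directional ?v (g z)) \<in> P" using c by (intro P.sum_in P.mult_in_right) auto
      also have "(\<Sum>z\<in>Z. c z * directional ?v (g z)) = (\<Sum>z\<in>Z. \<Sum>j<n. ?v j * (c z * ?u z j))"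
        by (simp add: directional_def sum_distrib_left mult.left_commute)
      also have "\<dots> = (\<Sum>j<n. \<Sum>z\<in>Z. ?v j * (c z * ?u z j))" by (rule sum.swap)
      also have "\<dots> = (\<Sum>j<n. ?v j * w j)" by (simp add: w_def sum_distrib_left)
      also have "\<dots> = ?v k * w k + (\<Sum>j\<in>W - {k}. ?v j * w j)" using k(1) by (simp add: sum.remove)
      finally have total: "?v k * w k + (\<Sum>j\<in>W - {k}. ?v j * w j) \<in> P" .
      have "?v j * w j \<in> P" if "j \<in> W - {k}" for j
      proof (cases "j \<in> set jv")
        case True
        then show ?thesis using wjv vL by blast
      next
        case False
        then show ?thesis using natural_vec_notin[OF iv jv'_mem, of j] jv'(3) that by auto
      qed
      then have "(\<Sum>j\<in>W - {k}. ?v j * w j) \<in> P" by (rule P.sum_in)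
      from P.diff_in[OF total this] have "?v k * w k \<in> P" by simp
      moreover have "?v k \<notin> P"
      proof
        assume "?v k \<in> P"
        then have "(-1) ^ (r + i) * ?v k \<in> P" by (intro P.mult_in_right) auto
        moreover have "(-1) ^ (r + i) * ?v k = minor J iv jv"
          unfolding vk by (simp flip: mult.assoc power_add mult_2)
        ultimately show False using minor by simp
      qed
      ultimately show "w k \<in> P" using P.prime_in[OF vL wL] by blast
    qed
    then have "(\<Sum>z\<in>Z. c z * ?u z j) \<in> P" if "j \<in> W" for j using wjv that unfolding w_def by blast
    then show "\<forall>z\<in>Z. c z \<in> P" using indep_modD[OF ind, of c] c by blast
  qed
  then have "card Z \<le> card (set jv)"
    by (rule P.indep_mod_card_le_coords[OF fZ finite_set]) (use uL in auto)
  then show False using less Z(2) card_length[of jv] jp(1) by simp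
qed

text \<open>A stable ideal need not be prime, so it is enlarged to the largest stable ideal inside a
  maximal ideal above it. That ideal is prime, regularity provides a minor outside it, and
  \<open>stable_prime_zero\<close> makes it zero.\<close>

lemma simple_module_of_regular:
  assumes reg: "regular (Loc T)" and N: "stable_ideal (Loc T) natural_derivations N"
  shows "N = {0} \<or> N = Loc T"
proof (rule ccontr)
  assume ne: "\<not> (N = {0} \<or> N = Loc T)"
  interpret R: subring_set "Loc T" by (rule subring_Loc[OF T])
  interpret N: ideal_set "Loc T" N using N by (simp add: stable_ideal_def)
  have "1 \<notin> N"
  proof
    assume "1 \<in> N"
    then have "Loc T \<subseteq> N" using N.mult_in_right[of _ 1] by auto
    then show False using ne N.subset by blast
  qed
  then obtain M where M: "prime_set (Loc T) M" "N \<subseteq> M"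
    using R.noetherian_maximal_ideal[OF noetherian_Loc[OF T] N.ideal_set_axioms] by blast
  interpret M: prime_set "Loc T" M by (rule M)
  let ?P = "largest_stable (Loc T) natural_derivations M"
  have der: "derivation_on (Loc T) D" if "D \<in> natural_derivations" for D
    using that derivation_on_vec_derivation[OF T natural_vec_tangent natural_vec_Loc[OF _ _ T]] by blast
  have P: "prime_set (Loc T) ?P" by (rule M.prime_largest_stable[OF der inverse_of_nat_in_Loc[OF T]])
  have st: "stable_ideal (Loc T) natural_derivations ?P" by (rule M.stable_largest_stable[OF der])
  have NP: "N \<subseteq> ?P" by (rule M.largest_stable_maximal[OF der N M(2)])
  obtain X where X: "X \<subseteq> {..<m}" "card X = r" "indep_mod B (contract ?P) X (grad f) W"
    using reg P unfolding regular_Loc_iff[OF T] rank_eq[symmetric] by blast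
  have fX: "finite X" using X(1) finite_subset by blast
  have "indep_mod (Loc T) ?P X (\<lambda>i j. bar (pdiff j (f i))) W"
    by (rule indep_mod_pushforward[OF prime_contract(1)[OF T P] P bar_in_Loc[OF T] _ fX _ X(3)])
      (use X(1) f_B in \<open>auto simp: contract_def\<close>)
  moreover have "(\<Sum>i\<in>X. c i * J $$ (i, j)) = (\<Sum>i\<in>X. c i * bar (pdiff j (f i)))" if "j \<in> W" for c j
    using that X(1) by (intro sum.cong) (auto simp: J_entry subset_iff)
  ultimately have "indep_mod (Loc T) ?P X (\<lambda>i j. J $$ (i, j)) W"
    unfolding indep_mod_def by simp
  then obtain iv jv where "iv \<in> nonsing_rows J" "jv \<in> nonsing_cols J" "minor J iv jv \<notin> ?P"
    using nonsingular_minor[OF P X(1,2) _ J_entry_Loc[OF T]] by blast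
  then have "?P = {0}" using stable_prime_zero[OF P st] by blast
  then show False using NP ne N.zero_in by blast
qed

theorem natural_operators_equivalences:
  "regular (Loc T) \<longleftrightarrow> simple_ring (nat_diff_ops n bar J (Loc T))"
  "simple_ring (nat_diff_ops n bar J (Loc T)) \<longleftrightarrow>
     simple_left_module (nat_diff_ops n bar J (Loc T)) (evaluation_module (Loc T))"
  using simple_module_Loc_iff regular_of_simple_module simple_module_of_regular by blast+

end

end

section \<open>From the quotient ring to its image in the fraction field\<close>

lemma affine_domain_reduction:
  fixes f :: "nat \<Rightarrow> 'k::field_char_0 mpoly" and \<iota> :: "'k mpoly set \<Rightarrow> 'q::field"
  assumes f: "\<forall>i<m. f i \<in> carrier (poly_ring n)"
    and I: "I = genideal (poly_ring n) (f ` {..<m})" "primeideal I (poly_ring n)"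
    and A: "A = poly_ring n Quot I" and \<iota>: "fraction_field A \<iota>"
  shows "affine_domain n m f I (reduction n I \<iota>)"
    and "reduction n I \<iota> ` polys_in {..<n} = \<iota> ` carrier A"
    and "p \<in> polys_in {..<n} \<Longrightarrow> I +>\<^bsub>poly_ring n\<^esub> p \<in> carrier A"
proof -
  let ?R = "poly_ring n :: 'k mpoly ring"
  let ?B = "polys_in {..<n} :: 'k mpoly set"
  let ?bar = "reduction n I \<iota>"
  interpret I: primeideal I ?R by (rule I(2))
  have cR: "carrier ?R = ?B" by (simp add: poly_ring_eq)
  have prime: "prime_set ?B I"
    using I(2) unfolding poly_ring_eq by (rule polys.primeideal_subring_of_iff[THEN iffD1])
  interpret P: prime_set ?B I by (rule prime)
  have hom: "(+>\<^bsub>?R\<^esub>) I \<in> Ring.ring_hom ?R A" unfolding A by (rule I.rcos_ring_hom)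
  have \<iota>hom: "\<iota> \<in> Ring.ring_hom A (subring_of UNIV)" and inj: "inj_on \<iota> (carrier A)"
    and frac: "\<And>q. \<exists>a\<in>carrier A. \<exists>b\<in>carrier A. \<iota> b \<noteq> 0 \<and> q = \<iota> a / \<iota> b"
    using \<iota> unfolding fraction_field_def by auto
  show cl: "I +>\<^bsub>?R\<^esub> p \<in> carrier A" if "p \<in> ?B" for p using ring_hom_closed[OF hom] that cR by auto
  have surj: "\<exists>p\<in>?B. x = I +>\<^bsub>?R\<^esub> p" if "x \<in> carrier A" for x
    using that unfolding A FactRing_def A_RCOSETS_def' by (auto simp: cR)
  show "?bar ` ?B = \<iota> ` carrier A"
    using cl surj unfolding reduction_def by blast
  have add: "?bar (p + q) = ?bar p + ?bar q" if "p \<in> ?B" "q \<in> ?B" for p q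
    using ring_hom_add[OF hom, of p q] ring_hom_add[OF \<iota>hom cl[OF that(1)] cl[OF that(2)]] that cR
    by (simp add: reduction_def poly_ring_eq)
  have mult: "?bar (p * q) = ?bar p * ?bar q" if "p \<in> ?B" "q \<in> ?B" for p q
    using ring_hom_mult[OF hom, of p q] ring_hom_mult[OF \<iota>hom cl[OF that(1)] cl[OF that(2)]] that cR
    by (simp add: reduction_def poly_ring_eq)
  have one: "?bar 1 = 1"
    using ring_hom_one[OF hom] ring_hom_one[OF \<iota>hom] by (simp add: reduction_def poly_ring_eq)
  have zero: "?bar 0 = 0" using add[of 0 0] by (metis add_cancel_left_left add_0 polys.zero_mem)
  have I0: "I +>\<^bsub>?R\<^esub> p = I \<longleftrightarrow> p \<in> I" if "p \<in> ?B" for p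
    using I.a_rcos_self[of p] I.a_rcos_const[of p] that cR by auto
  have eq0: "?bar p = 0 \<longleftrightarrow> p \<in> I" if p: "p \<in> ?B" for p
  proof -
    have "?bar p = 0 \<longleftrightarrow> \<iota> (I +>\<^bsub>?R\<^esub> p) = \<iota> (I +>\<^bsub>?R\<^esub> 0)" using zero by (simp add: reduction_def)
    also have "\<dots> \<longleftrightarrow> I +>\<^bsub>?R\<^esub> p = I +>\<^bsub>?R\<^esub> 0" using inj_on_eq_iff[OF inj cl[OF p] cl] by simp
    also have "I +>\<^bsub>?R\<^esub> 0 = I" using I0[of 0] by simp
    finally show ?thesis using I0[OF p] by simp
  qed
  have gen: "I = {\<Sum>i<m. a i * f i | a. \<forall>i<m. a i \<in> ?B}"
  proof -
    have "f ` {..<m} \<subseteq> ?B" using f cR by auto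
    from polys.genideal_eq[OF finite_lessThan this] show ?thesis
      unfolding I(1) poly_ring_eq by (simp add: Ball_def)
  qed
  show "affine_domain n m f I ?bar"
  proof
    fix i assume i: "i < m"
    show "f i \<in> I" unfolding I(1) genideal_def using i by blast
  next
    fix p assume "p \<in> I"
    then show "\<exists>a. (\<forall>i<m. a i \<in> ?B) \<and> p = (\<Sum>i<m. a i * f i)" using gen by blast
  next
    fix x
    obtain a b where ab: "a \<in> carrier A" "b \<in> carrier A" "\<iota> b \<noteq> 0" "x = \<iota> a / \<iota> b" using frac[of x] by blast
    obtain p where p: "p \<in> ?B" "a = I +>\<^bsub>?R\<^esub> p" using surj[OF ab(1)] by blast
    obtain q where q: "q \<in> ?B" "b = I +>\<^bsub>?R\<^esub> q" using surj[OF ab(2)] by blast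
    have "?bar q \<noteq> 0" "x = ?bar p / ?bar q" using ab(3,4) p(2) q(2) by (simp_all add: reduction_def)
    then show "\<exists>p\<in>?B. \<exists>s\<in>?B. ?bar s \<noteq> 0 \<and> x = ?bar p / ?bar s" using p(1) q(1) by blast
  qed (use prime add mult one eq0 in \<open>auto simp: P.subset P.in_ring P.prime_in\<close>)
qed

theorem theorem4p4:
  fixes n m :: nat
    and f :: "nat \<Rightarrow> 'k::field_char_0 mpoly"
    and I :: "'k mpoly set"
    and A :: "'k mpoly set ring"
    and \<iota> :: "'k mpoly set \<Rightarrow> 'q::field"
    and S :: "'k mpoly set set"
    and bar :: "'k mpoly \<Rightarrow> 'q"
    and J :: "'q mat"
    and \<A> :: "'q set"
    and \<DD> :: "('q \<Rightarrow> 'q) ring"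
  assumes "\<forall>i<m. f i \<in> carrier (poly_ring n)"
    and "I = genideal (poly_ring n) (f ` {..<m})"
    and "primeideal I (poly_ring n)"
    and "\<not> maximalideal I (poly_ring n)"
    and "A = poly_ring n Quot I"
    and "fraction_field A \<iota>"
    and "submonoid S A"
    and "\<zero>\<^bsub>A\<^esub> \<notin> S"
    and "bar = reduction n I \<iota>"
    and "J = jacobi_matrix m n f bar"
    and "\<A> = fractions (\<iota> ` carrier A) (\<iota> ` S)"
    and "\<DD> = nat_diff_ops n bar J \<A>"
  shows "(regular \<A> \<longleftrightarrow> simple_ring \<DD>) \<and>
         (simple_ring \<DD> \<longleftrightarrow> simple_left_module \<DD> (evaluation_module \<A>))"
proof -
  interpret affine_domain n m f I bar
    unfolding assms(9) by (rule affine_domain_reduction(1)[OF assms(1-3,5,6)])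
  interpret S: submonoid S A by (rule assms(7))
  note img = affine_domain_reduction(2)[OF assms(1-3,5,6), folded assms(9)]
  \<comment> \<open>The full preimage of \<open>S\<close> in the polynomial ring, so that
    denominators become polynomials as in \<open>Loc\<close>.\<close>
  define T where "T = {s \<in> B. bar s \<in> \<iota> ` S}"
  have \<iota>hom: "\<iota> \<in> Ring.ring_hom A (subring_of UNIV)" and inj: "inj_on \<iota> (carrier A)"
    using assms(6) unfolding fraction_field_def by auto
  have SA: "\<iota> ` S \<subseteq> bar ` B" unfolding img using S.subset by blast
  have barT: "bar ` T = \<iota> ` S"
  proof
    show "\<iota> ` S \<subseteq> bar ` T"
    proof
      fix x assume x: "x \<in> \<iota> ` S"
      then obtain p where "p \<in> B" "x = bar p" using SA by (meson imageE subsetD)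
      then show "x \<in> bar ` T" using x by (simp add: T_def)
    qed
  qed (auto simp: T_def)
  have "mult_set T"
    unfolding mult_set_def
  proof (intro conjI ballI)
    show "T \<subseteq> B" by (auto simp: T_def)
    have "bar 1 = \<iota> \<one>\<^bsub>A\<^esub>" using ring_hom_one[OF \<iota>hom] bar_one by simp
    then show "1 \<in> T" unfolding T_def using S.one_closed by blast
    fix s t assume "s \<in> T" "t \<in> T"
    then obtain x y where *: "s \<in> B" "t \<in> B" "x \<in> S" "y \<in> S" "bar s = \<iota> x" "bar t = \<iota> y" by (auto simp: T_def)
    have "\<iota> (x \<otimes>\<^bsub>A\<^esub> y) = \<iota> x * \<iota> y"
      using ring_hom_mult[OF \<iota>hom, of x y] *(3,4) S.subset by (simp add: subset_iff)
    then have "bar (s * t) = \<iota> (x \<otimes>\<^bsub>A\<^esub> y)" using * by (simp add: bar_mult)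
    moreover have "s * t \<in> B" "x \<otimes>\<^bsub>A\<^esub> y \<in> S" using *(1-4) S.m_closed by simp_all
    ultimately show "s * t \<in> T" unfolding T_def by blast
  next
    show "T \<inter> I = {}"
    proof (rule ccontr)
      assume "T \<inter> I \<noteq> {}"
      then obtain s x where s: "s \<in> B" "s \<in> I" "x \<in> S" "bar s = \<iota> x" by (auto simp: T_def)
      interpret I': primeideal I "poly_ring n" by (rule assms(3))
      have ringA: "ring A" unfolding assms(5) by (rule I'.quotient_is_ring)
      have R: "ring (subring_of (UNIV :: 'q set))"
        using subring_set.cring_subring_of[OF subring_set_UNIV] cring.axioms(1) by blast
      have "\<iota> \<zero>\<^bsub>A\<^esub> = 0" using ring_hom_zero[OF \<iota>hom ringA R] by simp
      moreover have "\<iota> x = 0" using s(4) bar_eq_0_iff[OF s(1)] s(2) by (simp only:)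
      moreover have "\<zero>\<^bsub>A\<^esub> \<in> carrier A" using ringA by (simp add: ring.ring_simprules(2))
      ultimately have "x = \<zero>\<^bsub>A\<^esub>" using inj_onD[OF inj] s(3) S.subset by auto
      then show False using assms(8) s(3) by simp
    qed
  qed
  moreover have "\<A> = Loc T"
    unfolding assms(11) Loc_def fractions_def img[symmetric] barT[symmetric] by blast
  ultimately show ?thesis
    using natural_operators_equivalences[of T] unfolding assms(10,12) by simp
qed

end
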